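(* Let $(x,u)\in\mathcal S$ with $\theta<0$, let $d$ be its mode insertion gradient, and let $J(\gamma):=J(\mathcal P(x,u-\gamma d))$. Define $$\hat J(1;\gamma):=J(0)+\sum_{i\in I_1}(-1)^{\omega_i}\frac{\theta^3}{\dot d_{\sigma_{i+\omega_i}}(T_i(\gamma_0^+))}(\gamma-\gamma_0),$$ $$\hat J(2;\gamma):=J(0)-\sum_{i\in I_2}\frac{\sqrt2\,\theta^2}{\ddot d_{\sigma_{i+\omega_i}}(T_i(\gamma_0^+))^{1/2}}(\gamma-\gamma_0)^{1/2}.$$ Set $J(\gamma)=\hat J(\overline m;\gamma)+R(\gamma)$, where $R(\gamma)$ is the remainder. If $\overline m=1$ or $\overline m=2$, then there exists $\delta\gamma>0$ such that for all $\gamma\in(\gamma_0,\gamma_0+\delta\gamma)$, $$|\hat J(\overline m;\gamma)-J(0)|\ge|R(\gamma)|.$$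
   Context: Setting. Fix $T>0$, $x_0\in\mathbb R^n$, modes $f_1,\dots,f_N:\mathbb R^n\to\mathbb R^n$ and a running cost $\ell:\mathbb R^n\to\mathbb R$. Standing assumption: each $f_i$ and $\ell$ are $C^2$ on $\mathbb R^n$ with $\|D^2f_i(x)\|\le K_2$, $\|D^2\ell(x)\|\le\overline K_2$ for all $x$, for some constants. A switching control is a piecewise constant $u=[u_1,\dots,u_N]^T$ on $[0,T]$ with $u_i(t)\in\{0,1\}$ and $\sum_iu_i(t)=1$ for a.e. $t$. It is equivalently described by its mode schedule $(\Sigma,\mathcal T)$, $\Sigma=[\sigma_1,\dots,\sigma_M]$, $\mathcal T=[T_1<\dots<T_{M-1}]$, through $u(t)=e_{\sigma_i}$ for $t\in[T_{i-1},T_i)$, $T_0=0$, $T_M=T$ ($e_j$ is the $j$th standard basis vector); the $T_i$ are the switching times. $u$ is non-chattering if for some $\delta t>0$ all adjacent switching times differ by more than $\delta t$; $\Omega$ is the set of non-chattering switching controls. $\mathcal X$, $\mathcal U$ are the Lebesgue integrable functions from $[0,T]$ to $\mathbb R^n$, $\mathbb R^N$. With $F(x,u)=\sum_iu_if_i(x)$, $\mathcal S$ is the set of $(x,u)\in\mathcal X\times\mathcal U$ with $u\in\Omega$ and $\dot x=F(x,u)$, $x(0)=x_0$ (in integral form). The cost is $J(x,u)=\int_0^T\ell(x(\tau))\,d\tau$. The adjoint $\rho$ solves $\dot\rho=-D_1F(x,u)^T\rho-D\ell(x)^T$, $\rho(T)=0$. The mode insertion gradient of $J$ at $(x,u)$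 is $d=[d_1,\dots,d_N]^T$, $d_a(t)=\rho(t)^T(f_a(x(t))-F(x(t),u(t)))$. Double indices denote differences: $d_{ab}=d_a-d_b$. Projection. $\mathcal Q_i(\mu(t))=\prod_{j\ne i}1(\mu_i(t)-\mu_j(t))$ with $1(s)=1$ for $s\ge0$, $1(s)=0$ for $s<0$. $\mathcal R\subset\mathcal U$ is the set of $\mu$ with $\mathcal Q(\mu)\in\Omega$. $\mathcal P(\alpha,\mu)=(x,u)$ for $(\alpha,\mu)\in\mathcal X\times\mathcal R$, where $u=\mathcal Q(\mu)$ and $x$ solves $\dot x=F(x,u)$, $x(0)=x_0$. Standing assumption: $d$ is piecewise continuous and for $i\neq j$ the function $d_i-d_j$ has finitely many critical points in $[0,T]$ (points where its derivative vanishes or it is not differentiable); this guarantees $u-\gamma d\in\mathcal R$ for $\gamma>0$. Optimality function and schedule. $\theta=\theta(x,u):=\min_{\sigma\in\{1,\dots,N\},\,t\in[0,T]}d_\sigma(t)$ (the lower bound of $d$ over modes and times), and $\gamma_0:=-1/\theta$ when $\theta<0$. $(\Sigma(\gamma),\mathcal T(\gamma))$ is the mode schedule of $\mathcal Q(u-\gamma d)$, with $\mathcal T(\gamma)=[T_1(\gamma),\dots,T_{M-1}(\gamma)]$. The mode sequence $\Sigma(\gamma)=[\sigma_1,\dots,\sigma_M]$ is constant for $\gamma$ in some interval $(\gamma_0,\gamma_0+\delta)$. The superscript $+$ denotes a limit from the right: $T_i(\gamma_0^+)=\lim_{\gamma\downarrow\gamma_0}T_i(\gamma)$, and values of $d$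 and its time derivatives at $T_i(\gamma_0^+)$ are the limits of the values at $T_i(\gamma)$ as $\gamma\downarrow\gamma_0$. Types. $T_i(\gamma_0^+)$, between modes $\sigma_i$ and $\sigma_{i+1}$ of $\Sigma(\gamma_0^+)$, has type $m(T_i(\gamma_0^+))=0$ if $T_i(\gamma)$ is constant for $\gamma\in(\gamma_0,\gamma_0+\delta\gamma)$ for some $\delta\gamma>0$; otherwise $m(T_i(\gamma_0^+))=\min\{m\in\mathbb N: D^md_{\sigma_i\sigma_{i+1}}(T_i(\gamma_0^+))\ne0\}$. $I_j$ ($j=1,2$) is the set of $i\in\{1,\dots,M-1\}$ with $m(T_i(\gamma_0^+))=j$, and $\overline m=\max_im(T_i(\gamma_0^+))$. $\omega_i=0$ if there is $\delta\gamma>0$ with $T_i(\gamma)>T_i(\gamma_0^+)$ for $\gamma\in(\gamma_0,\gamma_0+\delta\gamma)$, and $\omega_i=1$ if instead $T_i(\gamma)<T_i(\gamma_0^+)$ there. *)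

theory Defs
  imports "HOL-Analysis.Analysis" "HOL-Library.Extended_Nat"
begin

(* Modes are indexed by a finite type 'm, so N = CARD('m), and R^N is real^'m with standard
   basis vectors "axis j 1". *)

definition C2_bounded :: "('a::real_normed_vector \<Rightarrow> 'b::real_normed_vector) \<Rightarrow> real \<Rightarrow> bool" where
  "C2_bounded g K \<longleftrightarrow>
    (\<exists>g' :: 'a \<Rightarrow> ('a \<Rightarrow>\<^sub>L 'b). \<exists>g'' :: 'a \<Rightarrow> ('a \<Rightarrow>\<^sub>L ('a \<Rightarrow>\<^sub>L 'b)).
      (\<forall>x. (g has_derivative blinfun_apply (g' x)) (at x)) \<and>
      (\<forall>x. (g' has_derivative blinfun_apply (g'' x)) (at x)) \<and>
      continuous_on UNIV g'' \<and> (\<forall>x. norm (g'' x) \<le> K))"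

definition L1_functions :: "real \<Rightarrow> (real \<Rightarrow> 'a::euclidean_space) set" where
  "L1_functions T = {x. x absolutely_integrable_on {0..T}}"

(* s i is the switching time T_i for i = 1, ..., M - 1, with s 0 = 0 and s M = T; sg i is the
   i-th mode, i = 1, ..., M.  Consecutive modes differ, which makes the schedule of a control
   unique on the relevant indices.  The control is identified up to null sets: mode_selector
   below has several entries equal to 1 at ties. *)
definition mode_schedule ::
    "real \<Rightarrow> nat \<Rightarrow> (nat \<Rightarrow> 'm::finite) \<Rightarrow> (nat \<Rightarrow> real) \<Rightarrow> (real \<Rightarrow> real^'m) \<Rightarrow> bool" where
  "mode_schedule T M sg s u \<longleftrightarrow>
    1 \<le> M \<and> s 0 = 0 \<and> s M = T \<and>
    (\<forall>i\<in>{1..M}. s (i - 1) < s i) \<and>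
    (\<forall>i\<in>{1..<M}. sg i \<noteq> sg (i + 1)) \<and>
    (\<forall>i\<in>{1..M}. AE t in lebesgue. t \<in> {s (i - 1)..<s i} \<longrightarrow> u t = axis (sg i) 1)"

definition non_chattering_controls :: "real \<Rightarrow> (real \<Rightarrow> real^'m::finite) set" where
  "non_chattering_controls T =
    {u. \<exists>M sg s. mode_schedule T M sg s u \<and>
          (\<exists>dt>0. \<forall>i\<in>{1..M}. s i - s (i - 1) > dt)}"

definition F :: "('m::finite \<Rightarrow> real^'n \<Rightarrow> real^'n) \<Rightarrow> real^'n \<Rightarrow> real^'m \<Rightarrow> real^'n" where
  "F f y w = (\<Sum>i\<in>UNIV. (w $ i) *\<^sub>R f i y)"

definition solves_state_eq ::
    "real \<Rightarrow> real^'n \<Rightarrow> ('m::finite \<Rightarrow> real^'n \<Rightarrow> real^'n) \<Rightarrow> (real \<Rightarrow> real^'m) \<Rightarrow> (real \<Rightarrow> real^'n) \<Rightarrow> bool"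
  where
  "solves_state_eq T x0 f u x \<longleftrightarrow>
    (\<forall>t\<in>{0..T}. ((\<lambda>s. F f (x s) (u s)) has_integral (x t - x0)) {0..t})"

definition feasible_pairs ::
    "real \<Rightarrow> real^'n \<Rightarrow> ('m::finite \<Rightarrow> real^'n \<Rightarrow> real^'n) \<Rightarrow> ((real \<Rightarrow> real^'n) \<times> (real \<Rightarrow> real^'m)) set"
  where
  "feasible_pairs T x0 f =
    {(x, u). x \<in> L1_functions T \<and> u \<in> L1_functions T \<and>
             u \<in> non_chattering_controls T \<and> solves_state_eq T x0 f u x}"

definition cost :: "real \<Rightarrow> (real^'n \<Rightarrow> real) \<Rightarrow> (real \<Rightarrow> real^'n) \<times> (real \<Rightarrow> real^'m::finite) \<Rightarrow> real" where
  "cost T l z = integral {0..T} (\<lambda>t. l (fst z t))"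

(* Integral form of rho' = - D_1F(x,u)^T rho - Dl(x)^T with rho(T) = 0; the column vector
   Dl(x)^T is the transpose of the functional Dl(x) applied to 1. *)
definition solves_adjoint_eq ::
    "real \<Rightarrow> ('m::finite \<Rightarrow> real^'n \<Rightarrow> real^'n) \<Rightarrow> (real^'n \<Rightarrow> real) \<Rightarrow>
      (real \<Rightarrow> real^'n) \<Rightarrow> (real \<Rightarrow> real^'m) \<Rightarrow> (real \<Rightarrow> real^'n) \<Rightarrow> bool" where
  "solves_adjoint_eq T f l x u rho \<longleftrightarrow>
    (\<forall>t\<in>{0..T}.
      ((\<lambda>s. adjoint (frechet_derivative (\<lambda>y. F f y (u s)) (at (x s))) (rho s)
           + adjoint (frechet_derivative l (at (x s))) 1) has_integral rho t) {t..T})"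

definition mode_insertion_gradient ::
    "('m::finite \<Rightarrow> real^'n \<Rightarrow> real^'n) \<Rightarrow> (real \<Rightarrow> real^'n) \<Rightarrow>
      (real \<Rightarrow> real^'n) \<Rightarrow> (real \<Rightarrow> real^'m) \<Rightarrow> real \<Rightarrow> real^'m" where
  "mode_insertion_gradient f rho x u t = (\<chi> a. rho t \<bullet> (f a (x t) - F f (x t) (u t)))"

definition unit_step :: "real \<Rightarrow> real" where
  "unit_step s = (if 0 \<le> s then 1 else 0)"

definition mode_selector :: "(real \<Rightarrow> real^'m::finite) \<Rightarrow> real \<Rightarrow> real^'m" where
  "mode_selector mu t = (\<chi> i. \<Prod>j\<in>UNIV - {i}. unit_step (mu t $ i - mu t $ j))"

(* The projection does not depend on its argument alpha.  Solutions of the state equation are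
   unique on {0..T}, and the cost only sees that interval, so the choice is immaterial. *)
definition projection ::
    "real \<Rightarrow> real^'n \<Rightarrow> ('m::finite \<Rightarrow> real^'n \<Rightarrow> real^'n) \<Rightarrow> (real \<Rightarrow> real^'n) \<Rightarrow> (real \<Rightarrow> real^'m) \<Rightarrow>
      (real \<Rightarrow> real^'n) \<times> (real \<Rightarrow> real^'m)" where
  "projection T x0 f alpha mu =
    ((SOME y. y \<in> L1_functions T \<and> solves_state_eq T x0 f (mode_selector mu) y),
     mode_selector mu)"

definition piecewise_continuous_on :: "real \<Rightarrow> real \<Rightarrow> (real \<Rightarrow> 'a::topological_space) \<Rightarrow> bool" where
  "piecewise_continuous_on a b g \<longleftrightarrow>
    (\<exists>S. finite S \<and> continuous_on ({a..b} - S) g) \<and>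
    (\<forall>t\<in>{a<..b}. \<exists>L. (g \<longlongrightarrow> L) (at_left t)) \<and>
    (\<forall>t\<in>{a..<b}. \<exists>L. (g \<longlongrightarrow> L) (at_right t))"

definition critical_points :: "real \<Rightarrow> (real \<Rightarrow> real) \<Rightarrow> real set" where
  "critical_points T g =
    {t\<in>{0..T}. (g has_real_derivative 0) (at t within {0..T}) \<or>
               \<not> g differentiable (at t within {0..T})}"

(* An infimum: d jumps at the switching times of u, so the lower bound may be approached only
   as a one-sided limit. *)
definition optimality_function :: "real \<Rightarrow> (real \<Rightarrow> real^'m::finite) \<Rightarrow> real" where
  "optimality_function T d = (INF (a, t)\<in>UNIV \<times> {0..T}. d t $ a)"

(* Below, Ts gamma i is the switching time T_i(gamma). *)

definition switch_limit :: "real \<Rightarrow> (real \<Rightarrow> nat \<Rightarrow> real) \<Rightarrow> nat \<Rightarrow> real" where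
  "switch_limit g0 Ts i = Lim (at_right g0) (\<lambda>g. Ts g i)"

(* The k-th time derivative of h at T_i(gamma_0^+). *)
definition deriv_at_switch ::
    "real \<Rightarrow> (real \<Rightarrow> nat \<Rightarrow> real) \<Rightarrow> nat \<Rightarrow> (real \<Rightarrow> real) \<Rightarrow> nat \<Rightarrow> real" where
  "deriv_at_switch g0 Ts k h i = Lim (at_right g0) (\<lambda>g. (deriv ^^ k) h (Ts g i))"

(* The minimum ranges over k \<ge> 1 (k = 0 would always qualify, the difference having the value
   \<theta> or - \<theta> there); it is \<infinity> if no such k exists. *)
definition switch_type ::
    "real \<Rightarrow> (real \<Rightarrow> real^'m::finite) \<Rightarrow> (nat \<Rightarrow> 'm) \<Rightarrow> (real \<Rightarrow> nat \<Rightarrow> real) \<Rightarrow> nat \<Rightarrow> enat" where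
  "switch_type g0 d sg Ts i =
    (if \<exists>c. \<forall>\<^sub>F g in at_right g0. Ts g i = c then 0
     else Inf {enat k | k. 1 \<le> k \<and>
            deriv_at_switch g0 Ts k (\<lambda>t. d t $ sg i - d t $ sg (i + 1)) i \<noteq> 0})"

definition switches_of_type ::
    "real \<Rightarrow> (real \<Rightarrow> real^'m::finite) \<Rightarrow> nat \<Rightarrow> (nat \<Rightarrow> 'm) \<Rightarrow> (real \<Rightarrow> nat \<Rightarrow> real) \<Rightarrow> enat \<Rightarrow> nat set" where
  "switches_of_type g0 d M sg Ts j = {i\<in>{1..M - 1}. switch_type g0 d sg Ts i = j}"

definition max_switch_type ::
    "real \<Rightarrow> (real \<Rightarrow> real^'m::finite) \<Rightarrow> nat \<Rightarrow> (nat \<Rightarrow> 'm) \<Rightarrow> (real \<Rightarrow> nat \<Rightarrow> real) \<Rightarrow> enat" where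
  "max_switch_type g0 d M sg Ts = Max (switch_type g0 d sg Ts ` {1..M - 1})"

(* Switching times of nonzero type eventually stay on one side of their limit, so for these
   the value 1 means that T_i(gamma) approaches its limit from below. *)
definition switch_side :: "real \<Rightarrow> (real \<Rightarrow> nat \<Rightarrow> real) \<Rightarrow> nat \<Rightarrow> nat" where
  "switch_side g0 Ts i =
    (if \<forall>\<^sub>F g in at_right g0. Ts g i > switch_limit g0 Ts i then 0 else 1)"

definition J_hat1 ::
    "real \<Rightarrow> real \<Rightarrow> real \<Rightarrow> (real \<Rightarrow> real^'m::finite) \<Rightarrow> nat \<Rightarrow> (nat \<Rightarrow> 'm) \<Rightarrow>
      (real \<Rightarrow> nat \<Rightarrow> real) \<Rightarrow> real \<Rightarrow> real" where
  "J_hat1 J0 theta g0 d M sg Ts g =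
    J0 + (\<Sum>i\<in>switches_of_type g0 d M sg Ts 1.
           (- 1) ^ switch_side g0 Ts i *
           (theta ^ 3 / deriv_at_switch g0 Ts 1 (\<lambda>t. d t $ sg (i + switch_side g0 Ts i)) i) *
           (g - g0))"

definition J_hat2 ::
    "real \<Rightarrow> real \<Rightarrow> real \<Rightarrow> (real \<Rightarrow> real^'m::finite) \<Rightarrow> nat \<Rightarrow> (nat \<Rightarrow> 'm) \<Rightarrow>
      (real \<Rightarrow> nat \<Rightarrow> real) \<Rightarrow> real \<Rightarrow> real" where
  "J_hat2 J0 theta g0 d M sg Ts g =
    J0 - (\<Sum>i\<in>switches_of_type g0 d M sg Ts 2.
           (sqrt 2 * theta ^ 2 /
             sqrt (deriv_at_switch g0 Ts 2 (\<lambda>t. d t $ sg (i + switch_side g0 Ts i)) i)) *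
           sqrt (g - g0))"

definition J_hat ::
    "enat \<Rightarrow> real \<Rightarrow> real \<Rightarrow> real \<Rightarrow> (real \<Rightarrow> real^'m::finite) \<Rightarrow> nat \<Rightarrow> (nat \<Rightarrow> 'm) \<Rightarrow>
      (real \<Rightarrow> nat \<Rightarrow> real) \<Rightarrow> real \<Rightarrow> real" where
  "J_hat m J0 theta g0 d M sg Ts g =
    (if m = 1 then J_hat1 J0 theta g0 d M sg Ts g
     else if m = 2 then J_hat2 J0 theta g0 d M sg Ts g
     else undefined)"

end

theory Submission
  imports Defs
begin

text \<open>
  Write \<open>A = Jhat - J 0\<close> for the predicted and \<open>B = J \<gamma> - J 0\<close> for the true change of the cost. The
  remainder is \<open>B - A\<close>, so the claim holds as soon as \<open>B\<close> lies between \<open>2 A\<close> and \<open>0\<close>. For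
  this, one-sided bounds on \<open>B\<close> and \<open>A\<close> suffice.

  Let \<open>\<nu>\<close> be the time during which the projected control differs from \<open>u\<close>. The adjoint equation gives
  \<open>B = w + O(\<nu>\<^sup>2)\<close>, where \<open>w\<close> is the integral of the component of \<open>d\<close> belonging to the inserted mode over
  the set of insertion (\<open>cost_first_order_expansion\<close>, \<open>projection_cost_expansion\<close>). The modes may grow
  quadratically, so it also has to be shown that the perturbed trajectory exists on the whole interval; it
  does for small \<open>\<nu>\<close>, because \<open>x\<close> almost solves its equation (\<open>solution_near_trajectory\<close>). A mode is
  inserted only where its component is at most \<open>- 1 / \<gamma>\<close>, and no component is below \<open>\<theta>\<close>. Hence
  \<open>\<theta> \<nu> \<le> w \<le> - \<nu> / \<gamma>\<close>, and as \<open>\<nu>\<close> tends to \<open>0\<close> the change satisfies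
  \<open>11/10 \<theta> \<nu> \<le> B \<le> 0\<close> (\<open>cost_change_bounds\<close>).

  It remains to compare \<open>\<theta> \<nu>\<close> with \<open>A\<close>. The differences of components of \<open>d\<close> have finitely many critical
  points, hence finitely many zeros, so the time interval splits into finitely many pieces on which
  the current mode is constant and the components are monotone and pairwise distinct. On such a piece
  a mode can only be inserted next to an end at which its component attains \<open>\<theta>\<close>, up to the point where
  the component equals \<open>- 1 / \<gamma>\<close> (\<open>gap_insertion\<close>). Consequently every switching time is either
  constant or one of these crossing points, and \<open>\<nu>\<close> is at most the total distance of the switching times
  from their limits (\<open>switching_structure\<close>). A crossing point moves by at most 11/10 times
  \<open>\<theta>\<^sup>2 (\<gamma> - \<gamma>0)\<close> divided by the slope of the component, or, if the slope vanishes, 11/10 times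
  \<open>\<bar>\<theta>\<bar> sqrt (2 (\<gamma> - \<gamma>0))\<close> divided by the square root of its second derivative (\<open>root_linear_rate\<close>,
  \<open>root_square_root_rate\<close>). Multiplied by \<open>\<theta>\<close>, these are the terms of \<open>A\<close>, so that
  \<open>- \<theta> \<nu> \<le> - 6/5 A\<close> (\<open>predicted_decrease_dominates\<close>) and therefore \<open>B \<ge> 66/50 A \<ge> 2 A\<close>.
\<close>

section \<open>Piecewise constant mode functions\<close>

text \<open>
  A control is identified up to null sets, so only its mode function matters. It is encoded as a
  function that is locally constant off a finite set: this form gives integrability and
  differentiability of solutions without mentioning an ordered list of switching times.
\<close>

definition piecewise_constant :: "real \<Rightarrow> real \<Rightarrow> (real \<Rightarrow> 'a) \<Rightarrow> bool" where
  "piecewise_constant a b c \<longleftrightarrow>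
     (\<exists>S. finite S \<and> (\<forall>t\<in>{a..b} - S. \<forall>\<^sub>F s in nhds t. c s = c t))"

lemma piecewise_constant_Pair:
  assumes "piecewise_constant a b c" "piecewise_constant a b c'"
  shows "piecewise_constant a b (\<lambda>t. (c t, c' t))"
proof -
  obtain S S' where S: "finite S" "\<forall>t\<in>{a..b} - S. \<forall>\<^sub>F s in nhds t. c s = c t"
    and S': "finite S'" "\<forall>t\<in>{a..b} - S'. \<forall>\<^sub>F s in nhds t. c' s = c' t"
    using assms unfolding piecewise_constant_def by blast
  have "\<forall>t\<in>{a..b} - (S \<union> S'). \<forall>\<^sub>F s in nhds t. (c s, c' s) = (c t, c' t)"
  proof
    fix t assume "t \<in> {a..b} - (S \<union> S')"
    then have "\<forall>\<^sub>F s in nhds t. c s = c t" "\<forall>\<^sub>F s in nhds t. c' s = c' t"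
      using S S' by auto
    then show "\<forall>\<^sub>F s in nhds t. (c s, c' s) = (c t, c' t)"
      by eventually_elim simp
  qed
  then show ?thesis
    unfolding piecewise_constant_def using S S' by blast
qed

lemma continuous_locally_constant_selection:
  fixes G :: "'m \<Rightarrow> real \<Rightarrow> 'b::topological_space"
  assumes c: "\<forall>\<^sub>F s in nhds t. c s = c t"
    and G: "continuous (at t within A) (G (c t))"
  shows "continuous (at t within A) (\<lambda>s. G (c s) s)"
proof -
  have "(G (c t) \<longlongrightarrow> G (c t) t) (at t within A)"
    using G by (simp add: continuous_within)
  moreover have "\<forall>\<^sub>F s in at t within A. G (c t) s = G (c s) s"
    using c unfolding eventually_at_filter by eventually_elim simp
  ultimately show ?thesis
    unfolding continuous_within by (rule Lim_transform_eventually)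
qed

text \<open>
  Off a finite set the integrand is continuous, and it takes its values in a finite union of
  compact sets, so it is measurable and bounded.
\<close>

lemma absolutely_integrable_piecewise:
  fixes G :: "'m::finite \<Rightarrow> real \<Rightarrow> 'b::euclidean_space"
  assumes c: "piecewise_constant a b c"
    and G: "\<And>m. continuous_on {a..b} (G m)"
  shows "(\<lambda>t. G (c t) t) absolutely_integrable_on {a..b}"
proof -
  obtain S where S: "finite S" "\<forall>t\<in>{a..b} - S. \<forall>\<^sub>F s in nhds t. c s = c t"
    using c unfolding piecewise_constant_def by blast
  have "bounded (\<Union>m. G m ` {a..b})"
    using G by (intro bounded_UN) (auto intro: compact_imp_bounded compact_continuous_image)
  then obtain B where "\<forall>v\<in>(\<Union>m. G m ` {a..b}). norm v \<le> B"
    unfolding bounded_iff by (rule exE)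
  then have B: "\<And>m t. t \<in> {a..b} \<Longrightarrow> norm (G m t) \<le> B" by auto
  have neg: "negligible S" using S by (simp add: negligible_finite)
  let ?A = "{a..b} - S"
  have A: "?A \<in> sets lebesgue"
    using neg negligible_imp_sets by (intro sets.Diff) auto
  have "continuous_on ?A (\<lambda>t. G (c t) t)"
    unfolding continuous_on_eq_continuous_within
  proof
    fix t assume t: "t \<in> ?A"
    show "continuous (at t within ?A) (\<lambda>t. G (c t) t)"
    proof (rule continuous_locally_constant_selection[where G = G and c = c])
      show "\<forall>\<^sub>F s in nhds t. c s = c t" using S t by blast
      show "continuous (at t within ?A) (G (c t))"
        using G t by (meson Diff_iff Diff_subset continuous_on_eq_continuous_within
            continuous_within_subset)
    qed
  qed
  then have "(\<lambda>t. G (c t) t) \<in> borel_measurable (lebesgue_on ?A)"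
    by (rule continuous_imp_measurable_on_sets_lebesgue[OF _ A])
  then have "(\<lambda>t. G (c t) t) absolutely_integrable_on ?A"
  proof (rule measurable_bounded_by_integrable_imp_absolutely_integrable[OF _ A, where g = "\<lambda>_. B"])
    show "(\<lambda>_. B) integrable_on ?A"
      by (rule integrable_spike_set[of _ "{a..b}"])
        (auto intro: negligible_subset[OF neg] integrable_const_ivl)
  qed (use B in auto)
  then show ?thesis
    by (rule absolutely_integrable_spike_set) (auto intro: negligible_subset[OF neg])
qed

lemma integrable_piecewise:
  fixes G :: "'m::finite \<Rightarrow> real \<Rightarrow> 'b::euclidean_space"
  assumes "piecewise_constant a b c" "\<And>m. continuous_on {a..b} (G m)"
  shows "(\<lambda>t. G (c t) t) integrable_on {a..b}"
  by (rule set_lebesgue_integral_eq_integral(1)[OF absolutely_integrable_piecewise[OF assms]])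

lemma indefinite_integral_derivative:
  fixes g :: "real \<Rightarrow> 'a::banach"
  assumes y: "\<And>t. t \<in> {a..b} \<Longrightarrow> (g has_integral (y t - yi)) {a..t}"
    and t: "t \<in> {a<..<b}" and g: "continuous (at t within {a..b}) g"
  shows "(y has_vector_derivative g t) (at t)"
proof -
  have ab: "a \<le> b" and tab: "t \<in> {a..b} - {}" using t by auto
  have int: "g integrable_on {a..b}" using y[of b] ab by auto
  have "((\<lambda>u. integral {a..u} g) has_vector_derivative g t) (at t within {a..b} - {})"
    by (rule integral_has_vector_derivative_continuous_at[OF int tab]) (use g in auto)
  then have "((\<lambda>u. integral {a..u} g) has_vector_derivative g t) (at t)"
    using t at_within_Icc_at[of a t b] by simp
  then have d: "((\<lambda>u. yi + integral {a..u} g) has_vector_derivative g t) (at t)"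
    by (auto intro!: derivative_eq_intros)
  show ?thesis
  proof (rule has_vector_derivative_transform_within_open[OF d])
    show "open {a<..<b}" "t \<in> {a<..<b}" using t by auto
    show "yi + integral {a..s} g = y s" if "s \<in> {a<..<b}" for s
      using integral_unique[OF y[of s]] that by simp
  qed
qed

lemma indefinite_integral_continuous_on:
  fixes g :: "real \<Rightarrow> 'a::banach"
  assumes y: "\<And>t. t \<in> {a..b} \<Longrightarrow> (g has_integral (y t - yi)) {a..t}"
  shows "continuous_on {a..b} y"
proof (cases "a \<le> b")
  case True
  have int: "g integrable_on {a..b}" using y[of b] True by auto
  have "continuous_on {a..b} (\<lambda>t. yi + integral {a..t} g)"
    by (intro continuous_intros indefinite_integral_continuous_1 int)
  then show ?thesis
    by (rule continuous_on_eq) (use integral_unique[OF y] in auto)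
qed auto

text \<open>
  The mode at time \<open>t\<close> is the one of the first interval whose right end lies beyond \<open>t\<close>.
\<close>

lemma mode_schedule_mode_function:
  fixes v :: "real \<Rightarrow> real^'m::finite"
  assumes ms: "mode_schedule T M sg s v"
  obtains c N where "piecewise_constant 0 T c" "negligible N"
    "\<And>t. t \<in> {0..T} - N \<Longrightarrow> v t = axis (c t) 1"
proof -
  have s: "1 \<le> M" "s 0 = 0" "s M = T" "\<And>i. i \<in> {1..M} \<Longrightarrow> s (i - 1) < s i"
    and ae: "\<And>i. i \<in> {1..M} \<Longrightarrow>
        AE t in lebesgue. t \<in> {s (i - 1)..<s i} \<longrightarrow> v t = axis (sg i) 1"
    using ms unfolding mode_schedule_def by auto
  define i0 where "i0 t = (LEAST i. t < s i)" for t
  define c where "c t = sg (i0 t)" for t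
  have mono: "s i \<le> s j" if "i \<le> j" "j \<le> M" for i j
    using that
  proof (induction j rule: dec_induct)
    case (step n)
    then show ?case using s(4)[of "Suc n"] by auto
  qed simp
  have i0: "i0 t \<in> {1..M} \<and> t \<in> {s (i0 t - 1)..<s (i0 t)}" if "t \<in> {0..<T}" for t
  proof -
    have ex: "t < s M" using that s by auto
    have 1: "t < s (i0 t)" unfolding i0_def by (rule LeastI[of _ M]) (rule ex)
    have 2: "i0 t \<le> M" unfolding i0_def by (rule Least_le) (rule ex)
    have 3: "i0 t \<noteq> 0" using 1 s that by (metis atLeastLessThan_iff not_le)
    have 4: "\<not> t < s (i0 t - 1)" using 3 not_less_Least[of "i0 t - 1" "\<lambda>i. t < s i"]
      unfolding i0_def by auto
    show ?thesis using 1 2 3 4 by auto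
  qed
  have i0_eq: "i0 t = i" if "i \<in> {1..M}" "t \<in> {s (i - 1)..<s i}" for t i
    unfolding i0_def
  proof (rule Least_equality)
    show "t < s i" using that by auto
    fix j assume "t < s j"
    show "i \<le> j"
    proof (rule ccontr)
      assume "\<not> i \<le> j"
      then have "s j \<le> s (i - 1)" using that by (intro mono) auto
      then show False using \<open>t < s j\<close> that by auto
    qed
  qed
  have "piecewise_constant 0 T c"
    unfolding piecewise_constant_def
  proof (intro exI[of _ "s ` {0..M}"] conjI ballI)
    show "finite (s ` {0..M})" by simp
    fix t assume t: "t \<in> {0..T} - s ` {0..M}"
    then have "t \<noteq> T" using s by (metis DiffD2 atLeastAtMost_iff imageI le_refl le0)
    then have t0: "t \<in> {0..<T}" using t by auto
    define i where "i = i0 t"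
    have i: "i \<in> {1..M}" "t \<in> {s (i - 1)..<s i}" using i0[OF t0] unfolding i_def by auto
    have "t \<noteq> s (i - 1)" using t i by (metis DiffD2 atLeastAtMost_iff diff_le_self imageI le0 le_trans)
    then have "t \<in> {s (i - 1)<..<s i}" using i by auto
    then have "\<forall>\<^sub>F r in nhds t. r \<in> {s (i - 1)<..<s i}"
      by (intro eventually_nhds_in_open) auto
    then show "\<forall>\<^sub>F r in nhds t. c r = c t"
    proof eventually_elim
      case (elim r)
      then have "i0 r = i" using i by (intro i0_eq) auto
      then show ?case unfolding c_def i_def by simp
    qed
  qed
  have "\<forall>i\<in>{1..M}. \<exists>N. negligible N \<and> (\<forall>t. t \<in> {s (i - 1)..<s i} \<longrightarrow> t \<notin> N \<longrightarrow> v t = axis (sg i) 1)"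
  proof
    fix i assume "i \<in> {1..M}"
    then obtain N where N: "N \<in> null_sets lebesgue"
        "{t \<in> space lebesgue. \<not> (t \<in> {s (i - 1)..<s i} \<longrightarrow> v t = axis (sg i) 1)} \<subseteq> N"
      using ae[of i] unfolding eventually_ae_filter by blast
    then have "negligible N" by (simp add: negligible_iff_null_sets)
    moreover have "t \<notin> N \<longrightarrow> v t = axis (sg i) 1" if "t \<in> {s (i - 1)..<s i}" for t
      using N that by auto
    ultimately show "\<exists>N. negligible N \<and> (\<forall>t. t \<in> {s (i - 1)..<s i} \<longrightarrow> t \<notin> N \<longrightarrow> v t = axis (sg i) 1)"
      by blast
  qed
  then obtain Nf where Nf: "\<And>i. i \<in> {1..M} \<Longrightarrow> negligible (Nf i)"
      "\<And>i t. i \<in> {1..M} \<Longrightarrow> t \<in> {s (i - 1)..<s i} \<Longrightarrow> t \<notin> Nf i \<Longrightarrow> v t = axis (sg i) 1"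
    by metis
  define N where "N = insert T (\<Union>i\<in>{1..M}. Nf i)"
  have "negligible N"
    unfolding N_def using Nf(1) by (auto intro!: negligible_Union)
  moreover have "v t = axis (c t) 1" if t: "t \<in> {0..T} - N" for t
  proof -
    have "t \<in> {0..<T}" using t unfolding N_def by auto
    note i = i0[OF this]
    have "t \<notin> Nf (i0 t)" using t i unfolding N_def by blast
    then show ?thesis using Nf(2) i unfolding c_def by blast
  qed
  ultimately show thesis using that \<open>piecewise_constant 0 T c\<close> by blast
qed

section \<open>Solutions near a given trajectory\<close>

text \<open>
  A bound on the second derivative makes \<open>g'\<close> Lipschitz with constant \<open>K\<close>; the mean value
  inequality for \<open>g - g' a\<close> on the segment from \<open>a\<close> to \<open>b\<close> then gives the estimate.
\<close>

lemma quadratic_remainder: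
  fixes g :: "'a::real_normed_vector \<Rightarrow> 'b::real_normed_vector"
    and g' :: "'a \<Rightarrow> ('a \<Rightarrow>\<^sub>L 'b)" and g'' :: "'a \<Rightarrow> ('a \<Rightarrow>\<^sub>L ('a \<Rightarrow>\<^sub>L 'b))"
  assumes g: "\<And>y. (g has_derivative blinfun_apply (g' y)) (at y)"
    and g': "\<And>y. (g' has_derivative blinfun_apply (g'' y)) (at y)"
    and K: "\<And>y. norm (g'' y) \<le> K"
  shows "norm (g b - g a - g' a (b - a)) \<le> K * (norm (b - a))\<^sup>2"
proof -
  have K0: "0 \<le> K" using K[of a] norm_ge_zero order_trans by blast
  have lip: "norm (g' y - g' a) \<le> K * norm (y - a)" for y
  proof (rule differentiable_bound[of UNIV g' "\<lambda>y. blinfun_apply (g'' y)" K])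
    show "onorm (blinfun_apply (g'' y)) \<le> K" for y using K[of y] by (simp add: norm_blinfun.rep_eq)
  qed (use g' in auto)
  have "norm (g b - g a - blinfun_apply (g' a) (b - a)) \<le> norm (b - a) * (K * norm (b - a))"
  proof (rule differentiable_bound_linearization[of a b "closed_segment a b" g "\<lambda>y. blinfun_apply (g' y)" a])
    fix t :: real assume "t \<in> {0..1}"
    then show "a + t *\<^sub>R (b - a) \<in> closed_segment a b"
      unfolding closed_segment_def by (auto intro!: exI[of _ t] simp: algebra_simps)
  next
    fix y assume y: "y \<in> closed_segment a b"
    show "(g has_derivative blinfun_apply (g' y)) (at y within closed_segment a b)"
      using g has_derivative_at_withinI by blast
    have "onorm (blinfun_apply (g' y) - blinfun_apply (g' a)) = norm (g' y - g' a)"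
      by (simp add: norm_blinfun.rep_eq minus_blinfun.rep_eq fun_diff_def)
    also have "\<dots> \<le> K * norm (y - a)" by (rule lip)
    also have "\<dots> \<le> K * norm (b - a)"
      using segment_bound(1)[OF y] K0 by (intro mult_left_mono) auto
    finally show "onorm (blinfun_apply (g' y) - blinfun_apply (g' a)) \<le> K * norm (b - a)" .
  qed auto
  then show ?thesis by (simp add: power2_eq_square mult_ac)
qed

lemma has_integral_exp_weight:
  fixes L :: real
  assumes "0 \<le> t"
  shows "((\<lambda>s. L * exp (2 * L * s)) has_integral (exp (2 * L * t) - 1) / 2) {0..t}"
proof -
  have "((\<lambda>s. L * exp (2 * L * s)) has_integral exp (2 * L * t) / 2 - exp (2 * L * 0) / 2) {0..t}"
    by (rule fundamental_theorem_of_calculus[OF assms])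
      (auto intro!: derivative_eq_intros simp: has_real_derivative_iff_has_vector_derivative[symmetric])
  then show ?thesis by (simp add: diff_divide_distrib)
qed

text \<open>
  The maximum \<open>m\<close> of \<open>exp (- 2 L t) h t\<close> would satisfy \<open>m \<le> m / 2\<close> if it were positive, because integrating
  \<open>L m exp (2 L s)\<close> gains a factor one half.
\<close>

lemma gronwall_nonpos:
  fixes h :: "real \<Rightarrow> real"
  assumes cont: "continuous_on {0..T} h" and L: "0 \<le> L"
    and le: "\<And>t. t \<in> {0..T} \<Longrightarrow> h t \<le> L * integral {0..t} h"
    and t: "t \<in> {0..T}"
  shows "h t \<le> 0"
proof -
  have "continuous_on {0..T} (\<lambda>s. exp (- (2 * L * s)) * h s)"
    by (intro continuous_intros cont)
  then obtain r where r: "r \<in> {0..T}"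
    and max: "\<And>s. s \<in> {0..T} \<Longrightarrow> exp (- (2 * L * s)) * h s \<le> exp (- (2 * L * r)) * h r"
    using continuous_attains_sup[OF compact_Icc, of 0 T "\<lambda>s. exp (- (2 * L * s)) * h s"] t by fastforce
  define m where "m = exp (- (2 * L * r)) * h r"
  have bound: "h s \<le> m * exp (2 * L * s)" if "s \<in> {0..T}" for s
    using max[OF that] unfolding m_def[symmetric] by (simp add: exp_minus field_simps)
  have "h r \<le> L * integral {0..r} h" by (rule le[OF r])
  also have "\<dots> \<le> L * integral {0..r} (\<lambda>s. m * exp (2 * L * s))"
  proof (rule mult_left_mono[OF integral_le L])
    show "h integrable_on {0..r}"
      using r by (intro integrable_continuous_real continuous_on_subset[OF cont]) auto
    show "(\<lambda>s. m * exp (2 * L * s)) integrable_on {0..r}"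
      by (intro integrable_continuous_real continuous_intros)
  qed (use bound r in auto)
  also have "\<dots> = m * integral {0..r} (\<lambda>s. L * exp (2 * L * s))"
    by simp
  also have "\<dots> = m * ((exp (2 * L * r) - 1) / 2)"
    by (subst integral_unique[OF has_integral_exp_weight]) (use r in auto)
  also have "h r = m * exp (2 * L * r)" unfolding m_def by (simp add: exp_minus)
  finally have "m * ((exp (2 * L * r) + 1) / 2) \<le> 0" by (simp add: field_simps)
  then have "m \<le> 0"
    by (smt (verit) exp_gt_zero half_gt_zero_iff mult_pos_pos)
  then show ?thesis
    using bound[OF t] by (smt (verit) exp_gt_zero mult_nonneg_nonneg mult_nonpos_nonneg)
qed

text \<open>
  A bounded second derivative allows quadratic growth of \<open>f\<close>, so a perturbed control need not
  have a solution on the whole interval. It has one when the given curve \<open>x\<close> almost solves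
  the perturbed equation: the Picard iteration started at \<open>x\<close> contracts by one half in the norm
  weighted with \<open>exp (- 2 L t)\<close>, hence stays in the tube of radius one around \<open>x\<close>, where the
  Lipschitz constant \<open>L\<close> is valid, and converges there.
\<close>

lemma solution_near_trajectory:
  fixes f :: "'m::finite \<Rightarrow> 'a::euclidean_space \<Rightarrow> 'a" and x :: "real \<Rightarrow> 'a"
  assumes T: "0 \<le> T" and c: "piecewise_constant 0 T c"
    and f: "\<And>m. continuous_on UNIV (f m)" and x: "continuous_on {0..T} x"
    and L: "0 < L"
    and lip: "\<And>m t y z. t \<in> {0..T} \<Longrightarrow> norm (y - x t) \<le> 1 \<Longrightarrow> norm (z - x t) \<le> 1 \<Longrightarrow>
               norm (f m y - f m z) \<le> L * norm (y - z)"
    and eps0: "0 \<le> \<epsilon>" and eps: "2 * \<epsilon> * exp (2 * L * T) \<le> 1"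
    and defect: "\<And>t. t \<in> {0..T} \<Longrightarrow> norm (x0 + integral {0..t} (\<lambda>s. f (c s) (x s)) - x t) \<le> \<epsilon>"
  obtains y where "continuous_on {0..T} y"
    "\<And>t. t \<in> {0..T} \<Longrightarrow> ((\<lambda>s. f (c s) (y s)) has_integral (y t - x0)) {0..t}"
    "\<And>t. t \<in> {0..T} \<Longrightarrow> norm (y t - x t) \<le> 2 * \<epsilon> * exp (2 * L * T)"
proof -
  define Y where "Y = rec_nat x (\<lambda>_ y t. x0 + integral {0..t} (\<lambda>s. f (c s) (y s)))"
  have Y0: "Y 0 = x" and YS: "Y (Suc n) = (\<lambda>t. x0 + integral {0..t} (\<lambda>s. f (c s) (Y n s)))" for n
    by (auto simp: Y_def)
  have int: "(\<lambda>s. f (c s) (y s)) integrable_on {0..t}" if "continuous_on {0..T} y" "t \<in> {0..T}" for y t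
  proof (rule integrable_subinterval_real)
    show "(\<lambda>s. f (c s) (y s)) integrable_on {0..T}"
      by (rule integrable_piecewise[OF c, of "\<lambda>m s. f m (y s)"])
        (rule continuous_on_compose2[OF f that(1)], auto)
  qed (use that in auto)
  have e_mono: "\<epsilon> * exp (2 * L * t) \<le> \<epsilon> * exp (2 * L * T)" if "t \<in> {0..T}" for t
    using that eps0 L by (intro mult_left_mono) auto
  \<comment> \<open>the weight \<open>exp (2 L t)\<close> makes each step gain a factor one half\<close>
  have inv: "continuous_on {0..T} (Y n) \<and> (\<forall>t\<in>{0..T}.
      norm (Y (Suc n) t - Y n t) \<le> \<epsilon> * exp (2 * L * t) / 2 ^ n \<and>
      norm (Y n t - x t) \<le> 2 * (\<epsilon> * exp (2 * L * t)) * (1 - 1 / 2 ^ n))" for n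
  proof (induction n)
    case 0
    have "norm (Y (Suc 0) t - Y 0 t) \<le> \<epsilon> * exp (2 * L * t)" if "t \<in> {0..T}" for t
    proof -
      have "norm (Y (Suc 0) t - Y 0 t) \<le> \<epsilon>" using defect[OF that] by (simp add: YS Y0)
      also have "\<dots> \<le> \<epsilon> * exp (2 * L * t)"
        using eps0 L that by (simp add: mult_le_cancel_left1)
      finally show ?thesis .
    qed
    then show ?case using x by (auto simp: Y0)
  next
    case (Suc n)
    have cn: "continuous_on {0..T} (Y n)"
      and dn: "\<And>t. t \<in> {0..T} \<Longrightarrow> norm (Y (Suc n) t - Y n t) \<le> \<epsilon> * exp (2 * L * t) / 2 ^ n"
      and xn: "\<And>t. t \<in> {0..T} \<Longrightarrow> norm (Y n t - x t) \<le> 2 * (\<epsilon> * exp (2 * L * t)) * (1 - 1 / 2 ^ n)"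
      using Suc by auto
    have cS: "continuous_on {0..T} (Y (Suc n))"
      unfolding YS using int[OF cn, of T] T
      by (intro continuous_intros indefinite_integral_continuous_1) auto
    have xS: "norm (Y (Suc n) t - x t) \<le> 2 * (\<epsilon> * exp (2 * L * t)) * (1 - 1 / 2 ^ Suc n)"
      if t: "t \<in> {0..T}" for t
    proof -
      have "norm (Y (Suc n) t - x t) \<le> norm (Y (Suc n) t - Y n t) + norm (Y n t - x t)"
        by (rule order_trans[OF _ norm_triangle_ineq]) simp
      also have "\<dots> \<le> \<epsilon> * exp (2 * L * t) / 2 ^ n + 2 * (\<epsilon> * exp (2 * L * t)) * (1 - 1 / 2 ^ n)"
        using dn[OF t] xn[OF t] by linarith
      also have "\<dots> = 2 * (\<epsilon> * exp (2 * L * t)) * (1 - 1 / 2 ^ Suc n)"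
        by (simp add: field_simps)
      finally show ?thesis .
    qed
    have e_mono2: "2 * (\<epsilon> * exp (2 * L * t)) \<le> 2 * (\<epsilon> * exp (2 * L * T))" if "t \<in> {0..T}" for t
      using e_mono[OF that] by linarith
    have tube: "norm (y - x t) \<le> 1"
      if "norm (y - x t) \<le> 2 * (\<epsilon> * exp (2 * L * t)) * (1 - 1 / 2 ^ k)" "t \<in> {0..T}" for y t and k :: nat
    proof -
      have "2 * (\<epsilon> * exp (2 * L * t)) * (1 - 1 / 2 ^ k) \<le> 2 * (\<epsilon> * exp (2 * L * T)) * 1"
        using eps0 by (intro mult_mono e_mono2 that(2)) auto
      then show ?thesis using that eps by simp
    qed
    have "norm (Y (Suc (Suc n)) t - Y (Suc n) t) \<le> \<epsilon> * exp (2 * L * t) / 2 ^ Suc n"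
      if t: "t \<in> {0..T}" for t
    proof -
      have i1: "(\<lambda>s. f (c s) (Y (Suc n) s)) integrable_on {0..t}"
        and i2: "(\<lambda>s. f (c s) (Y n s)) integrable_on {0..t}"
        by (rule int[OF cS t], rule int[OF cn t])
      have w: "((\<lambda>s. \<epsilon> / 2 ^ n * (L * exp (2 * L * s))) has_integral \<epsilon> / 2 ^ n * ((exp (2 * L * t) - 1) / 2)) {0..t}"
        using t by (intro has_integral_mult_right has_integral_exp_weight) auto
      have "Y (Suc (Suc n)) t = x0 + integral {0..t} (\<lambda>s. f (c s) (Y (Suc n) s))"
        and "Y (Suc n) t = x0 + integral {0..t} (\<lambda>s. f (c s) (Y n s))"
        by (rule YS[THEN fun_cong])+
      then have "norm (Y (Suc (Suc n)) t - Y (Suc n) t)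
          = norm (integral {0..t} (\<lambda>s. f (c s) (Y (Suc n) s) - f (c s) (Y n s)))"
        by (simp only: integral_diff[OF i1 i2] add_diff_cancel_left)
      also have "\<dots> \<le> integral {0..t} (\<lambda>s. \<epsilon> / 2 ^ n * (L * exp (2 * L * s)))"
      proof (rule integral_norm_bound_integral)
        show "(\<lambda>s. f (c s) (Y (Suc n) s) - f (c s) (Y n s)) integrable_on {0..t}"
          by (rule integrable_diff[OF i1 i2])
        show "(\<lambda>s. \<epsilon> / 2 ^ n * (L * exp (2 * L * s))) integrable_on {0..t}"
          using w by blast
        fix s assume "s \<in> {0..t}"
        then have s: "s \<in> {0..T}" using t by auto
        have "norm (f (c s) (Y (Suc n) s) - f (c s) (Y n s)) \<le> L * norm (Y (Suc n) s - Y n s)"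
          using lip[OF s] tube[OF xS[OF s] s] tube[OF xn[OF s] s] by blast
        also have "\<dots> \<le> L * (\<epsilon> * exp (2 * L * s) / 2 ^ n)"
          using dn[OF s] L by (intro mult_left_mono) auto
        finally show "norm (f (c s) (Y (Suc n) s) - f (c s) (Y n s)) \<le> \<epsilon> / 2 ^ n * (L * exp (2 * L * s))"
          by (simp add: field_simps)
      qed
      also have "\<dots> = \<epsilon> / 2 ^ n * ((exp (2 * L * t) - 1) / 2)"
        using w by (rule integral_unique)
      also have "\<dots> \<le> \<epsilon> * exp (2 * L * t) / 2 ^ Suc n"
        using eps0 by (simp add: field_simps)
      finally show ?thesis .
    qed
    then show ?case using cS xS by blast
  qed
  have lim: "uniform_limit {0..T} (\<lambda>n t. \<Sum>i<n. Y (Suc i) t - Y i t) (\<lambda>t. \<Sum>i. Y (Suc i) t - Y i t) sequentially"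
  proof (rule Weierstrass_m_test)
    show "norm (Y (Suc n) t - Y n t) \<le> \<epsilon> * exp (2 * L * T) * (1 / 2) ^ n" if "t \<in> {0..T}" for n t
    proof -
      have "norm (Y (Suc n) t - Y n t) \<le> \<epsilon> * exp (2 * L * t) / 2 ^ n" using inv that by blast
      also have "\<dots> \<le> \<epsilon> * exp (2 * L * T) / 2 ^ n"
        using e_mono[OF that] by (intro divide_right_mono) auto
      finally show ?thesis by (simp add: power_one_over)
    qed
    show "summable (\<lambda>n. \<epsilon> * exp (2 * L * T) * (1 / 2 :: real) ^ n)"
      by (intro summable_mult summable_geometric) auto
  qed
  define y where "y t = x t + (\<Sum>i. Y (Suc i) t - Y i t)" for t
  have ulim: "uniform_limit {0..T} Y y sequentially"
  proof -
    have "uniform_limit {0..T} (\<lambda>n t. x t + (\<Sum>i<n. Y (Suc i) t - Y i t)) y sequentially"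
      unfolding y_def by (intro uniform_limit_intros lim)
    moreover have "x t + (\<Sum>i<n. Y (Suc i) t - Y i t) = Y n t" for n t
      using sum_lessThan_telescope[of "\<lambda>i. Y i t" n] by (simp add: Y0)
    ultimately show ?thesis by simp
  qed
  have cy: "continuous_on {0..T} y"
    by (rule uniform_limit_theorem[OF _ ulim]) (use inv in auto)
  have plim: "(\<lambda>n. Y n t) \<longlonglongrightarrow> y t" if "t \<in> {0..T}" for t
    by (rule tendsto_uniform_limitI[OF ulim that])
  have near_n: "norm (Y n t - x t) \<le> 2 * \<epsilon> * exp (2 * L * T)" if "t \<in> {0..T}" for n t
  proof -
    have "norm (Y n t - x t) \<le> 2 * (\<epsilon> * exp (2 * L * t)) * (1 - 1 / 2 ^ n)" using inv that by blast
    also have "\<dots> \<le> 2 * (\<epsilon> * exp (2 * L * T)) * 1"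
    proof (rule mult_mono)
      show "2 * (\<epsilon> * exp (2 * L * t)) \<le> 2 * (\<epsilon> * exp (2 * L * T))"
        using e_mono[OF that] by linarith
    qed (use eps0 in auto)
    finally show ?thesis by simp
  qed
  have near: "norm (y t - x t) \<le> 2 * \<epsilon> * exp (2 * L * T)" if "t \<in> {0..T}" for t
  proof (rule tendsto_upperbound)
    show "(\<lambda>n. norm (Y n t - x t)) \<longlonglongrightarrow> norm (y t - x t)"
      by (intro tendsto_intros plim that)
  qed (use near_n that in auto)
  have "((\<lambda>s. f (c s) (y s)) has_integral (y t - x0)) {0..t}" if t: "t \<in> {0..T}" for t
  proof -
    have iy: "(\<lambda>s. f (c s) (y s)) integrable_on {0..t}" by (rule int[OF cy t])
    have "(\<lambda>n. x0 + integral {0..t} (\<lambda>s. f (c s) (Y n s))) \<longlonglongrightarrow> x0 + integral {0..t} (\<lambda>s. f (c s) (y s))"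
    proof (intro tendsto_intros, unfold tendsto_iff dist_norm, intro allI impI)
      fix e :: real assume e: "0 < e"
      define e' where "e' = e / (L * t + 1)"
      have Lt: "0 \<le> L * t" using L t by auto
      have e': "0 < e'" "L * t * e' < e"
        using e Lt unfolding e'_def by (auto simp: field_simps)
      have "\<forall>\<^sub>F n in sequentially. \<forall>s\<in>{0..T}. dist (Y n s) (y s) < e'"
        using ulim e' unfolding uniform_limit_iff by blast
      then show "\<forall>\<^sub>F n in sequentially.
          norm (integral {0..t} (\<lambda>s. f (c s) (Y n s)) - integral {0..t} (\<lambda>s. f (c s) (y s))) < e"
      proof eventually_elim
        case (elim n)
        have iYn: "(\<lambda>s. f (c s) (Y n s)) integrable_on {0..t}" using int[OF _ t] inv by blast
        have "norm (integral {0..t} (\<lambda>s. f (c s) (Y n s)) - integral {0..t} (\<lambda>s. f (c s) (y s)))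
            = norm (integral {0..t} (\<lambda>s. f (c s) (Y n s) - f (c s) (y s)))"
          using iYn iy by (simp add: integral_diff)
        also have "\<dots> \<le> integral {0..t} (\<lambda>s. L * e')"
        proof (rule integral_norm_bound_integral[OF integrable_diff[OF iYn iy] integrable_const_ivl])
          fix s assume "s \<in> {0..t}"
          then have s: "s \<in> {0..T}" using t by auto
          have "norm (f (c s) (Y n s) - f (c s) (y s)) \<le> L * norm (Y n s - y s)"
            using lip[OF s] near_n[OF s] near[OF s] eps by (meson order_trans)
          also have "\<dots> \<le> L * e'"
            using elim s L by (intro mult_left_mono) (auto simp: dist_norm less_imp_le)
          finally show "norm (f (c s) (Y n s) - f (c s) (y s)) \<le> L * e'" .
        qed
        also have "\<dots> = L * t * e'" using t by simp
        finally show ?case using e' by simp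
      qed
    qed
    moreover have "(\<lambda>n. x0 + integral {0..t} (\<lambda>s. f (c s) (Y n s))) \<longlonglongrightarrow> y t"
      using LIMSEQ_Suc[OF plim[OF t]] by (simp add: YS)
    ultimately have "x0 + integral {0..t} (\<lambda>s. f (c s) (y s)) = y t"
      by (rule LIMSEQ_unique)
    then show ?thesis using iy by (metis add_diff_cancel_left' integrable_integral)
  qed
  then show thesis using that cy near by blast
qed

text \<open>
  Two solutions are continuous, hence lie in a common ball, on which all modes are Lipschitz.
\<close>

lemma solution_unique:
  fixes T :: real and f :: "'m::finite \<Rightarrow> 'a::euclidean_space \<Rightarrow> 'a"
  assumes lip: "\<And>r. \<exists>L>0. \<forall>m. \<forall>y\<in>cball 0 r. \<forall>z\<in>cball 0 r. norm (f m y - f m z) \<le> L * norm (y - z)"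
    and y: "\<And>t. t \<in> {0..T} \<Longrightarrow> ((\<lambda>s. f (c s) (y s)) has_integral (y t - x0)) {0..t}"
    and z: "\<And>t. t \<in> {0..T} \<Longrightarrow> ((\<lambda>s. f (c s) (z s)) has_integral (z t - x0)) {0..t}"
    and t: "t \<in> {0..T}"
  shows "y t = z t"
proof -
  have cy: "continuous_on {0..T} y" and cz: "continuous_on {0..T} z"
    by (rule indefinite_integral_continuous_on[OF y], simp, rule indefinite_integral_continuous_on[OF z], simp)
  have "bounded (y ` {0..T} \<union> z ` {0..T})"
    using cy cz by (auto intro: compact_imp_bounded compact_continuous_image)
  then obtain r where r: "\<And>s. s \<in> {0..T} \<Longrightarrow> norm (y s) \<le> r \<and> norm (z s) \<le> r"
    unfolding bounded_iff by blast
  obtain L where L: "0 < L" "\<And>m v w. norm v \<le> r \<Longrightarrow> norm w \<le> r \<Longrightarrow> norm (f m v - f m w) \<le> L * norm (v - w)"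
    using lip[of r] by auto
  have cd: "continuous_on {0..T} (\<lambda>s. norm (y s - z s))" by (intro continuous_intros cy cz)
  have "norm (y t - z t) \<le> 0"
  proof (rule gronwall_nonpos[OF cd _ _ t])
    show "0 \<le> L" using L by simp
    fix s assume s: "s \<in> {0..T}"
    have i: "((\<lambda>r. f (c r) (y r) - f (c r) (z r)) has_integral (y s - x0 - (z s - x0))) {0..s}"
      by (rule has_integral_diff[OF y[OF s] z[OF s]])
    have id: "(\<lambda>r. norm (y r - z r)) integrable_on {0..s}"
      using s by (intro integrable_continuous_real continuous_on_subset[OF cd]) auto
    have "norm (y s - z s) = norm (integral {0..s} (\<lambda>r. f (c r) (y r) - f (c r) (z r)))"
      using integral_unique[OF i] by simp
    also have "\<dots> \<le> integral {0..s} (\<lambda>r. L * norm (y r - z r))"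
    proof (rule integral_norm_bound_integral)
      show "(\<lambda>r. f (c r) (y r) - f (c r) (z r)) integrable_on {0..s}" using i by blast
      show "(\<lambda>r. L * norm (y r - z r)) integrable_on {0..s}" using integrable_on_cmult_left[OF id] by simp
      show "norm (f (c q) (y q) - f (c q) (z q)) \<le> L * norm (y q - z q)" if "q \<in> {0..s}" for q
        using L(2) r[of q] that s by auto
    qed
    also have "\<dots> = L * integral {0..s} (\<lambda>r. norm (y r - z r))" by simp
    finally show "norm (y s - z s) \<le> L * integral {0..s} (\<lambda>r. norm (y r - z r))" .
  qed
  then show ?thesis by simp
qed

section \<open>First-order expansion of the cost\<close>

lemma adjoint_blinfun_eq:
  fixes A :: "'a::euclidean_space \<Rightarrow>\<^sub>L 'b::euclidean_space"
  shows "adjoint (blinfun_apply A) v = (\<Sum>b\<in>Basis. (A b \<bullet> v) *\<^sub>R b)"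
proof -
  have "adjoint (blinfun_apply A) v = (\<Sum>b\<in>Basis. (b \<bullet> adjoint (blinfun_apply A) v) *\<^sub>R b)"
    by (simp only: inner_commute[of _ "adjoint (blinfun_apply A) v"] euclidean_representation)
  then show ?thesis
    by (simp add: adjoint_works[OF bounded_linear.linear[OF blinfun.bounded_linear_right]])
qed

lemma inner_adjoint_blinfun:
  fixes A :: "'a::euclidean_space \<Rightarrow>\<^sub>L 'b::euclidean_space"
  shows "adjoint (blinfun_apply A) v \<bullet> w = v \<bullet> A w"
  using adjoint_works[OF bounded_linear.linear[OF blinfun.bounded_linear_right[of A]], of w v]
  by (simp add: inner_commute)

text \<open>
  The integral of this indicator is the amount of time during which two controls differ.
\<close>

definition mismatch :: "(real \<Rightarrow> 'm) \<Rightarrow> (real \<Rightarrow> 'm) \<Rightarrow> real \<Rightarrow> real" where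
  "mismatch c c' t = (if c t = c' t then 0 else 1)"

lemma mismatch_bounds: "0 \<le> mismatch c c' t" "mismatch c c' t \<le> 1"
  by (auto simp: mismatch_def)

lemma integrable_mismatch:
  fixes c :: "real \<Rightarrow> 'm::finite"
  assumes "piecewise_constant a b c" "piecewise_constant a b c'"
  shows "mismatch c c' integrable_on {a..b}"
proof -
  have "(\<lambda>t. (\<lambda>p s. if fst p = snd p then 0 else 1 :: real) (c t, c' t) t) integrable_on {a..b}"
    by (rule integrable_piecewise[OF piecewise_constant_Pair[OF assms]]) auto
  then show ?thesis by (simp add: mismatch_def[abs_def])
qed

text \<open>
  A trajectory \<open>x\<close> with mode function \<open>c\<close> and its adjoint \<open>\<rho>\<close>. The set \<open>S\<close> contains all times at
  which \<open>c\<close> may switch; the derivatives of the modes and of the running cost are fixed as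
  bounded linear functions so that their continuity can be used.
\<close>

locale adjoint_trajectory =
  fixes T K KL :: real
    and f :: "'m::finite \<Rightarrow> 'a::euclidean_space \<Rightarrow> 'a"
    and f' :: "'m \<Rightarrow> 'a \<Rightarrow> ('a \<Rightarrow>\<^sub>L 'a)"
    and f'' :: "'m \<Rightarrow> 'a \<Rightarrow> ('a \<Rightarrow>\<^sub>L ('a \<Rightarrow>\<^sub>L 'a))"
    and l :: "'a \<Rightarrow> real" and l' :: "'a \<Rightarrow> ('a \<Rightarrow>\<^sub>L real)"
    and l'' :: "'a \<Rightarrow> ('a \<Rightarrow>\<^sub>L ('a \<Rightarrow>\<^sub>L real))"
    and c :: "real \<Rightarrow> 'm" and S :: "real set" and x0 :: 'a and x \<rho> :: "real \<Rightarrow> 'a"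
  assumes T_pos: "0 < T"
    and f': "\<And>m y. (f m has_derivative blinfun_apply (f' m y)) (at y)"
    and f'': "\<And>m y. (f' m has_derivative blinfun_apply (f'' m y)) (at y)"
    and f''_cont: "\<And>m. continuous_on UNIV (f'' m)" and f''_le: "\<And>m y. norm (f'' m y) \<le> K"
    and l': "\<And>y. (l has_derivative blinfun_apply (l' y)) (at y)"
    and l'': "\<And>y. (l' has_derivative blinfun_apply (l'' y)) (at y)"
    and l''_cont: "continuous_on UNIV l''" and l''_le: "\<And>y. norm (l'' y) \<le> KL"
    and finite_S: "finite S"
    and c_locally_constant: "\<And>t. t \<in> {0..T} - S \<Longrightarrow> \<forall>\<^sub>F s in nhds t. c s = c t"
    and state: "\<And>t. t \<in> {0..T} \<Longrightarrow> ((\<lambda>s. f (c s) (x s)) has_integral (x t - x0)) {0..t}"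
    and costate: "\<And>t. t \<in> {0..T} \<Longrightarrow>
      ((\<lambda>s. adjoint (f' (c s) (x s)) (\<rho> s) + adjoint (l' (x s)) 1) has_integral \<rho> t) {t..T}"
begin

lemma c_piecewise: "piecewise_constant 0 T c"
  unfolding piecewise_constant_def using finite_S c_locally_constant by blast

lemma f_continuous: "continuous_on A (f m)"
  using f' by (meson has_derivative_continuous_on has_derivative_at_withinI)

lemma l_continuous: "continuous_on A l"
  using l' by (meson has_derivative_continuous_on has_derivative_at_withinI)

lemma f'_continuous: "continuous_on A (f' m)"
  using f'' by (meson has_derivative_continuous_on has_derivative_at_withinI)

lemma l'_continuous: "continuous_on A l'"
  using l'' by (meson has_derivative_continuous_on has_derivative_at_withinI)

lemma x_continuous: "continuous_on {0..T} x"
  by (rule indefinite_integral_continuous_on[where g = "\<lambda>s. f (c s) (x s)" and y = x and yi = x0]) (rule state)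

lemma fx_continuous: "continuous_on {0..T} (\<lambda>t. f m (x t))"
  by (rule continuous_on_compose2[OF f_continuous x_continuous]) auto

lemma f'x_continuous: "continuous_on {0..T} (\<lambda>t. f' m (x t))"
  by (rule continuous_on_compose2[OF f'_continuous x_continuous]) auto

lemma l'x_continuous: "continuous_on {0..T} (\<lambda>t. l' (x t))"
  by (rule continuous_on_compose2[OF l'_continuous x_continuous]) auto

definition costate_rhs :: "'m \<Rightarrow> real \<Rightarrow> 'a" where
  "costate_rhs m t = adjoint (f' m (x t)) (\<rho> t) + adjoint (l' (x t)) 1"

text \<open>
  The adjoint equation runs backwards from \<open>T\<close>; rewritten from \<open>0\<close> it fits the lemmas on
  indefinite integrals.
\<close>

lemma costate_backward:
  assumes t: "t \<in> {0..T}"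
  shows "((\<lambda>s. costate_rhs (c s) s) has_integral (- \<rho> t - - \<rho> 0)) {0..t}"
proof -
  have all: "(\<lambda>s. costate_rhs (c s) s) integrable_on {0..T}"
    using costate[of 0] T_pos unfolding costate_rhs_def by auto
  have "integral {0..t} (\<lambda>s. costate_rhs (c s) s) + integral {t..T} (\<lambda>s. costate_rhs (c s) s)
      = integral {0..T} (\<lambda>s. costate_rhs (c s) s)"
    using t by (intro Henstock_Kurzweil_Integration.integral_combine all) auto
  moreover have "integral {t..T} (\<lambda>s. costate_rhs (c s) s) = \<rho> t"
    "integral {0..T} (\<lambda>s. costate_rhs (c s) s) = \<rho> 0"
    using integral_unique[OF costate[of t]] integral_unique[OF costate[of 0]] t T_pos
    unfolding costate_rhs_def by auto
  ultimately have "integral {0..t} (\<lambda>s. costate_rhs (c s) s) = - \<rho> t - - \<rho> 0"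
    by (simp add: algebra_simps)
  moreover have "(\<lambda>s. costate_rhs (c s) s) integrable_on {0..t}"
    using t by (intro integrable_subinterval_real[OF all]) auto
  ultimately show ?thesis by (metis integrable_integral)
qed

lemma rho_continuous: "continuous_on {0..T} \<rho>"
proof -
  have "continuous_on {0..T} (\<lambda>t. - \<rho> t)"
    by (rule indefinite_integral_continuous_on[OF costate_backward])
  then show ?thesis using continuous_on_minus by fastforce
qed

lemma rho_T: "\<rho> T = 0"
  using has_integral_unique[OF costate[of T] has_integral_null_real] T_pos by simp

lemma x_0: "x 0 = x0"
  using has_integral_unique[OF state[of 0] has_integral_null_real] T_pos by simp

lemma costate_rhs_continuous: "continuous_on {0..T} (costate_rhs m)"
  unfolding costate_rhs_def adjoint_blinfun_eq
  by (intro continuous_intros rho_continuous f'x_continuous l'x_continuous)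

lemma solution_has_derivative:
  assumes y: "\<And>t. t \<in> {0..T} \<Longrightarrow> ((\<lambda>s. f (d s) (y s)) has_integral (y t - x0)) {0..t}"
    and d: "\<forall>\<^sub>F s in nhds t. d s = d t" and t: "t \<in> {0<..<T}"
  shows "(y has_vector_derivative f (d t) (y t)) (at t)"
proof (rule indefinite_integral_derivative[OF y t])
  have "continuous_on {0..T} y"
    by (rule indefinite_integral_continuous_on[OF y])
  then have "continuous_on {0..T} (\<lambda>s. f (d t) (y s))"
    by (rule continuous_on_compose2[OF f_continuous]) auto
  then have "continuous (at t within {0..T}) (\<lambda>s. f (d t) (y s))"
    using t by (simp add: continuous_on_eq_continuous_within)
  then show "continuous (at t within {0..T}) (\<lambda>s. f (d s) (y s))"
    using continuous_locally_constant_selection[OF d, of _ "\<lambda>m s. f m (y s)"] by blast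
qed

lemma x_has_derivative:
  assumes "t \<in> {0<..<T} - S"
  shows "(x has_vector_derivative f (c t) (x t)) (at t)"
  by (rule solution_has_derivative[where d = c and y = x]) (use assms state c_locally_constant in auto)

lemma rho_has_derivative:
  assumes t: "t \<in> {0<..<T} - S"
  shows "(\<rho> has_vector_derivative - costate_rhs (c t) t) (at t)"
proof -
  have "((\<lambda>t. - \<rho> t) has_vector_derivative costate_rhs (c t) t) (at t)"
  proof (rule indefinite_integral_derivative[OF costate_backward])
    show "t \<in> {0<..<T}" using t by auto
    have "continuous (at t within {0..T}) (costate_rhs (c t))"
      using costate_rhs_continuous t by (simp add: continuous_on_eq_continuous_within)
    moreover have "\<forall>\<^sub>F s in nhds t. c s = c t" using t by (intro c_locally_constant) auto
    ultimately show "continuous (at t within {0..T}) (\<lambda>s. costate_rhs (c s) s)"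
      using continuous_locally_constant_selection[of c t _ costate_rhs] by blast
  qed
  then show ?thesis using has_vector_derivative_minus by fastforce
qed

lemma f_Lipschitz_on_balls:
  "\<exists>L>0. \<forall>m. \<forall>y\<in>cball 0 r. \<forall>z\<in>cball 0 r. norm (f m y - f m z) \<le> L * norm (y - z)"
proof -
  have "bounded (\<Union>m. f' m ` cball 0 r)"
    by (intro bounded_UN finite_code ballI compact_imp_bounded compact_continuous_image f'_continuous)
      (auto intro: compact_cball)
  then obtain B where B: "\<And>m y. y \<in> cball 0 r \<Longrightarrow> norm (f' m y) \<le> B"
    unfolding bounded_iff by fastforce
  have "norm (f m y - f m z) \<le> max B 1 * norm (y - z)" if "y \<in> cball 0 r" "z \<in> cball 0 r" for m y z
  proof (rule differentiable_bound[of "cball 0 r" "f m" "\<lambda>y. blinfun_apply (f' m y)"])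
    fix w assume "w \<in> cball (0::'a) r"
    then show "onorm (blinfun_apply (f' m w)) \<le> max B 1"
      using B[of w m] by (auto simp: norm_blinfun.rep_eq[symmetric])
    show "(f m has_derivative blinfun_apply (f' m w)) (at w within cball 0 r)"
      by (rule has_derivative_at_withinI[OF f'])
  qed (use that in auto)
  then show ?thesis by (intro exI[of _ "max B 1"]) auto
qed

lemma bounded_along_trajectory:
  fixes G :: "'i::finite \<Rightarrow> real \<Rightarrow> 'b::real_normed_vector"
  assumes "\<And>i. continuous_on {0..T} (G i)"
  obtains B where "0 \<le> B" "\<And>i t. t \<in> {0..T} \<Longrightarrow> norm (G i t) \<le> B"
proof -
  have "bounded (\<Union>i. G i ` {0..T})"
    using assms by (intro bounded_UN) (auto intro: compact_imp_bounded compact_continuous_image)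
  then obtain B where B: "\<forall>v\<in>(\<Union>i. G i ` {0..T}). norm v \<le> B"
    unfolding bounded_iff by (rule exE)
  have "norm (G i t) \<le> max B 0" if "t \<in> {0..T}" for i t
    using B that by (intro max.coboundedI1) auto
  then show thesis using that[of "max B 0"] by auto
qed

text \<open>
  Let \<open>z = y - x\<close> be the deviation caused by the control \<open>c'\<close>. It is of the order of the time \<open>\<nu>\<close>
  during which the controls differ. Since \<open>\<rho> \<bullet> z\<close> vanishes at both ends, the integral of its
  derivative is zero, and the adjoint equation turns this identity into
  \<open>\<integral> l' z = \<integral> \<rho> \<bullet> (f (c' t) y - f (c t) x - f' (c t) z)\<close>, with the derivatives taken at \<open>x\<close>.
  What separates this from the claimed first-order term are the two Taylor remainders,
  quadratic in \<open>z\<close>, and the difference of the linearisations of the two modes applied to \<open>z\<close>, which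
  is of order \<open>\<nu>\<close> but supported on a set of measure \<open>\<nu>\<close>.
\<close>

theorem cost_first_order_expansion:
  obtains C \<epsilon>0 where "0 < \<epsilon>0" "0 \<le> C"
    "\<And>c'. piecewise_constant 0 T c' \<Longrightarrow> integral {0..T} (mismatch c c') \<le> \<epsilon>0 \<Longrightarrow>
       \<exists>y. continuous_on {0..T} y \<and>
         (\<forall>t\<in>{0..T}. ((\<lambda>s. f (c' s) (y s)) has_integral (y t - x0)) {0..t})"
    "\<And>c' y. piecewise_constant 0 T c' \<Longrightarrow> integral {0..T} (mismatch c c') \<le> \<epsilon>0 \<Longrightarrow>
       (\<And>t. t \<in> {0..T} \<Longrightarrow> ((\<lambda>s. f (c' s) (y s)) has_integral (y t - x0)) {0..t}) \<Longrightarrow>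
       \<bar>integral {0..T} (\<lambda>t. l (y t)) - integral {0..T} (\<lambda>t. l (x t))
         - integral {0..T} (\<lambda>t. \<rho> t \<bullet> (f (c' t) (x t) - f (c t) (x t)))\<bar>
       \<le> C * (integral {0..T} (mismatch c c'))\<^sup>2"
proof -
  obtain r where r0: "0 \<le> r" and r: "\<And>(i::unit) t. t \<in> {0..T} \<Longrightarrow> norm (x t) \<le> r"
    using bounded_along_trajectory[of "\<lambda>_::unit. x"] x_continuous by auto
  obtain P where P0: "0 \<le> P" and P: "\<And>(i::unit) t. t \<in> {0..T} \<Longrightarrow> norm (\<rho> t) \<le> P"
    using bounded_along_trajectory[of "\<lambda>_::unit. \<rho>"] rho_continuous by auto
  obtain C0 where C00: "0 \<le> C0" and C0: "\<And>m t. t \<in> {0..T} \<Longrightarrow> norm (f m (x t)) \<le> C0"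
    using bounded_along_trajectory[of "\<lambda>m t. f m (x t)", OF fx_continuous] by blast
  obtain G where G0: "0 \<le> G" and G: "\<And>m t. t \<in> {0..T} \<Longrightarrow> norm (f' m (x t)) \<le> G"
    using bounded_along_trajectory[of "\<lambda>m t. f' m (x t)", OF f'x_continuous] by blast
  have K0: "0 \<le> K" "0 \<le> KL"
    using f''_le[of undefined undefined] l''_le[of undefined] norm_ge_zero order_trans by blast+
  obtain L where L: "0 < L" and lip0: "\<And>m y z. norm y \<le> r + 1 \<Longrightarrow> norm z \<le> r + 1 \<Longrightarrow>
      norm (f m y - f m z) \<le> L * norm (y - z)"
    using f_Lipschitz_on_balls[of "r + 1"] by auto
  have lip: "norm (f m y - f m z) \<le> L * norm (y - z)"
    if "t \<in> {0..T}" "norm (y - x t) \<le> 1" "norm (z - x t) \<le> 1" for m t y z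
  proof (rule lip0)
    show "norm y \<le> r + 1" using that r[OF that(1)] norm_triangle_sub[of y "x t"] by linarith
    show "norm z \<le> r + 1" using that r[OF that(1)] norm_triangle_sub[of z "x t"] by linarith
  qed
  \<comment> \<open>modes differ by at most \<open>2 C0\<close> along \<open>x\<close>, so \<open>E \<nu>\<close> is the deviation allowed by the Picard iteration\<close>
  define E where "E = 4 * C0 * exp (2 * L * T)"
  \<comment> \<open>keeps the deviation below the radius of the tube around \<open>x\<close>\<close>
  define \<epsilon>0 where "\<epsilon>0 = 1 / (E + 1)"
  have E0: "0 \<le> E" using C00 by (simp add: E_def)
  have "0 < \<epsilon>0" using E0 by (simp add: \<epsilon>0_def)
  define C where "C = (KL * E\<^sup>2 + P * K * E\<^sup>2) * T + 2 * P * G * E"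
  have "0 \<le> C" using K0 P0 G0 E0 T_pos by (simp add: C_def)
  have near: "\<exists>y. continuous_on {0..T} y \<and>
         (\<forall>t\<in>{0..T}. ((\<lambda>s. f (c' s) (y s)) has_integral (y t - x0)) {0..t}) \<and>
         (\<forall>t\<in>{0..T}. norm (y t - x t) \<le> E * integral {0..T} (mismatch c c'))"
    if c': "piecewise_constant 0 T c'" and small: "integral {0..T} (mismatch c c') \<le> \<epsilon>0" for c'
  proof -
    define m where "m = integral {0..T} (mismatch c c')"
    have im: "mismatch c c' integrable_on {0..T}" by (rule integrable_mismatch[OF c_piecewise c'])
    have m0: "0 \<le> m" unfolding m_def by (intro integral_nonneg im mismatch_bounds)
    have "2 * (2 * C0 * m) * exp (2 * L * T) = E * m" unfolding E_def by simp
    also have "\<dots> \<le> E * \<epsilon>0" using small E0 unfolding m_def by (intro mult_left_mono) auto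
    also have "\<dots> \<le> 1" using E0 unfolding \<epsilon>0_def by (simp add: field_simps)
    finally have eps: "2 * (2 * C0 * m) * exp (2 * L * T) \<le> 1" .
    have defect: "norm (x0 + integral {0..t} (\<lambda>s. f (c' s) (x s)) - x t) \<le> 2 * C0 * m"
      if t: "t \<in> {0..T}" for t
    proof -
      have i': "(\<lambda>s. f (c' s) (x s)) integrable_on {0..t}"
        by (rule integrable_subinterval_real[OF integrable_piecewise[OF c' fx_continuous]]) (use t in auto)
      have i: "(\<lambda>s. f (c s) (x s)) integrable_on {0..t}"
        by (rule has_integral_integrable[OF state[OF t]])
      have imt: "mismatch c c' integrable_on {0..t}"
        using t by (intro integrable_subinterval_real[OF im]) auto
      have "x0 + integral {0..t} (\<lambda>s. f (c' s) (x s)) - x t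
          = integral {0..t} (\<lambda>s. f (c' s) (x s) - f (c s) (x s))"
        using integral_unique[OF state[OF t]] integral_diff[OF i' i] by simp
      also have "norm \<dots> \<le> integral {0..t} (\<lambda>s. 2 * C0 * mismatch c c' s)"
      proof (rule integral_norm_bound_integral[OF integrable_diff[OF i' i]])
        show "(\<lambda>s. 2 * C0 * mismatch c c' s) integrable_on {0..t}"
          using integrable_on_cmult_left[OF imt, of "2 * C0"] by simp
        fix s assume "s \<in> {0..t}"
        then have s: "s \<in> {0..T}" using t by auto
        show "norm (f (c' s) (x s) - f (c s) (x s)) \<le> 2 * C0 * mismatch c c' s"
          using norm_triangle_ineq4[of "f (c' s) (x s)" "f (c s) (x s)"] C0[OF s, of "c s"] C0[OF s, of "c' s"]
          by (auto simp: mismatch_def)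
      qed
      also have "\<dots> = 2 * C0 * integral {0..t} (mismatch c c')" by simp
      also have "\<dots> \<le> 2 * C0 * m"
        unfolding m_def using t C00
        by (intro mult_left_mono integral_subset_le imt im) (auto simp: mismatch_bounds)
      finally show ?thesis .
    qed
    obtain y where "continuous_on {0..T} y"
      "\<And>t. t \<in> {0..T} \<Longrightarrow> ((\<lambda>s. f (c' s) (y s)) has_integral (y t - x0)) {0..t}"
      "\<And>t. t \<in> {0..T} \<Longrightarrow> norm (y t - x t) \<le> 2 * (2 * C0 * m) * exp (2 * L * T)"
    proof (rule solution_near_trajectory[where f = f and x = x and c = c' and T = T and L = L and \<epsilon> = "2 * C0 * m"])
      show "continuous_on UNIV (f i)" for i by (rule f_continuous)
    qed (use T_pos c' x_continuous L lip m0 C00 eps defect in auto)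
    then show ?thesis unfolding m_def[symmetric] E_def by (intro exI[of _ y]) (auto simp: mult_ac)
  qed
  have expansion: "\<bar>integral {0..T} (\<lambda>t. l (y t)) - integral {0..T} (\<lambda>t. l (x t))
         - integral {0..T} (\<lambda>t. \<rho> t \<bullet> (f (c' t) (x t) - f (c t) (x t)))\<bar>
       \<le> C * (integral {0..T} (mismatch c c'))\<^sup>2"
    if c': "piecewise_constant 0 T c'" and small: "integral {0..T} (mismatch c c') \<le> \<epsilon>0"
      and y: "\<And>t. t \<in> {0..T} \<Longrightarrow> ((\<lambda>s. f (c' s) (y s)) has_integral (y t - x0)) {0..t}" for c' y
  proof -
    define m where "m = integral {0..T} (mismatch c c')"
    have im: "mismatch c c' integrable_on {0..T}" by (rule integrable_mismatch[OF c_piecewise c'])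
    have m0: "0 \<le> m" unfolding m_def by (intro integral_nonneg im mismatch_bounds)
    obtain y' where y': "\<forall>t\<in>{0..T}. ((\<lambda>s. f (c' s) (y' s)) has_integral (y' t - x0)) {0..t}"
      "\<forall>t\<in>{0..T}. norm (y' t - x t) \<le> E * m"
      using near[OF c' small] unfolding m_def by blast
    have close: "norm (y t - x t) \<le> E * m" if t: "t \<in> {0..T}" for t
    proof -
      have "y t = y' t"
        by (rule solution_unique[OF f_Lipschitz_on_balls, where T = T and c = c' and ?x0.0 = x0 and y = y and z = y'])
          (use y y' t in auto)
      then show ?thesis using y' t by simp
    qed
    have cy: "continuous_on {0..T} y" by (rule indefinite_integral_continuous_on[OF y])
    have y0: "y 0 = x0" using has_integral_unique[OF y[of 0] has_integral_null_real] T_pos by simp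
    obtain S' where S': "finite S'" "\<And>t. t \<in> {0..T} - S' \<Longrightarrow> \<forall>\<^sub>F s in nhds t. c' s = c' t"
      using c' unfolding piecewise_constant_def by blast
    define q where "q t = \<rho> t \<bullet> (f (c' t) (y t) - f (c t) (x t))
        - \<rho> t \<bullet> f' (c t) (x t) (y t - x t) - l' (x t) (y t - x t)" for t
    have "(q has_integral (\<rho> T \<bullet> (y T - x T) - \<rho> 0 \<bullet> (y 0 - x 0))) {0..T}"
    proof (rule fundamental_theorem_of_calculus_interior_strong[where S = "S \<union> S'"])
      show "finite (S \<union> S')" using finite_S S' by simp
      show "continuous_on {0..T} (\<lambda>t. \<rho> t \<bullet> (y t - x t))"
        by (intro continuous_intros rho_continuous cy x_continuous)
      fix t assume t: "t \<in> {0<..<T} - (S \<union> S')"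
      have dy: "(y has_vector_derivative f (c' t) (y t)) (at t)"
        by (rule solution_has_derivative[where d = c' and y = y]) (use t y S' in auto)
      have dx: "(x has_vector_derivative f (c t) (x t)) (at t)"
        using t by (intro x_has_derivative) auto
      have dr: "(\<rho> has_vector_derivative - costate_rhs (c t) t) (at t)"
        using t by (intro rho_has_derivative) auto
      have "((\<lambda>t. \<rho> t \<bullet> (y t - x t)) has_vector_derivative
          \<rho> t \<bullet> (f (c' t) (y t) - f (c t) (x t)) + (- costate_rhs (c t) t) \<bullet> (y t - x t)) (at t)"
        by (rule bounded_bilinear.has_vector_derivative[OF bounded_bilinear_inner dr
              has_vector_derivative_diff[OF dy dx]])
      moreover have "\<rho> t \<bullet> (f (c' t) (y t) - f (c t) (x t)) + (- costate_rhs (c t) t) \<bullet> (y t - x t) = q t"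
        by (simp add: q_def costate_rhs_def inner_add_left inner_diff_left inner_adjoint_blinfun)
      ultimately show "((\<lambda>t. \<rho> t \<bullet> (y t - x t)) has_vector_derivative q t) (at t)" by simp
    qed (use T_pos in auto)
    then have q: "(q has_integral 0) {0..T}" by (simp add: rho_T y0 x_0)
    define w where "w t = \<rho> t \<bullet> (f (c' t) (x t) - f (c t) (x t))" for t
    have iw: "w integrable_on {0..T}"
    proof -
      have "(\<lambda>t. (\<lambda>p t. \<rho> t \<bullet> (f (snd p) (x t) - f (fst p) (x t))) (c t, c' t) t) integrable_on {0..T}"
        by (rule integrable_piecewise[OF piecewise_constant_Pair[OF c_piecewise c']])
          (intro continuous_intros rho_continuous fx_continuous)
      then show ?thesis by (simp add: w_def[abs_def])
    qed
    have il: "(\<lambda>t. l (z t)) integrable_on {0..T}" if "continuous_on {0..T} z" for z :: "real \<Rightarrow> 'a"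
      by (intro integrable_continuous_real continuous_on_compose2[OF l_continuous that]) auto
    let ?h = "\<lambda>t. l (y t) - l (x t) - w t + q t"
    have ih: "?h integrable_on {0..T}"
      using q by (intro integrable_add integrable_diff il cy x_continuous iw) auto
    have "integral {0..T} ?h = integral {0..T} (\<lambda>t. l (y t)) - integral {0..T} (\<lambda>t. l (x t)) - integral {0..T} w"
      using q il[OF cy] il[OF x_continuous] iw
      by (subst integral_add integral_diff; (intro integrable_diff)?; auto simp: integral_diff integrable_diff)+
    moreover have "norm (integral {0..T} ?h) \<le> integral {0..T}
        (\<lambda>t. (KL * E\<^sup>2 + P * K * E\<^sup>2) * m\<^sup>2 + 2 * P * G * E * m * mismatch c c' t)"
    proof (rule integral_norm_bound_integral[OF ih])
      show "(\<lambda>t. (KL * E\<^sup>2 + P * K * E\<^sup>2) * m\<^sup>2 + 2 * P * G * E * m * mismatch c c' t) integrable_on {0..T}"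
        using integrable_on_cmult_left[OF im, of "2 * P * G * E * m"]
        by (intro integrable_add integrable_const_ivl) simp
      fix t assume t: "t \<in> {0..T}"
      define z where "z = y t - x t"
      have z: "norm z \<le> E * m" using close[OF t] by (simp add: z_def)
      have z2: "(norm z)\<^sup>2 \<le> E\<^sup>2 * m\<^sup>2" using power_mono[OF z, of 2] by (simp add: power_mult_distrib)
      define e1 where "e1 = l (y t) - l (x t) - l' (x t) z"
      define e2 where "e2 = f (c' t) (y t) - f (c' t) (x t) - f' (c' t) (x t) z"
      define e3 where "e3 = f' (c' t) (x t) z - f' (c t) (x t) z"
      have split: "?h t = e1 + \<rho> t \<bullet> e2 + \<rho> t \<bullet> e3"
        by (simp add: e1_def e2_def e3_def q_def w_def z_def inner_diff_right)
      have "\<bar>e1\<bar> \<le> KL * (norm z)\<^sup>2"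
        using quadratic_remainder[OF l' l'' l''_le, of "y t" "x t"] by (simp add: e1_def z_def)
      also have "\<dots> \<le> KL * (E\<^sup>2 * m\<^sup>2)" using z2 K0 by (intro mult_left_mono)
      finally have b1: "\<bar>e1\<bar> \<le> KL * (E\<^sup>2 * m\<^sup>2)" .
      have "norm e2 \<le> K * (norm z)\<^sup>2"
        using quadratic_remainder[OF f' f'' f''_le, of "c' t" "y t" "x t"] by (simp add: e2_def z_def)
      also have "\<dots> \<le> K * (E\<^sup>2 * m\<^sup>2)" using z2 K0 by (intro mult_left_mono)
      finally have "norm e2 \<le> K * (E\<^sup>2 * m\<^sup>2)" .
      then have b2: "\<bar>\<rho> t \<bullet> e2\<bar> \<le> P * (K * (E\<^sup>2 * m\<^sup>2))"
        using P[OF t] P0 by (intro order_trans[OF Cauchy_Schwarz_ineq2] mult_mono) auto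
      have "norm e3 \<le> 2 * G * (E * m) * mismatch c c' t"
      proof (cases "c t = c' t")
        case False
        have "norm e3 \<le> norm (f' (c' t) (x t) z) + norm (f' (c t) (x t) z)"
          unfolding e3_def by (rule norm_triangle_ineq4)
        also have "\<dots> \<le> norm (f' (c' t) (x t)) * norm z + norm (f' (c t) (x t)) * norm z"
          by (intro add_mono norm_blinfun)
        also have "\<dots> \<le> G * (E * m) + G * (E * m)"
          using G[OF t] z G0 by (intro add_mono mult_mono) auto
        finally show ?thesis using False by (simp add: mismatch_def mult_ac)
      qed (simp add: e3_def mismatch_def)
      then have b3: "\<bar>\<rho> t \<bullet> e3\<bar> \<le> P * (2 * G * (E * m) * mismatch c c' t)"
        using P[OF t] P0 by (intro order_trans[OF Cauchy_Schwarz_ineq2] mult_mono) auto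
      show "norm (?h t) \<le> (KL * E\<^sup>2 + P * K * E\<^sup>2) * m\<^sup>2 + 2 * P * G * E * m * mismatch c c' t"
        unfolding split real_norm_def using b1 b2 b3 by (simp add: algebra_simps)
    qed
    moreover have "integral {0..T} (\<lambda>t. (KL * E\<^sup>2 + P * K * E\<^sup>2) * m\<^sup>2 + 2 * P * G * E * m * mismatch c c' t)
        = C * m\<^sup>2"
    proof -
      have "((\<lambda>t. (KL * E\<^sup>2 + P * K * E\<^sup>2) * m\<^sup>2 + 2 * P * G * E * m * mismatch c c' t) has_integral
          (T - 0) *\<^sub>R ((KL * E\<^sup>2 + P * K * E\<^sup>2) * m\<^sup>2) + 2 * P * G * E * m * m) {0..T}"
        unfolding m_def using T_pos im
        by (intro has_integral_add has_integral_const_real[THEN has_integral_eq_rhs] has_integral_mult_right) auto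
      then show ?thesis by (simp add: integral_unique C_def power2_eq_square algebra_simps)
    qed
    ultimately show ?thesis unfolding m_def w_def by simp
  qed
  show thesis
    by (rule that[OF \<open>0 < \<epsilon>0\<close> \<open>0 \<le> C\<close>]) (use near expansion in blast)+
qed

end

section \<open>Threshold crossings of a scalar function\<close>

text \<open>
  A mode is inserted where its component of \<open>d\<close> lies below \<open>- 1 / g\<close>. This threshold leaves \<open>\<theta>\<close> at
  \<open>g0\<close> with speed at most \<open>\<theta>\<^sup>2\<close>.
\<close>

lemma threshold_asymptotics:
  fixes \<theta> g0 :: real
  assumes "\<theta> < 0" "g0 = - 1 / \<theta>" "g0 < g"
  shows "\<theta> < - 1 / g" "- 1 / g - \<theta> \<le> \<theta>\<^sup>2 * (g - g0)"
proof -
  have g0: "0 < g0" "\<theta> = - 1 / g0" using assms by (auto simp: divide_neg_neg)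
  show "\<theta> < - 1 / g" unfolding g0(2) using g0(1) assms(3) by (simp add: field_simps)
  have "- 1 / g - \<theta> = (g - g0) / (g * g0)"
    unfolding g0(2) using g0(1) assms(3) by (simp add: field_simps)
  also have "\<dots> \<le> (g - g0) / (g0 * g0)"
    using g0(1) assms(3) by (intro divide_left_mono mult_right_mono) auto
  also have "\<dots> = \<theta>\<^sup>2 * (g - g0)" unfolding g0(2) by (simp add: power2_eq_square)
  finally show "- 1 / g - \<theta> \<le> \<theta>\<^sup>2 * (g - g0)" .
qed

lemma threshold_tendsto:
  fixes \<theta> g0 :: real
  assumes "\<theta> < 0" "g0 = - 1 / \<theta>"
  shows "((\<lambda>g. - 1 / g) \<longlongrightarrow> \<theta>) (at_right g0)"
proof -
  have "((\<lambda>g. - 1 / g) \<longlongrightarrow> - 1 / g0) (at_right g0)"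
    using assms by (intro tendsto_intros) auto
  then show ?thesis using assms by simp
qed

lemma continuous_nonzero_constant_sign:
  fixes g :: "real \<Rightarrow> real"
  assumes "continuous_on {p<..<q} g" "\<And>t. t \<in> {p<..<q} \<Longrightarrow> g t \<noteq> 0"
  shows "(\<forall>t\<in>{p<..<q}. 0 < g t) \<or> (\<forall>t\<in>{p<..<q}. g t < 0)"
proof (rule ccontr)
  assume "\<not> ?thesis"
  then obtain s t where st: "s \<in> {p<..<q}" "t \<in> {p<..<q}" "g s \<le> 0" "0 \<le> g t"
    by (auto simp: not_less)
  have "connected (g ` {p<..<q})"
    by (rule connected_continuous_image[OF assms(1)]) simp
  then have "0 \<in> g ` {p<..<q}"
    by (rule connectedD_interval[of _ "g s" "g t"]) (use st in auto)
  then show False using assms(2) by auto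
qed

lemma mean_value_from_left_end:
  fixes h h1 :: "real \<Rightarrow> real"
  assumes c: "continuous_on {0..w} h" and t: "t \<in> {0<..<w}"
    and d: "\<And>t. t \<in> {0<..<w} \<Longrightarrow> (h has_real_derivative h1 t) (at t)"
  shows "\<exists>\<xi>\<in>{0<..<t}. h t - h 0 = t * h1 \<xi>"
proof -
  have "continuous_on {0..t} h" using t by (intro continuous_on_subset[OF c]) auto
  then obtain \<xi> where "0 < \<xi>" "\<xi> < t" "h t - h 0 = h1 \<xi> * (t - 0)"
  proof (rule mvt[of 0 t h "\<lambda>\<xi> v. h1 \<xi> * v", rotated])
    show "(h has_derivative (*) (h1 s)) (at s)" if "0 < s" "s < t" for s
      using d[of s] that t by (simp add: has_field_derivative_def)
  qed (use t in auto)
  then show ?thesis by (auto simp: mult.commute)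
qed

text \<open>
  If the derivative at the minimum is nonzero, the mean value theorem bounds the root of
  \<open>h = - 1 / g\<close> by the excess of the threshold over \<open>\<theta>\<close> divided by the slope. The factor 11/10
  absorbs the variation of the slope near \<open>0\<close>.
\<close>

lemma root_linear_rate:
  fixes h h1 \<tau> :: "real \<Rightarrow> real"
  assumes th: "\<theta> < 0" "g0 = - 1 / \<theta>" and w: "0 < w"
    and c: "continuous_on {0..w} h" and c1: "continuous_on {0..w} h1"
    and d: "\<And>t. t \<in> {0<..<w} \<Longrightarrow> (h has_real_derivative h1 t) (at t)"
    and z: "h 0 = \<theta>" and nz: "h1 0 \<noteq> 0"
    and lim: "filterlim \<tau> (at_right 0) (at_right g0)"
    and root: "\<forall>\<^sub>F g in at_right g0. h (\<tau> g) = - 1 / g"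
  shows "0 < h1 0" "\<forall>\<^sub>F g in at_right g0. \<tau> g \<le> 11 / 10 * (\<theta>\<^sup>2 / h1 0) * (g - g0)"
proof -
  have lim1: "(h1 \<longlongrightarrow> h1 0) (at_right 0)"
    using c1 w by (auto simp: continuous_on_Icc_at_rightD)
  have ev0: "\<forall>\<^sub>F g in at_right g0. \<tau> g \<in> {0<..<r}" if "0 < r" for r
    using filterlim_iff[THEN iffD1, OF lim] eventually_at_right_real[OF that] by blast
  note gr = eventually_at_right_less[of g0]
  have mvt: "\<exists>\<xi>\<in>{0<..<t}. h t - \<theta> = t * h1 \<xi>" if "t \<in> {0<..<w}" for t
    using mean_value_from_left_end[OF c that d] z by simp
  show pos: "0 < h1 0"
  proof (rule ccontr)
    assume "\<not> 0 < h1 0"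
    then have "h1 0 < 0" using nz by auto
    then have "\<forall>\<^sub>F t in at_right 0. h1 t < 0" using lim1 by (rule order_tendstoD(2)[rotated])
    then obtain b where b: "0 < b" "\<And>t. 0 < t \<Longrightarrow> t < b \<Longrightarrow> h1 t < 0"
      unfolding eventually_at_right_field by auto
    have bw: "0 < min b w" using b w by simp
    have "\<forall>\<^sub>F g in at_right g0. False"
      using ev0[OF bw] root gr
    proof eventually_elim
      case (elim g)
      obtain \<xi> where xi: "\<xi> \<in> {0<..<\<tau> g}" "h (\<tau> g) - \<theta> = \<tau> g * h1 \<xi>"
        using mvt[of "\<tau> g"] elim by auto
      then have "\<tau> g * h1 \<xi> < 0" using b(2)[of \<xi>] elim by (intro mult_pos_neg) auto
      then show ?case using threshold_asymptotics(1)[OF th elim(3)] xi elim by simp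
    qed
    then show False by simp
  qed
  have "10 / 11 * h1 0 < h1 0" using pos by simp
  then have "\<forall>\<^sub>F t in at_right 0. 10 / 11 * h1 0 < h1 t" using lim1 by (rule order_tendstoD(1)[rotated])
  then obtain b where b: "0 < b" "\<And>t. 0 < t \<Longrightarrow> t < b \<Longrightarrow> 10 / 11 * h1 0 < h1 t"
    unfolding eventually_at_right_field by auto
    have bw: "0 < min b w" using b w by simp
  show "\<forall>\<^sub>F g in at_right g0. \<tau> g \<le> 11 / 10 * (\<theta>\<^sup>2 / h1 0) * (g - g0)"
    using ev0[OF bw] root gr
  proof eventually_elim
    case (elim g)
    obtain \<xi> where xi: "\<xi> \<in> {0<..<\<tau> g}" "h (\<tau> g) - \<theta> = \<tau> g * h1 \<xi>"
      using mvt[of "\<tau> g"] elim by auto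
    have "\<tau> g * (10 / 11 * h1 0) \<le> \<tau> g * h1 \<xi>"
      using b(2)[of \<xi>] xi elim by (intro mult_left_mono) auto
    also have "\<dots> \<le> \<theta>\<^sup>2 * (g - g0)"
      using threshold_asymptotics(2)[OF th elim(3)] xi elim by simp
    finally show ?case using pos by (simp add: field_simps)
  qed
qed

text \<open>
  The same for a vanishing first derivative: there \<open>h\<close> exceeds \<open>\<theta>\<close> by almost half the second
  derivative times the square of the argument.
\<close>

lemma root_square_root_rate:
  fixes h h1 h2 \<tau> :: "real \<Rightarrow> real"
  assumes th: "\<theta> < 0" "g0 = - 1 / \<theta>" and w: "0 < w"
    and c: "continuous_on {0..w} h" and c1: "continuous_on {0..w} h1"
    and c2: "continuous_on {0..w} h2"
    and d: "\<And>t. t \<in> {0<..<w} \<Longrightarrow> (h has_real_derivative h1 t) (at t)"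
    and d1: "\<And>t. t \<in> {0<..<w} \<Longrightarrow> (h1 has_real_derivative h2 t) (at t)"
    and z: "h 0 = \<theta>" "h1 0 = 0" and nz: "h2 0 \<noteq> 0"
    and lim: "filterlim \<tau> (at_right 0) (at_right g0)"
    and root: "\<forall>\<^sub>F g in at_right g0. h (\<tau> g) = - 1 / g"
  shows "0 < h2 0" "\<forall>\<^sub>F g in at_right g0. \<tau> g \<le> 11 / 10 * (sqrt 2 * \<bar>\<theta>\<bar> / sqrt (h2 0)) * sqrt (g - g0)"
proof -
  have lim2: "(h2 \<longlongrightarrow> h2 0) (at_right 0)"
    using c2 w by (auto simp: continuous_on_Icc_at_rightD)
  have ev0: "\<forall>\<^sub>F g in at_right g0. \<tau> g \<in> {0<..<r}" if "0 < r" for r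
    using filterlim_iff[THEN iffD1, OF lim] eventually_at_right_real[OF that] by blast
  note gr = eventually_at_right_less[of g0]
  have mvt: "\<exists>\<xi>\<in>{0<..<t}. h t - \<theta> = t * h1 \<xi>" if "t \<in> {0<..<w}" for t
    using mean_value_from_left_end[OF c that d] z by simp
  have mvt1: "\<exists>\<xi>\<in>{0<..<t}. h1 t = t * h2 \<xi>" if "t \<in> {0<..<w}" for t
    using mean_value_from_left_end[OF c1 that d1] z by simp
  show pos: "0 < h2 0"
  proof (rule ccontr)
    assume "\<not> 0 < h2 0"
    then have "h2 0 < 0" using nz by auto
    then have "\<forall>\<^sub>F t in at_right 0. h2 t < 0" using lim2 by (rule order_tendstoD(2)[rotated])
    then obtain b where b: "0 < b" "\<And>t. 0 < t \<Longrightarrow> t < b \<Longrightarrow> h2 t < 0"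
      unfolding eventually_at_right_field by auto
    have bw: "0 < min b w" using b w by simp
    have "\<forall>\<^sub>F g in at_right g0. False"
      using ev0[OF bw] root gr
    proof eventually_elim
      case (elim g)
      obtain \<xi> where xi: "\<xi> \<in> {0<..<\<tau> g}" "h (\<tau> g) - \<theta> = \<tau> g * h1 \<xi>"
        using mvt[of "\<tau> g"] elim by auto
      obtain \<eta> where eta: "\<eta> \<in> {0<..<\<xi>}" "h1 \<xi> = \<xi> * h2 \<eta>"
        using mvt1[of \<xi>] xi elim by auto
      have "h1 \<xi> < 0" unfolding eta(2) using b(2)[of \<eta>] xi eta elim by (intro mult_pos_neg) auto
      then have "\<tau> g * h1 \<xi> < 0" using elim by (intro mult_pos_neg) auto
      then show ?case using threshold_asymptotics(1)[OF th elim(3)] xi elim by simp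
    qed
    then show False by simp
  qed
  \<comment> \<open>100/121 is the square of the inverse of 11/10\<close>
  define D where "D = 100 / 121 * h2 0"
  have D: "0 < D" "D < h2 0" using pos by (auto simp: D_def)
  have "\<forall>\<^sub>F t in at_right 0. D < h2 t" using lim2 D(2) by (rule order_tendstoD(1))
  then obtain b where b: "0 < b" "\<And>t. 0 < t \<Longrightarrow> t < b \<Longrightarrow> D < h2 t"
    unfolding eventually_at_right_field by auto
    have bw: "0 < min b w" using b w by simp
  have quad: "D * t\<^sup>2 / 2 \<le> h t - \<theta>" if t: "t \<in> {0<..<min b w}" for t
  proof -
    have "\<exists>\<xi>\<in>{0<..<t}. (h t - D * t\<^sup>2 / 2) - (h 0 - D * 0\<^sup>2 / 2) = t * (h1 \<xi> - D * \<xi>)"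
    proof (rule mean_value_from_left_end[of w "\<lambda>t. h t - D * t\<^sup>2 / 2" t "\<lambda>t. h1 t - D * t"])
      show "((\<lambda>t. h t - D * t\<^sup>2 / 2) has_real_derivative h1 s - D * s) (at s)" if "s \<in> {0<..<w}" for s
        using d[OF that] by (auto intro!: derivative_eq_intros)
    qed (use t in \<open>auto intro!: continuous_intros c\<close>)
    then obtain s where s: "s \<in> {0<..<t}" "h t - D * t\<^sup>2 / 2 - \<theta> = t * (h1 s - D * s)"
      using z by auto
    obtain \<xi> where xi: "\<xi> \<in> {0<..<s}" "h1 s = s * h2 \<xi>" using mvt1[of s] s t by auto
    have "s * D \<le> s * h2 \<xi>" using b(2)[of \<xi>] xi s t by (intro mult_left_mono) auto
    then have "0 \<le> t * (h1 s - D * s)" using xi s t by (intro mult_nonneg_nonneg) (auto simp: mult.commute)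
    then show ?thesis using s(2) by linarith
  qed
  show "\<forall>\<^sub>F g in at_right g0. \<tau> g \<le> 11 / 10 * (sqrt 2 * \<bar>\<theta>\<bar> / sqrt (h2 0)) * sqrt (g - g0)"
    using ev0[OF bw] root gr
  proof eventually_elim
    case (elim g)
    have "D * (\<tau> g)\<^sup>2 / 2 \<le> \<theta>\<^sup>2 * (g - g0)"
      using quad[OF elim(1)] threshold_asymptotics(2)[OF th elim(3)] elim by simp
    then have "(\<tau> g)\<^sup>2 \<le> (11 / 10)\<^sup>2 * (2 * \<theta>\<^sup>2 / h2 0) * (g - g0)"
      using pos unfolding D_def by (simp add: field_simps)
    also have "\<dots> = (11 / 10 * (sqrt 2 * \<bar>\<theta>\<bar> / sqrt (h2 0)) * sqrt (g - g0))\<^sup>2"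
      using pos elim by (simp add: power_mult_distrib power_divide)
    finally show ?case
      by (rule power2_le_imp_le) (use pos elim in auto)
  qed
qed

text \<open>
  The root is provided by the intermediate value theorem; it tends to \<open>0\<close> since \<open>h\<close> exceeds \<open>\<theta>\<close>
  by a positive amount at every positive argument.
\<close>

lemma threshold_root:
  fixes h :: "real \<Rightarrow> real"
  assumes th: "\<theta> < 0" "g0 = - 1 / \<theta>" and w: "0 < w"
    and c: "continuous_on {0..w} h"
    and mono: "\<And>s t. 0 \<le> s \<Longrightarrow> s < t \<Longrightarrow> t \<le> w \<Longrightarrow> h s < h t"
    and z: "h 0 = \<theta>"
  obtains \<tau> where "filterlim \<tau> (at_right 0) (at_right g0)"
    "\<forall>\<^sub>F g in at_right g0. 0 < \<tau> g \<and> \<tau> g < w \<and> h (\<tau> g) = - 1 / g"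
proof -
  note gr = eventually_at_right_less[of g0]
  define \<tau> where "\<tau> g = (SOME t. t \<in> {0..w} \<and> h t = - 1 / g)" for g
  have key: "\<forall>\<^sub>F g in at_right g0. 0 < \<tau> g \<and> \<tau> g < e \<and> h (\<tau> g) = - 1 / g" if e: "0 < e" "e \<le> w" for e
  proof -
    have "\<theta> < h e" using mono[of 0 e] e z by simp
    then have "\<forall>\<^sub>F g in at_right g0. - 1 / g < h e"
      by (rule order_tendstoD(2)[OF threshold_tendsto[OF th]])
    then show ?thesis using gr
    proof eventually_elim
      case (elim g)
      have lo: "\<theta> < - 1 / g" by (rule threshold_asymptotics(1)[OF th elim(2)])
      have "\<exists>t\<ge>0. t \<le> w \<and> h t = - 1 / g"
      proof (rule IVT')
        show "- 1 / g \<le> h w" using elim(1) mono[of e w] e by (cases "e = w") auto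
      qed (use lo z w c in auto)
      then have ex: "\<tau> g \<in> {0..w} \<and> h (\<tau> g) = - 1 / g"
        unfolding \<tau>_def by (intro someI_ex[of "\<lambda>t. t \<in> {0..w} \<and> h t = - 1 / g"]) auto
      have "\<tau> g \<noteq> 0" using ex lo z by auto
      moreover have "\<tau> g < e"
      proof (rule ccontr)
        assume "\<not> \<tau> g < e"
        then have "h e \<le> h (\<tau> g)" using mono[of e "\<tau> g"] ex e by (cases "e = \<tau> g") auto
        then show False using ex elim by simp
      qed
      ultimately show ?case using ex by auto
    qed
  qed
  have "filterlim \<tau> (at_right 0) (at_right g0)"
    unfolding filterlim_at_right_to_0 filterlim_iff
  proof (intro allI impI)
    fix P :: "real \<Rightarrow> bool" assume "eventually P (at_right 0)"
    then obtain b where b: "0 < b" "\<And>t. 0 < t \<Longrightarrow> t < b \<Longrightarrow> P t"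
      unfolding eventually_at_right_field by auto
    have bw: "0 < min b w" using b w by simp
    show "\<forall>\<^sub>F g in at_right g0. P (\<tau> g)"
      using key[OF bw min.cobounded2] by eventually_elim (use b w in auto)
  qed
  then show thesis using that key[of w] w by auto
qed

text \<open>
  The mode \<open>a\<close> is inserted exactly at the distances below \<open>r\<close> from the end \<open>p0\<close>; \<open>s\<close> is \<open>1\<close> at a left
  and \<open>- 1\<close> at a right end.
\<close>

definition inserted_up_to ::
    "('m \<Rightarrow> real \<Rightarrow> real) \<Rightarrow> 'm \<Rightarrow> real \<Rightarrow> real \<Rightarrow> 'm \<Rightarrow> real \<Rightarrow> real \<Rightarrow> real \<Rightarrow> real \<Rightarrow> bool" where
  "inserted_up_to h c0 p q a s p0 g r \<longleftrightarrow> 0 < r \<and> r < q - p \<and> h a (p0 + s * r) = - 1 / g \<and>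
     (\<forall>t\<in>{p<..<q}. (s * (t - p0) < r \<longrightarrow> h a t < - 1 / g \<and> (\<forall>b. b \<noteq> a \<longrightarrow> h a t < h b t)) \<and>
        (r < s * (t - p0) \<longrightarrow> (\<forall>b. b \<noteq> c0 \<longrightarrow> - 1 / g < h b t)))"

text \<open>
  The functions \<open>h b\<close> are the components of \<open>d\<close> on an interval on which the current mode is \<open>c0\<close>,
  no two components meet and no component has a critical point. One mode \<open>a\<close> is then the
  strict minimiser throughout, and only it can be inserted, unless it is \<open>c0\<close> itself. Its component is monotone, so it
  falls below \<open>- 1 / g\<close> on an interval adjacent to one end, and for \<open>g\<close> close to \<open>g0\<close> it does so
  only if it attains \<open>\<theta>\<close> at that end. The sign \<open>s\<close> treats both ends at once: \<open>s (t - p0)\<close> is the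
  distance from the end \<open>p0\<close>.
\<close>

lemma gap_insertion:
  fixes h h1 :: "'m::finite \<Rightarrow> real \<Rightarrow> real"
  assumes th: "\<theta> < 0" "g0 = - 1 / \<theta>" and pq: "p < q"
    and h: "\<And>b. continuous_on {p..q} (h b)" and h0: "\<And>t. h c0 t = 0"
    and h1: "\<And>b. continuous_on {p..q} (h1 b)"
    and der: "\<And>b t. t \<in> {p<..<q} \<Longrightarrow> (h b has_real_derivative h1 b t) (at t)"
    and noncrit: "\<And>b t. b \<noteq> c0 \<Longrightarrow> t \<in> {p<..<q} \<Longrightarrow> h1 b t \<noteq> 0"
    and untied: "\<And>b b' t. b \<noteq> b' \<Longrightarrow> t \<in> {p<..<q} \<Longrightarrow> h b t \<noteq> h b' t"
    and lower: "\<And>b t. t \<in> {p<..<q} \<Longrightarrow> \<theta> \<le> h b t"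
  shows "(\<forall>\<^sub>F g in at_right g0. \<forall>t\<in>{p<..<q}. \<forall>b. b \<noteq> c0 \<longrightarrow> - 1 / g < h b t) \<or>
    (\<exists>a s p0 \<tau>. a \<noteq> c0 \<and> (s = 1 \<and> p0 = p \<or> s = - 1 \<and> p0 = q) \<and> h a p0 = \<theta> \<and>
      filterlim \<tau> (at_right 0) (at_right g0) \<and>
      (\<forall>\<^sub>F g in at_right g0. inserted_up_to h c0 p q a s p0 g (\<tau> g)))"
    (is "?I \<or> ?A")
proof -
  note gr = eventually_at_right_less[of g0]
  have g0: "0 < g0" using th by simp
  define mid where "mid = (p + q) / 2"
  have mid: "mid \<in> {p<..<q}" using pq by (simp add: mid_def)
  obtain a where a: "\<And>b. h a mid \<le> h b mid"
    using ex_is_arg_min_if_finite[of UNIV "\<lambda>b. h b mid"] by (auto simp: is_arg_min_linorder)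
  have least: "h a t < h b t" if "b \<noteq> a" "t \<in> {p<..<q}" for b t
  proof -
    have "continuous_on {p<..<q} (\<lambda>t. h b t - h a t)"
      by (intro continuous_intros continuous_on_subset[OF h]) auto
    then have "(\<forall>t\<in>{p<..<q}. 0 < h b t - h a t) \<or> (\<forall>t\<in>{p<..<q}. h b t - h a t < 0)"
      by (rule continuous_nonzero_constant_sign) (use untied[OF that(1)] in auto)
    then show ?thesis using that a[of b] mid by force
  qed
  have below: "h a t \<le> h b t" if "t \<in> {p<..<q}" for b t using least[of b t] that by (cases "b = a") auto
  show ?thesis
  proof (cases "a = c0")
    case True
    have ?I using gr
    proof eventually_elim
      case (elim g)
      then have "- 1 / g < 0" using g0 by simp
      then show ?case using least True h0 by (metis order_less_trans)
    qed
    then show ?thesis ..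
  next
    case False
    have "continuous_on {p<..<q} (h1 a)" by (rule continuous_on_subset[OF h1]) auto
    then have sign: "(\<forall>t\<in>{p<..<q}. 0 < h1 a t) \<or> (\<forall>t\<in>{p<..<q}. h1 a t < 0)"
      by (rule continuous_nonzero_constant_sign) (use noncrit[OF False] in auto)
    obtain s p0 where s: "s = 1 \<and> p0 = p \<or> s = - 1 \<and> p0 = q"
      and mono: "\<And>t t'. 0 \<le> t \<Longrightarrow> t < t' \<Longrightarrow> t' \<le> q - p \<Longrightarrow> h a (p0 + s * t) < h a (p0 + s * t')"
    proof (cases "\<forall>t\<in>{p<..<q}. 0 < h1 a t")
      case True
      have "h a (p + 1 * t) < h a (p + 1 * t')" if "0 \<le> t" "t < t'" "t' \<le> q - p" for t t'
      proof (rule DERIV_pos_imp_increasing_open[of "p + 1 * t" "p + 1 * t'" "h a"])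
        show "\<exists>y. (h a has_real_derivative y) (at r) \<and> 0 < y" if "p + 1 * t < r" "r < p + 1 * t'" for r
          using der[of r a] True that \<open>0 \<le> t\<close> \<open>t' \<le> q - p\<close> by fastforce
        show "continuous_on {p + 1 * t..p + 1 * t'} (h a)"
          using that by (intro continuous_on_subset[OF h]) auto
      qed (use that in auto)
      then show thesis using that by blast
    next
      case False
      then have neg: "\<forall>t\<in>{p<..<q}. h1 a t < 0" using sign by blast
      have "h a (q + - 1 * t) < h a (q + - 1 * t')" if "0 \<le> t" "t < t'" "t' \<le> q - p" for t t'
      proof (rule DERIV_neg_imp_decreasing_open[of "q + - 1 * t'" "q + - 1 * t" "h a"])
        show "\<exists>y. (h a has_real_derivative y) (at r) \<and> y < 0" if "q + - 1 * t' < r" "r < q + - 1 * t" for r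
          using der[of r a] neg that \<open>0 \<le> t\<close> \<open>t' \<le> q - p\<close> by fastforce
        show "continuous_on {q + - 1 * t'..q + - 1 * t} (h a)"
          using that by (intro continuous_on_subset[OF h]) auto
      qed (use that in auto)
      then show thesis using that by blast
    qed
    define \<phi> where "\<phi> t = h a (p0 + s * t)" for t
    have s2: "s * s = 1" using s by auto
    have inj: "t = p0 + s * (s * (t - p0))" for t using s by auto
    have inside: "0 < s * (t - p0) \<and> s * (t - p0) < q - p" if "t \<in> {p<..<q}" for t
      using s that by auto
    have c\<phi>: "continuous_on {0..q - p} \<phi>"
      unfolding \<phi>_def by (intro continuous_on_compose2[OF h] continuous_intros) (use s in auto)
    have "p0 \<in> {p..q}" using s pq by auto
    moreover have "continuous_on (closure {p<..<q}) (h a)" using h pq by (simp add: closure_greaterThanLessThan)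
    ultimately have "\<theta> \<le> h a p0"
      using continuous_ge_on_closure[of "{p<..<q}" "h a" p0 \<theta>] lower pq by (simp add: closure_greaterThanLessThan)
    then consider "\<theta> < h a p0" | "h a p0 = \<theta>" by linarith
    then show ?thesis
    proof cases
      case 1
      then have "\<forall>\<^sub>F g in at_right g0. - 1 / g < h a p0"
        by (rule order_tendstoD(2)[OF threshold_tendsto[OF th]])
      then have ?I
      proof eventually_elim
        case (elim g)
        have "- 1 / g < h b t" if t: "t \<in> {p<..<q}" for t b
        proof -
          have "h a p0 < h a t" using mono[of 0 "s * (t - p0)"] inside[OF t] inj[of t] by simp
          then show ?thesis using elim below[OF t, of b] by linarith
        qed
        then show ?case by blast
      qed
      then show ?thesis ..
    next
      case 2
      obtain \<tau> where \<tau>: "filterlim \<tau> (at_right 0) (at_right g0)"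
        "\<forall>\<^sub>F g in at_right g0. 0 < \<tau> g \<and> \<tau> g < q - p \<and> \<phi> (\<tau> g) = - 1 / g"
      proof (rule threshold_root[OF th, of "q - p" \<phi>])
        show "\<phi> s < \<phi> t" if "0 \<le> s" "s < t" "t \<le> q - p" for s t
          unfolding \<phi>_def by (rule mono[OF that])
      qed (use pq c\<phi> 2 in \<open>auto simp: \<phi>_def\<close>)
      have "\<forall>\<^sub>F g in at_right g0. inserted_up_to h c0 p q a s p0 g (\<tau> g)"
        using \<tau>(2)
      proof eventually_elim
        case (elim g)
        have lt: "h a t < - 1 / g" if t: "t \<in> {p<..<q}" "s * (t - p0) < \<tau> g" for t
          using mono[of "s * (t - p0)" "\<tau> g"] inside[OF t(1)] inj[of t] t(2) elim unfolding \<phi>_def by simp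
        have gt: "- 1 / g < h b t" if t: "t \<in> {p<..<q}" "\<tau> g < s * (t - p0)" for t b
        proof -
          have "- 1 / g < h a t"
            using mono[of "\<tau> g" "s * (t - p0)"] inside[OF t(1)] inj[of t] t(2) elim unfolding \<phi>_def by simp
          then show ?thesis using below[OF t(1), of b] by linarith
        qed
        show ?case unfolding inserted_up_to_def using elim lt gt least unfolding \<phi>_def by blast
      qed
      then have ?A using False s 2 \<tau>(1) by blast
      then show ?thesis ..
    qed
  qed
qed

section \<open>Switching times and breakpoints\<close>

text \<open>
  Unlike in a mode schedule, neighbouring modes may agree, so a breakpoint need not be a switch.
\<close>

definition piecewise_modes ::
    "nat \<Rightarrow> (nat \<Rightarrow> real) \<Rightarrow> (nat \<Rightarrow> 'm::finite) \<Rightarrow> (real \<Rightarrow> real^'m) \<Rightarrow> bool" where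
  "piecewise_modes m q b v \<longleftrightarrow>
     (\<forall>j<m. q j < q (Suc j) \<and> (AE t in lebesgue. t \<in> {q j<..<q (Suc j)} \<longrightarrow> v t = axis (b j) 1))"

definition jumps :: "nat \<Rightarrow> (nat \<Rightarrow> 'm) \<Rightarrow> nat set" where
  "jumps m b = {j\<in>{1..<m}. b (j - 1) \<noteq> b j}"

lemma modes_agree_on_overlap:
  fixes v :: "real \<Rightarrow> real^'m::finite"
  assumes "AE t in lebesgue. t \<in> {p<..<q} \<longrightarrow> v t = axis a 1"
    and "AE t in lebesgue. t \<in> {p'<..<q'} \<longrightarrow> v t = axis b 1"
    and "max p p' < min q q'"
  shows "a = b"
proof (rule ccontr)
  assume ne: "a \<noteq> b"
  have "AE t in lebesgue. t \<notin> {max p p'<..<min q q'}"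
    using assms(1,2)
  proof eventually_elim
    case (elim t)
    show ?case
    proof
      assume "t \<in> {max p p'<..<min q q'}"
      then have "v t = axis a 1" "v t = axis b 1" using elim by auto
      then show False using ne by (simp add: axis_eq_axis)
    qed
  qed
  then have "{max p p'<..<min q q'} \<in> null_sets lebesgue"
    by (subst AE_iff_null_sets) auto
  then have "negligible {max p p'<..<min q q'}" by (simp add: negligible_iff_null_sets)
  moreover have "open {max p p'<..<min q q'}" "{max p p'<..<min q q'} \<noteq> {}" using assms(3) by auto
  ultimately show False using open_not_negligible by blast
qed

lemma increasing_chain:
  fixes q :: "nat \<Rightarrow> real"
  assumes "\<And>j. j < m \<Longrightarrow> q j < q (Suc j)" "i < j" "j \<le> m"
  shows "q i < q j"
  using assms(2,3)
proof (induction j)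
  case (Suc j)
  then show ?case using assms(1)[of j] by (cases "i = j") (auto simp: less_Suc_eq)
qed simp

lemma increasing_chain_locate:
  fixes q :: "nat \<Rightarrow> real"
  assumes "q 0 \<le> t" "t < q m"
  shows "\<exists>j<m. q j \<le> t \<and> t < q (Suc j)"
  using assms
proof (induction m)
  case (Suc m)
  then show ?case by (cases "t < q m") (auto simp: not_less less_Suc_eq)
qed auto

text \<open>
  At a genuine switch the modes on the two sides differ, and both descriptions must show it:
  every description of the same control has a breakpoint there.
\<close>

lemma jump_transfer:
  fixes v :: "real \<Rightarrow> real^'m::finite"
  assumes q: "piecewise_modes m q b v" and q': "piecewise_modes m' q' b' v"
    and ends: "q 0 = q' 0" "q m = q' m'" and j: "j \<in> jumps m b"
  shows "\<exists>j'\<in>jumps m' b'. q' j' = q j \<and> b' (j' - 1) = b (j - 1) \<and> b' j' = b j"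
proof -
  have inc: "\<And>i. i < m \<Longrightarrow> q i < q (Suc i)" and inc': "\<And>i. i < m' \<Longrightarrow> q' i < q' (Suc i)"
    and ae: "\<And>i. i < m \<Longrightarrow> AE t in lebesgue. t \<in> {q i<..<q (Suc i)} \<longrightarrow> v t = axis (b i) 1"
    and ae': "\<And>i. i < m' \<Longrightarrow> AE t in lebesgue. t \<in> {q' i<..<q' (Suc i)} \<longrightarrow> v t = axis (b' i) 1"
    using q q' unfolding piecewise_modes_def by auto
  have jm: "1 \<le> j" "j < m" "b (j - 1) \<noteq> b j" using j unfolding jumps_def by auto
  have "q 0 < q j" "q j < q m" using increasing_chain[of m q, OF inc] jm by auto
  then obtain j' where j': "j' < m'" "q' j' \<le> q j" "q j < q' (Suc j')"
    using increasing_chain_locate[of q' "q j" m'] ends by auto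
  have left: "q (j - 1) < q j" using inc[of "j - 1"] jm by simp
  have aeL: "AE t in lebesgue. t \<in> {q (j - 1)<..<q j} \<longrightarrow> v t = axis (b (j - 1)) 1"
    using ae[of "j - 1"] jm by simp
  have bj: "b j = b' j'"
    by (rule modes_agree_on_overlap[OF ae[OF jm(2)] ae'[OF j'(1)]]) (use inc[OF jm(2)] j' in auto)
  have eq: "q' j' = q j"
  proof (rule ccontr)
    assume "q' j' \<noteq> q j"
    then have "b (j - 1) = b' j'"
      by (intro modes_agree_on_overlap[OF aeL ae'[OF j'(1)]]) (use left j' in auto)
    then show False using bj jm by simp
  qed
  have "j' \<noteq> 0" using eq \<open>q 0 < q j\<close> ends by (metis less_irrefl)
  then have j'1: "j' - 1 < m'" "Suc (j' - 1) = j'" using j' by auto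
  have "b (j - 1) = b' (j' - 1)"
    by (rule modes_agree_on_overlap[OF aeL ae'[OF j'1(1)]])
      (use left inc'[OF j'1(1)] j'1 eq in auto)
  then have "j' \<in> jumps m' b'" "b' (j' - 1) = b (j - 1)"
    using bj jm j' \<open>j' \<noteq> 0\<close> unfolding jumps_def by auto
  then show ?thesis using eq bj by auto
qed

lemma mode_schedule_piecewise_modes:
  assumes "mode_schedule T M sg s v"
  shows "piecewise_modes M s (\<lambda>j. sg (Suc j)) v" "s 0 = 0" "s M = T"
    "jumps M (\<lambda>j. sg (Suc j)) = {1..<M}"
proof -
  show "piecewise_modes M s (\<lambda>j. sg (Suc j)) v"
    unfolding piecewise_modes_def
  proof (intro allI impI conjI)
    fix j assume j: "j < M"
    then have *: "Suc j \<in> {1..M}" by auto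
    have "\<forall>i\<in>{1..M}. s (i - 1) < s i" using assms unfolding mode_schedule_def by blast
    from this[rule_format, OF *] show "s j < s (Suc j)" by simp
    have "\<forall>i\<in>{1..M}. AE t in lebesgue. t \<in> {s (i - 1)..<s i} \<longrightarrow> v t = axis (sg i) 1"
      using assms unfolding mode_schedule_def by blast
    from this[rule_format, OF *]
    show "AE t in lebesgue. t \<in> {s j<..<s (Suc j)} \<longrightarrow> v t = axis (sg (Suc j)) 1"
      by eventually_elim auto
  qed
  show "s 0 = 0" "s M = T" using assms unfolding mode_schedule_def by auto
  show "jumps M (\<lambda>j. sg (Suc j)) = {1..<M}"
    using assms unfolding mode_schedule_def jumps_def by auto
qed

text \<open>
  The switching times are exactly the breakpoints at which the mode changes, in increasing
  order, so the \<open>i\<close>-th one is the breakpoint that is \<open>i\<close>-th among the jumps.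
\<close>

lemma switching_time_rank:
  fixes v :: "real \<Rightarrow> real^'m::finite"
  assumes ms: "mode_schedule T M sg s v" and pm: "piecewise_modes m q b v"
    and ends: "q 0 = 0" "q m = T" and i: "i \<in> {1..<M}"
  shows "\<exists>j\<in>jumps m b. card {k\<in>jumps m b. k \<le> j} = i \<and> s i = q j \<and> sg i = b (j - 1) \<and> sg (i + 1) = b j"
proof -
  note sch = mode_schedule_piecewise_modes[OF ms]
  have qinc: "q k < q k'" if "k < k'" "k' \<le> m" for k k'
    by (rule increasing_chain[OF _ that]) (use pm in \<open>auto simp: piecewise_modes_def\<close>)
  have sinc: "s k < s k'" if "k < k'" "k' \<le> M" for k k'
    by (rule increasing_chain[OF _ that]) (use sch(1) in \<open>auto simp: piecewise_modes_def\<close>)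
  have "\<forall>i\<in>{1..<M}. \<exists>j\<in>jumps m b. q j = s i \<and> b (j - 1) = sg i \<and> b j = sg (i + 1)"
  proof
    fix i assume i: "i \<in> {1..<M}"
    then have "i \<in> jumps M (\<lambda>j. sg (Suc j))" using sch(4) by simp
    from jump_transfer[OF sch(1) pm _ _ this] show "\<exists>j\<in>jumps m b. q j = s i \<and> b (j - 1) = sg i \<and> b j = sg (i + 1)"
      using sch ends i by auto
  qed
  then obtain \<phi> where \<phi>: "\<And>i. i \<in> {1..<M} \<Longrightarrow> \<phi> i \<in> jumps m b \<and> q (\<phi> i) = s i \<and> b (\<phi> i - 1) = sg i \<and> b (\<phi> i) = sg (i + 1)"
    by metis
  have qle: "q k \<le> q k' \<longleftrightarrow> k \<le> k'" if "k \<in> jumps m b" "k' \<in> jumps m b" for k k'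
    using that qinc[of k k'] qinc[of k' k] unfolding jumps_def
    by (metis (no_types, lifting) atLeastLessThan_iff less_imp_le mem_Collect_eq not_le order.order_iff_strict)
  have sle: "s k \<le> s k' \<longleftrightarrow> k \<le> k'" if "k \<in> {1..<M}" "k' \<in> {1..<M}" for k k'
    using that sinc[of k k'] sinc[of k' k]
    by (metis atLeastLessThan_iff less_imp_le not_le order.order_iff_strict)
  have \<phi>le: "\<phi> k \<le> \<phi> k' \<longleftrightarrow> k \<le> k'" if "k \<in> {1..<M}" "k' \<in> {1..<M}" for k k'
    using qle[of "\<phi> k" "\<phi> k'"] sle[OF that] \<phi>[OF that(1)] \<phi>[OF that(2)] by auto
  have "bij_betw \<phi> {1..i} {k\<in>jumps m b. k \<le> \<phi> i}"
    unfolding bij_betw_def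
  proof
    show "inj_on \<phi> {1..i}"
    proof (rule inj_onI)
      fix k k' assume "k \<in> {1..i}" "k' \<in> {1..i}" "\<phi> k = \<phi> k'"
      then show "k = k'" using \<phi>le[of k k'] \<phi>le[of k' k] i by auto
    qed
    show "\<phi> ` {1..i} = {k\<in>jumps m b. k \<le> \<phi> i}"
    proof
      show "\<phi> ` {1..i} \<subseteq> {k\<in>jumps m b. k \<le> \<phi> i}"
        using \<phi> \<phi>le i by auto
      show "{k\<in>jumps m b. k \<le> \<phi> i} \<subseteq> \<phi> ` {1..i}"
      proof
        fix k assume k: "k \<in> {k\<in>jumps m b. k \<le> \<phi> i}"
        then have "k \<in> jumps m b" by simp
        from jump_transfer[OF pm sch(1) _ _ this] obtain i' where i': "i' \<in> {1..<M}" "s i' = q k"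
          using sch ends by auto
        have "\<phi> i' = k"
          using qle[of "\<phi> i'" k] qle[of k "\<phi> i'"] \<phi>[OF i'(1)] k i' by auto
        then have "i' \<le> i" using \<phi>le[OF i'(1) i] k by simp
        then show "k \<in> \<phi> ` {1..i}" using \<open>\<phi> i' = k\<close> i' by auto
      qed
    qed
  qed
  then have "card {k\<in>jumps m b. k \<le> \<phi> i} = i" using bij_betw_same_card by fastforce
  then show ?thesis using \<phi>[OF i] by (intro bexI[of _ "\<phi> i"]) auto
qed

text \<open>
  The rank of a breakpoint among the jumps depends only on the sequence of modes. If that
  sequence is fixed while the breakpoints move, every switching time therefore follows one
  breakpoint.
\<close>

lemma switching_times_follow_breakpoints:
  fixes v :: "real \<Rightarrow> real \<Rightarrow> real^'m::finite" and G :: "real filter"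
  assumes nontriv: "G \<noteq> bot"
    and ev: "\<forall>\<^sub>F g in G. mode_schedule T M sg (Ts g) (v g) \<and> piecewise_modes m (q g) b (v g) \<and> q g 0 = 0 \<and> q g m = T"
  obtains idx where "bij_betw idx {1..<M} (jumps m b)"
    "\<And>i. i \<in> {1..<M} \<Longrightarrow> sg i = b (idx i - 1) \<and> sg (i + 1) = b (idx i)"
    "\<And>i. i \<in> {1..<M} \<Longrightarrow> \<forall>\<^sub>F g in G. Ts g i = q g (idx i)"
proof -
  define D where "D = jumps m b"
  \<comment> \<open>the rank among the jumps, which identifies a jump\<close>
  define r where "r j = card {k\<in>D. k \<le> j}" for j
  have finD: "finite D" unfolding D_def jumps_def by simp
  have r_mono: "r j < r k" if "j < k" "k \<in> D" for j k
  proof -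
    have "k \<in> {x\<in>D. x \<le> k}" "k \<notin> {x\<in>D. x \<le> j}" using that by auto
    moreover have "{x\<in>D. x \<le> j} \<subseteq> {x\<in>D. x \<le> k}" using that by auto
    ultimately have "{x\<in>D. x \<le> j} \<subset> {x\<in>D. x \<le> k}" by blast
    then show ?thesis unfolding r_def using finD by (intro psubset_card_mono) auto
  qed
  then have r_inj: "inj_on r D" by (intro inj_onI) (metis less_irrefl linorder_neqE_nat)
  obtain g1 where g1: "mode_schedule T M sg (Ts g1) (v g1)" "piecewise_modes m (q g1) b (v g1)" "q g1 0 = 0" "q g1 m = T"
    using eventually_happens'[OF nontriv ev] by blast
  have rank: "\<exists>j\<in>D. r j = i \<and> sg i = b (j - 1) \<and> sg (i + 1) = b j" if "i \<in> {1..<M}" for i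
    using switching_time_rank[OF g1 that] unfolding D_def r_def by blast
  have "r ` D = {1..<M}"
  proof
    show "{1..<M} \<subseteq> r ` D" using rank by blast
    show "r ` D \<subseteq> {1..<M}"
    proof
      fix x assume "x \<in> r ` D"
      then obtain j where j: "j \<in> D" "x = r j" by blast
      note sch = mode_schedule_piecewise_modes[OF g1(1)]
      from jump_transfer[OF g1(2) sch(1), of j] obtain i where i: "i \<in> {1..<M}" "Ts g1 i = q g1 j"
        using sch g1 j unfolding D_def by auto
      from switching_time_rank[OF g1 i(1)] obtain j' where j': "j' \<in> D" "r j' = i" "Ts g1 i = q g1 j'"
        unfolding D_def r_def by blast
      have "q g1 k < q g1 k'" if "k < k'" "k' \<in> D" for k k'
        by (rule increasing_chain[of m _ k k'])
          (use g1(2) that in \<open>auto simp: piecewise_modes_def D_def jumps_def\<close>)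
      then have "j' = j" using j j' i by (metis less_irrefl linorder_neqE_nat)
      then show "x \<in> {1..<M}" using j j' i by simp
    qed
  qed
  then have bij: "bij_betw r D {1..<M}" using r_inj unfolding bij_betw_def by blast
  define idx where "idx = inv_into D r"
  have idx: "idx i \<in> D \<and> r (idx i) = i" if "i \<in> {1..<M}" for i
    using bij that unfolding idx_def by (metis bij_betw_def f_inv_into_f inv_into_into)
  have uniq: "j = idx i" if "i \<in> {1..<M}" "j \<in> D" "r j = i" for i j
    using idx[OF that(1)] that r_inj by (metis inj_onD)
  show thesis
  proof (rule that)
    show "bij_betw idx {1..<M} (jumps m b)"
      using bij_betw_inv_into[OF bij] unfolding idx_def D_def .
    fix i assume i: "i \<in> {1..<M}"
    show "sg i = b (idx i - 1) \<and> sg (i + 1) = b (idx i)"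
    proof -
      obtain j where j: "j \<in> D" "r j = i" "sg i = b (j - 1) \<and> sg (i + 1) = b j" using rank[OF i] by blast
      show ?thesis using j(3) uniq[OF i j(1,2)] by simp
    qed
    show "\<forall>\<^sub>F g in G. Ts g i = q g (idx i)"
      using ev
    proof eventually_elim
      case (elim g)
      have "\<exists>j\<in>D. r j = i \<and> Ts g i = q g j"
        using switching_time_rank[of T M sg "Ts g" "v g" m "q g" b i] elim i unfolding D_def r_def by auto
      then obtain j where j: "j \<in> D" "r j = i" "Ts g i = q g j" by blast
      show ?case using j(3) uniq[OF i j(1,2)] by simp
    qed
  qed
qed

text \<open>
  By Rolle's theorem a critical point lies between any two zeros, so distinct zeros have
  different numbers of critical points to their left.
\<close>

lemma finite_zeros:
  assumes c: "continuous_on {0..T} g" and fin: "finite (critical_points T g)"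
  shows "finite {t\<in>{0..T}. g t = 0}"
proof -
  let ?Z = "{t\<in>{0..T}. g t = 0}" and ?C = "critical_points T g"
  define r where "r z = card {c\<in>?C. c < z}" for z
  have less: "r z < r z'" if z: "z \<in> ?Z" "z' \<in> ?Z" "z < z'" for z z'
  proof -
    have "\<exists>\<xi>\<in>{z<..<z'}. \<xi> \<in> ?C"
    proof (rule ccontr)
      assume none: "\<not> ?thesis"
      have diff: "g differentiable (at t)" if "z < t" "t < z'" for t
      proof -
        have "t \<in> {0..T}" "t \<notin> ?C" using none that z by auto
        then have "g differentiable (at t within {0..T})" unfolding critical_points_def by blast
        then show ?thesis using that z at_within_Icc_at[of 0 t T] by simp
      qed
      have "\<exists>\<xi>. z < \<xi> \<and> \<xi> < z' \<and> DERIV g \<xi> :> 0"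
        using z by (intro Rolle diff continuous_on_subset[OF c]) auto
      then obtain \<xi> where xi: "z < \<xi>" "\<xi> < z'" "DERIV g \<xi> :> 0" by blast
      then have "\<xi> \<in> ?C" unfolding critical_points_def
        using z has_field_derivative_at_within by fastforce
      then show False using none xi by auto
    qed
    then obtain \<xi> where "\<xi> \<in> ?C" "z < \<xi>" "\<xi> < z'" by auto
    then have "\<xi> \<in> {c\<in>?C. c < z'}" "\<xi> \<notin> {c\<in>?C. c < z}" by auto
    moreover have "{c\<in>?C. c < z} \<subseteq> {c\<in>?C. c < z'}" using z(3) by auto
    ultimately have "{c\<in>?C. c < z} \<subset> {c\<in>?C. c < z'}" by blast
    then show ?thesis unfolding r_def using fin by (intro psubset_card_mono) auto
  qed
  have "inj_on r ?Z"
  proof (rule inj_onI)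
    fix z z' assume "z \<in> ?Z" "z' \<in> ?Z" "r z = r z'"
    then show "z = z'" using less[of z z'] less[of z' z] by (metis less_irrefl linorder_neqE_linordered_idom)
  qed
  moreover have "r ` ?Z \<subseteq> {..card ?C}"
    unfolding r_def using fin by (auto intro!: card_mono)
  ultimately show ?thesis using finite_subset finite_imageD by (metis finite_atMost)
qed

lemma partition_by_finite_set:
  fixes P :: "real set"
  assumes "finite P" "a < b"
  obtains n p where "p 0 = a" "p n = b" "\<And>k. k < n \<Longrightarrow> p k < p (Suc k)"
    "\<And>k. k < n \<Longrightarrow> {p k<..<p (Suc k)} \<inter> P = {}"
proof -
  define Q where "Q = insert a (insert b (P \<inter> {a..b}))"
  define xs where "xs = sorted_list_of_set Q"
  have Q: "finite Q" "Q \<subseteq> {a..b}" "a \<in> Q" "b \<in> Q" using assms unfolding Q_def by auto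
  have xs: "set xs = Q" "sorted_wrt (<) xs" unfolding xs_def using Q by auto
  have lt: "xs ! i < xs ! j" if "i < j" "j < length xs" for i j
    using xs(2) that by (simp add: sorted_wrt_iff_nth_less)
  have len: "0 < length xs" using xs Q by auto
  define n where "n = length xs - 1"
  have n: "length xs = Suc n" using len by (simp add: n_def)
  obtain i where i: "i < length xs" "xs ! i = a" using xs Q by (metis in_set_conv_nth)
  obtain j where j: "j < length xs" "xs ! j = b" using xs Q by (metis in_set_conv_nth)
  have mem: "xs ! k \<in> {a..b}" if "k < length xs" for k using xs Q that by (metis nth_mem subsetD)
  have i0: "i = 0" using lt[of 0 i] i mem[of 0] len by fastforce
  have jn: "j = n" using lt[of j n] j mem[of n] n by fastforce
  show thesis
  proof (rule that[of "\<lambda>k. xs ! k" n])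
    show "xs ! 0 = a" "xs ! n = b" using i i0 j jn by auto
    fix k assume k: "k < n"
    show "xs ! k < xs ! Suc k" using lt[of k "Suc k"] k n by simp
    show "{xs ! k<..<xs ! Suc k} \<inter> P = {}"
    proof (rule ccontr)
      assume "\<not> ?thesis"
      then obtain y where y: "y \<in> P" "xs ! k < y" "y < xs ! Suc k" by auto
      then have "y \<in> Q" unfolding Q_def using mem[of k] mem[of "Suc k"] k n by auto
      then obtain r where r: "r < length xs" "xs ! r = y" using xs by (metis in_set_conv_nth)
      have "k < r" using lt[of r k] r y k n by (metis less_asym less_SucI linorder_neqE_nat less_irrefl)
      moreover have "r < Suc k" using lt[of "Suc k" r] r y k n by (metis less_asym linorder_neqE_nat less_irrefl)
      ultimately show False by simp
    qed
  qed
qed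

section \<open>The insertion gradient between switches\<close>

lemma has_vector_derivative_chain:
  assumes g: "(g has_derivative g') (at (z t))" and z: "(z has_vector_derivative z') (at t)"
  shows "((\<lambda>t. g (z t)) has_vector_derivative g' z') (at t)"
proof -
  have "((\<lambda>t. g (z t)) has_derivative (\<lambda>h. g' (h *\<^sub>R z'))) (at t)"
    using has_derivative_compose[OF z[unfolded has_vector_derivative_def] g] .
  moreover have "g' (h *\<^sub>R z') = h *\<^sub>R g' z'" for h
    using has_derivative_linear[OF g] by (simp add: linear_scale)
  ultimately show ?thesis unfolding has_vector_derivative_def by simp
qed

context adjoint_trajectory
begin

text \<open>
  \<open>H a b\<close> is the difference of the components \<open>a\<close> and \<open>b\<close> of the mode insertion gradient, in which the
  current control cancels. While the current mode is \<open>b\<close> it equals the component \<open>a\<close> itself.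
\<close>

definition H :: "'m \<Rightarrow> 'm \<Rightarrow> real \<Rightarrow> real" where
  "H a b t = \<rho> t \<bullet> (f a (x t) - f b (x t))"

text \<open>
  The time derivative of \<open>H a m\<close> while \<open>m\<close> is the current mode, written as an expression that
  is continuous on the whole interval. Its value at the end of an interval of constancy is
  therefore the one-sided limit of the derivative; likewise for \<open>H2\<close> below.
\<close>

definition H1 :: "'m \<Rightarrow> 'm \<Rightarrow> real \<Rightarrow> real" where
  "H1 a m t = \<rho> t \<bullet> (f' a (x t) (f m (x t)) - f' m (x t) (f m (x t)))
     - (\<rho> t \<bullet> f' m (x t) (f a (x t) - f m (x t)) + l' (x t) (f a (x t) - f m (x t)))"

definition H2 :: "'m \<Rightarrow> 'm \<Rightarrow> real \<Rightarrow> real" where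
  "H2 a m t =
    (let X = f m (x t); X' = f' m (x t) X; w = f a (x t) - X; w' = f' a (x t) X - X';
         V = f' a (x t) X - f' m (x t) X;
         V' = (f' a (x t) X' + f'' a (x t) X X) - (f' m (x t) X' + f'' m (x t) X X)
     in (\<rho> t \<bullet> V' + (- costate_rhs m t) \<bullet> V)
        - ((\<rho> t \<bullet> (f' m (x t) w' + f'' m (x t) X w) + (- costate_rhs m t) \<bullet> f' m (x t) w)
           + (l' (x t) w' + l'' (x t) X w)))"

lemma f''x_continuous: "continuous_on {0..T} (\<lambda>t. f'' m (x t))"
  by (rule continuous_on_compose2[OF f''_cont x_continuous]) auto

lemma l''x_continuous: "continuous_on {0..T} (\<lambda>t. l'' (x t))"
  by (rule continuous_on_compose2[OF l''_cont x_continuous]) auto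

lemma H_continuous: "continuous_on {0..T} (H a b)"
  unfolding H_def by (intro continuous_intros rho_continuous fx_continuous)

lemma H1_continuous: "continuous_on {0..T} (H1 a b)"
  unfolding H1_def
  by (intro continuous_intros rho_continuous fx_continuous f'x_continuous l'x_continuous)

lemma H2_continuous: "continuous_on {0..T} (H2 a b)"
  unfolding H2_def Let_def
  by (intro continuous_intros rho_continuous fx_continuous f'x_continuous l'x_continuous
      f''x_continuous l''x_continuous costate_rhs_continuous)

lemma H_has_derivative:
  assumes t: "t \<in> {0<..<T} - S"
  shows "(H a (c t) has_real_derivative H1 a (c t) t) (at t)"
proof -
  define m where "m = c t"
  have dx: "(x has_vector_derivative f m (x t)) (at t)"
    and dr: "(\<rho> has_vector_derivative - costate_rhs m t) (at t)"
    using x_has_derivative[OF t] rho_has_derivative[OF t] by (auto simp: m_def)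
  have df: "((\<lambda>t. f b (x t)) has_vector_derivative f' b (x t) (f m (x t))) (at t)" for b
    by (rule has_vector_derivative_chain[OF f' dx])
  have "(H a m has_vector_derivative
      \<rho> t \<bullet> (f' a (x t) (f m (x t)) - f' m (x t) (f m (x t)))
      + (- costate_rhs m t) \<bullet> (f a (x t) - f m (x t))) (at t)"
    unfolding H_def
    by (rule bounded_bilinear.has_vector_derivative[OF bounded_bilinear_inner dr
          has_vector_derivative_diff[OF df df]])
  moreover have "\<rho> t \<bullet> (f' a (x t) (f m (x t)) - f' m (x t) (f m (x t)))
      + (- costate_rhs m t) \<bullet> (f a (x t) - f m (x t)) = H1 a m t"
    unfolding H1_def costate_rhs_def inner_minus_left inner_add_left inner_adjoint_blinfun by simp
  ultimately show ?thesis
    unfolding m_def[symmetric] has_real_derivative_iff_has_vector_derivative by simp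
qed

lemma H1_has_derivative:
  assumes t: "t \<in> {0<..<T} - S"
  shows "(H1 a (c t) has_real_derivative H2 a (c t) t) (at t)"
proof -
  define m where "m = c t"
  define X where "X = f m (x t)"
  define X' where "X' = f' m (x t) X"
  have dx: "(x has_vector_derivative X) (at t)"
    and dr: "(\<rho> has_vector_derivative - costate_rhs m t) (at t)"
    using x_has_derivative[OF t] rho_has_derivative[OF t] by (auto simp: m_def X_def)
  have df: "((\<lambda>t. f b (x t)) has_vector_derivative f' b (x t) X) (at t)" for b
    by (rule has_vector_derivative_chain[OF f' dx])
  have df': "((\<lambda>t. f' b (x t)) has_vector_derivative f'' b (x t) X) (at t)" for b
    by (rule has_vector_derivative_chain[OF f'' dx])
  have dl': "((\<lambda>t. l' (x t)) has_vector_derivative l'' (x t) X) (at t)"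
    by (rule has_vector_derivative_chain[OF l'' dx])
  note app = bounded_bilinear.has_vector_derivative[OF bounded_bilinear_blinfun_apply]
  note inn = bounded_bilinear.has_vector_derivative[OF bounded_bilinear_inner]
  note sub = has_vector_derivative_diff
  have dX: "((\<lambda>t. f m (x t)) has_vector_derivative X') (at t)"
    unfolding X'_def by (rule df)
  have dw: "((\<lambda>t. f a (x t) - f m (x t)) has_vector_derivative f' a (x t) X - X') (at t)"
    by (rule sub[OF df dX])
  have "(H1 a m has_vector_derivative H2 a m t) (at t)"
    unfolding H1_def[abs_def] H2_def Let_def X_def[symmetric] X'_def[symmetric]
    unfolding X_def X'_def
    by (rule sub[OF inn[OF dr sub[OF app[OF df' dX] app[OF df' dX]]]
          has_vector_derivative_add[OF inn[OF dr app[OF df' dw]] app[OF dl' dw]],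
          unfolded X_def X'_def])
  then show ?thesis
    unfolding m_def[symmetric] has_real_derivative_iff_has_vector_derivative by simp
qed

text \<open>
  The component \<open>a\<close> of \<open>u - g d\<close> is the strict maximum at a time with current mode \<open>m\<close>.
\<close>

definition wins :: "real \<Rightarrow> 'm \<Rightarrow> real \<Rightarrow> 'm \<Rightarrow> bool" where
  "wins g m t a \<longleftrightarrow>
    (\<forall>b. b \<noteq> a \<longrightarrow> (if b = m then 1 else 0) - g * H b m t < (if a = m then 1 else 0) - g * H a m t)"

lemma H_self [simp]: "H a a t = 0"
  by (simp add: H_def)

lemma wins_current:
  assumes "0 < g" "\<And>b. b \<noteq> m \<Longrightarrow> - 1 / g < H b m t"
  shows "wins g m t m"
  unfolding wins_def
proof (intro allI impI)
  fix b assume b: "b \<noteq> m"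
  have "- 1 < g * H b m t" using assms(2)[OF b] assms(1) by (simp add: field_simps)
  then show "(if b = m then 1 else 0) - g * H b m t < (if m = m then 1 else 0) - g * H m m t"
    using b by simp
qed

lemma wins_inserted:
  assumes "0 < g" "a \<noteq> m" "H a m t < - 1 / g" "\<And>b. b \<noteq> a \<Longrightarrow> H a m t < H b m t"
  shows "wins g m t a"
  unfolding wins_def
proof (intro allI impI)
  fix b assume b: "b \<noteq> a"
  have "1 < - (g * H a m t)" using assms(1,3) by (simp add: field_simps)
  moreover have "g * H a m t < g * H b m t" using assms(4)[OF b] assms(1) by simp
  ultimately show "(if b = m then 1 else 0) - g * H b m t < (if a = m then 1 else 0) - g * H a m t"
    using assms(2) by auto
qed

definition splits :: "real \<Rightarrow> real \<Rightarrow> 'm \<Rightarrow> real \<Rightarrow> 'm \<Rightarrow> 'm \<Rightarrow> real \<Rightarrow> bool" where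
  "splits p q m r b1 b2 g \<longleftrightarrow> p < r \<and> r < q \<and>
     (\<forall>t\<in>{p<..<q}. (t < r \<longrightarrow> wins g m t b1) \<and> (r < t \<longrightarrow> wins g m t b2))"

text \<open>
  On an interval between \<open>p\<close> and \<open>q\<close> with current mode \<open>m\<close>, the mode \<open>a\<close> is inserted between the
  end \<open>p0\<close> and the point \<open>e g\<close>, which shrinks to \<open>p0\<close>; \<open>b1\<close> and \<open>b2\<close> are the resulting modes to the
  left and to the right of \<open>e g\<close>. The rates are those of the two lemmas on threshold roots.
\<close>

definition active_gap ::
    "real \<Rightarrow> real \<Rightarrow> real \<Rightarrow> real \<Rightarrow> 'm \<Rightarrow> (real \<Rightarrow> real) \<Rightarrow> 'm \<Rightarrow> 'm \<Rightarrow> 'm \<Rightarrow> real \<Rightarrow> real \<Rightarrow> bool" where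
  "active_gap \<theta> g0 p q m e b1 b2 a s p0 \<longleftrightarrow> a \<noteq> m \<and>
     (s = 1 \<and> p0 = p \<and> b1 = a \<and> b2 = m \<or> s = - 1 \<and> p0 = q \<and> b1 = m \<and> b2 = a) \<and>
     (\<forall>\<^sub>F g in at_right g0. 0 < s * (e g - p0)) \<and> (e \<longlongrightarrow> p0) (at_right g0) \<and>
     (H1 a m p0 \<noteq> 0 \<longrightarrow> 0 < s * H1 a m p0 \<and>
        (\<forall>\<^sub>F g in at_right g0. s * (e g - p0) \<le> 11 / 10 * (\<theta>\<^sup>2 / (s * H1 a m p0)) * (g - g0))) \<and>
     (H1 a m p0 = 0 \<longrightarrow> H2 a m p0 \<noteq> 0 \<longrightarrow> 0 < H2 a m p0 \<and>
        (\<forall>\<^sub>F g in at_right g0. s * (e g - p0) \<le> 11 / 10 * (sqrt 2 * \<bar>\<theta>\<bar> / sqrt (H2 a m p0)) * sqrt (g - g0)))"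

text \<open>
  An interval without insertion is also split, at its midpoint and with the same mode on
  both sides. In this way every interval contributes exactly one inner breakpoint, and the
  sequence of modes does not depend on \<open>g\<close>.
\<close>

lemma gap_breakpoint:
  assumes th: "\<theta> < 0" "g0 = - 1 / \<theta>" and pq: "0 \<le> p" "p < q" "q \<le> T"
    and S: "{p<..<q} \<inter> S = {}" and m: "\<And>t. t \<in> {p<..<q} \<Longrightarrow> c t = m"
    and noncrit: "\<And>b t. b \<noteq> m \<Longrightarrow> t \<in> {p<..<q} \<Longrightarrow> H1 b m t \<noteq> 0"
    and untied: "\<And>b b' t. b \<noteq> b' \<Longrightarrow> t \<in> {p<..<q} \<Longrightarrow> H b b' t \<noteq> 0"
    and lower: "\<And>b t. t \<in> {p<..<q} \<Longrightarrow> \<theta> \<le> H b m t"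
  shows "\<exists>e b1 b2. (\<forall>\<^sub>F g in at_right g0. splits p q m (e g) b1 b2 g) \<and>
      (b1 = m \<and> b2 = m \<and> (\<forall>g. e g = (p + q) / 2) \<or> (\<exists>a s p0. active_gap \<theta> g0 p q m e b1 b2 a s p0))"
proof -
  have sub: "{p..q} \<subseteq> {0..T}" using pq by auto
  have gpos: "\<forall>\<^sub>F g in at_right g0. 0 < g"
  proof -
    have "0 < g0" using th by (simp add: divide_neg_neg)
    moreover have "\<forall>\<^sub>F g in at_right g0. g0 < g" by (simp add: eventually_at_right_less)
    ultimately show ?thesis by (auto elim: eventually_mono)
  qed
  have dH: "(H b m has_real_derivative H1 b m t) (at t)" "(H1 b m has_real_derivative H2 b m t) (at t)"
    if "t \<in> {p<..<q}" for b t
  proof -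
    have t: "t \<in> {0<..<T} - S" using that pq S by auto
    show "(H b m has_real_derivative H1 b m t) (at t)" "(H1 b m has_real_derivative H2 b m t) (at t)"
      using H_has_derivative[OF t] H1_has_derivative[OF t] m[OF that] by auto
  qed
  have cont: "continuous_on {p..q} (H b m)" "continuous_on {p..q} (H1 b m)" "continuous_on {p..q} (H2 b m)" for b
    by (intro continuous_on_subset[OF H_continuous sub] continuous_on_subset[OF H1_continuous sub]
        continuous_on_subset[OF H2_continuous sub])+
  let ?H = "\<lambda>b. H b m"
  have "(\<forall>\<^sub>F g in at_right g0. \<forall>t\<in>{p<..<q}. \<forall>b. b \<noteq> m \<longrightarrow> - 1 / g < H b m t) \<or>
    (\<exists>a s p0 \<tau>. a \<noteq> m \<and> (s = 1 \<and> p0 = p \<or> s = - 1 \<and> p0 = q) \<and> H a m p0 = \<theta> \<and>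
      filterlim \<tau> (at_right 0) (at_right g0) \<and>
      (\<forall>\<^sub>F g in at_right g0. inserted_up_to ?H m p q a s p0 g (\<tau> g)))"
  proof (rule gap_insertion[where h = ?H and ?h1.0 = "\<lambda>b. H1 b m", OF th pq(2)])
    show "H b m t \<noteq> H b' m t" if "b \<noteq> b'" "t \<in> {p<..<q}" for b b' t
      using untied[OF that] unfolding H_def by (simp add: inner_diff_right)
  qed (use cont dH noncrit lower in auto)
  then show ?thesis
  proof
    assume ev: "\<forall>\<^sub>F g in at_right g0. \<forall>t\<in>{p<..<q}. \<forall>b. b \<noteq> m \<longrightarrow> - 1 / g < H b m t"
    have "\<forall>\<^sub>F g in at_right g0. splits p q m ((p + q) / 2) m m g"
      using ev gpos
    proof eventually_elim
      case (elim g)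
      then show ?case unfolding splits_def using wins_current pq by auto
    qed
    then show ?thesis by (intro exI[of _ "\<lambda>_. (p + q) / 2"] exI[of _ m]) auto
  next
    assume "\<exists>a s p0 \<tau>. a \<noteq> m \<and> (s = 1 \<and> p0 = p \<or> s = - 1 \<and> p0 = q) \<and> H a m p0 = \<theta> \<and>
      filterlim \<tau> (at_right 0) (at_right g0) \<and>
      (\<forall>\<^sub>F g in at_right g0. inserted_up_to ?H m p q a s p0 g (\<tau> g))"
    then obtain a s p0 \<tau> where a: "a \<noteq> m" and s: "s = 1 \<and> p0 = p \<or> s = - 1 \<and> p0 = q" and p0: "H a m p0 = \<theta>"
      and lim: "filterlim \<tau> (at_right 0) (at_right g0)"
      and ev: "\<forall>\<^sub>F g in at_right g0. inserted_up_to ?H m p q a s p0 g (\<tau> g)"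
      by blast
    note ins = inserted_up_to_def[of ?H m p q a s p0]
    define e where "e g = p0 + s * \<tau> g" for g
    define b1 where "b1 = (if s = 1 then a else m)"
    define b2 where "b2 = (if s = 1 then m else a)"
    have s2: "s * s = 1" "s * (s * y) = y" for y using s by auto
    have etau: "s * (e g - p0) = \<tau> g" for g by (simp add: e_def s2)
    have fin: "\<forall>\<^sub>F g in at_right g0. splits p q m (e g) b1 b2 g"
      using ev gpos
    proof eventually_elim
      case (elim g)
      note elim = elim[unfolded ins]
      have W1: "wins g m t a" if "t \<in> {p<..<q}" "s * (t - p0) < \<tau> g" for t
        by (rule wins_inserted[OF elim(2) a]) (use elim(1) that in auto)
      have W2: "wins g m t m" if "t \<in> {p<..<q}" "\<tau> g < s * (t - p0)" for t
        by (rule wins_current[OF elim(2)]) (use elim(1) that in auto)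
      have pe: "p < e g \<and> e g < q" using elim(1) s by (auto simp: e_def)
      show ?case
      proof (cases "s = 1")
        case True
        then show ?thesis using pe W1 W2 s unfolding splits_def b1_def b2_def e_def by auto
      next
        case False
        then have "s = - 1" "p0 = q" using s by auto
        then show ?thesis using pe W1 W2 unfolding splits_def b1_def b2_def e_def by auto
      qed
    qed
    have tau0: "(\<tau> \<longlongrightarrow> 0) (at_right g0)" using lim filterlim_at_right_to_0 by (simp add: filterlim_at)
    have elim_: "(e \<longlongrightarrow> p0) (at_right g0)"
    proof -
      have "((\<lambda>g. p0 + s * \<tau> g) \<longlongrightarrow> p0 + s * 0) (at_right g0)" by (intro tendsto_intros tau0)
      then show ?thesis by (simp add: e_def[abs_def])
    qed
    have w: "0 < q - p" using pq by simp
    have into: "p0 + s * t \<in> {p..q}" if "t \<in> {0..q - p}" for t using s that by auto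
    have into': "p0 + s * t \<in> {p<..<q}" if "t \<in> {0<..<q - p}" for t using s that by auto
    have c0: "continuous_on {0..q - p} (\<lambda>t. H a m (p0 + s * t))"
      and c1: "continuous_on {0..q - p} (\<lambda>t. s * H1 a m (p0 + s * t))"
      and c2: "continuous_on {0..q - p} (\<lambda>t. H2 a m (p0 + s * t))"
      using into by (intro continuous_intros continuous_on_compose2[OF cont(1)]
          continuous_on_compose2[OF cont(2)] continuous_on_compose2[OF cont(3)]; blast)+
    have d1: "((\<lambda>t. H a m (p0 + s * t)) has_real_derivative s * H1 a m (p0 + s * t)) (at t)"
      if t: "t \<in> {0<..<q - p}" for t
    proof -
      have "((\<lambda>t. H a m (p0 + s * t)) has_real_derivative H1 a m (p0 + s * t) * s) (at t)"
        by (rule DERIV_chain2[where f = "H a m" and g = "\<lambda>t. p0 + s * t"])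
          (use dH(1)[OF into'[OF t]] in \<open>auto intro!: derivative_eq_intros\<close>)
      then show ?thesis by (simp add: mult.commute)
    qed
    have d2: "((\<lambda>t. s * H1 a m (p0 + s * t)) has_real_derivative H2 a m (p0 + s * t)) (at t)"
      if t: "t \<in> {0<..<q - p}" for t
    proof -
      have "((\<lambda>t. H1 a m (p0 + s * t)) has_real_derivative H2 a m (p0 + s * t) * s) (at t)"
        by (rule DERIV_chain2[where f = "H1 a m" and g = "\<lambda>t. p0 + s * t"])
          (use dH(2)[OF into'[OF t]] in \<open>auto intro!: derivative_eq_intros\<close>)
      from DERIV_cmult[OF this, of s] show ?thesis using s2 by (simp add: mult_ac)
    qed
    have root: "\<forall>\<^sub>F g in at_right g0. H a m (p0 + s * \<tau> g) = - 1 / g"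
      using ev by eventually_elim (simp add: ins)
    have z: "H a m (p0 + s * 0) = \<theta>" using p0 by simp
    have r1: "0 < s * H1 a m p0 \<and> (\<forall>\<^sub>F g in at_right g0. \<tau> g \<le> 11 / 10 * (\<theta>\<^sup>2 / (s * H1 a m p0)) * (g - g0))"
      if nz: "H1 a m p0 \<noteq> 0"
    proof -
      have nz': "s * H1 a m (p0 + s * 0) \<noteq> 0" using nz s by auto
      show ?thesis
        using root_linear_rate[where h = "\<lambda>t. H a m (p0 + s * t)" and ?h1.0 = "\<lambda>t. s * H1 a m (p0 + s * t)",
            OF th w c0 c1 d1 z nz' lim root] by simp
    qed
    have r2: "0 < H2 a m p0 \<and> (\<forall>\<^sub>F g in at_right g0. \<tau> g \<le> 11 / 10 * (sqrt 2 * \<bar>\<theta>\<bar> / sqrt (H2 a m p0)) * sqrt (g - g0))"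
      if "H1 a m p0 = 0" and nz: "H2 a m p0 \<noteq> 0"
    proof -
      have z1: "s * H1 a m (p0 + s * 0) = 0" using that by simp
      have nz': "H2 a m (p0 + s * 0) \<noteq> 0" using nz by simp
      show ?thesis
        using root_square_root_rate[where h = "\<lambda>t. H a m (p0 + s * t)" and ?h1.0 = "\<lambda>t. s * H1 a m (p0 + s * t)"
            and ?h2.0 = "\<lambda>t. H2 a m (p0 + s * t)", OF th w c0 c1 c2 d1 d2 z z1 nz' lim root] by simp
    qed
    have epos: "\<forall>\<^sub>F g in at_right g0. 0 < \<tau> g" using ev by eventually_elim (simp add: ins)
    have "active_gap \<theta> g0 p q m e b1 b2 a s p0"
      unfolding active_gap_def etau b1_def b2_def using a s elim_ r1 r2 epos by auto
    then show ?thesis using fin by blast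
  qed
qed

end

section \<open>Types of switches and their rates\<close>

lemma iterated_deriv_eq:
  assumes U: "open U" and eq: "\<And>t. t \<in> U \<Longrightarrow> h t = g t"
    and g: "\<And>t. t \<in> U \<Longrightarrow> (g has_real_derivative g1 t) (at t)"
    and g1: "\<And>t. t \<in> U \<Longrightarrow> (g1 has_real_derivative g2 t) (at t)" and t: "t \<in> U"
  shows "(deriv ^^ 1) h t = g1 t" "(deriv ^^ 2) h t = g2 t"
proof -
  have d1: "deriv h t = g1 t" if "t \<in> U" for t
    by (rule DERIV_imp_deriv, rule DERIV_cong_ev[THEN iffD1, rotated 3, OF g[OF that]])
      (use eq that eventually_nhds_in_open[OF U that] in \<open>auto elim!: eventually_mono\<close>)
  have "deriv (deriv h) t = g2 t"
    by (rule DERIV_imp_deriv, rule DERIV_cong_ev[THEN iffD1, rotated 3, OF g1[OF t]])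
      (use d1 t eventually_nhds_in_open[OF U t] in \<open>auto elim!: eventually_mono\<close>)
  then show "(deriv ^^ 1) h t = g1 t" "(deriv ^^ 2) h t = g2 t"
    using d1[OF t] by (simp_all add: numeral_2_eq_2)
qed

context adjoint_trajectory
begin

text \<open>
  Near the limit the derivatives of \<open>h\<close> agree with continuous functions, so the limits that
  define the derivatives at the switch exist and are values of these functions.
\<close>

lemma deriv_at_active_switch:
  assumes gap: "0 \<le> p" "p < q" "q \<le> T" "{p<..<q} \<inter> S = {}" "\<And>t. t \<in> {p<..<q} \<Longrightarrow> c t = m"
    and e: "\<forall>\<^sub>F g in at_right g0. Ts g i \<in> {p<..<q}" "((\<lambda>g. Ts g i) \<longlongrightarrow> p0) (at_right g0)"
    and h: "\<And>t. t \<in> {p<..<q} \<Longrightarrow> h t = s * H a m t"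
  shows "deriv_at_switch g0 Ts 1 h i = s * H1 a m p0" "deriv_at_switch g0 Ts 2 h i = s * H2 a m p0"
proof -
  have der: "((\<lambda>t. s * H a m t) has_real_derivative s * H1 a m t) (at t)"
    "((\<lambda>t. s * H1 a m t) has_real_derivative s * H2 a m t) (at t)" if "t \<in> {p<..<q}" for t
  proof -
    have t: "t \<in> {0<..<T} - S" using that gap by auto
    show "((\<lambda>t. s * H a m t) has_real_derivative s * H1 a m t) (at t)"
      "((\<lambda>t. s * H1 a m t) has_real_derivative s * H2 a m t) (at t)"
      using DERIV_cmult[OF H_has_derivative[OF t, of a], of s] DERIV_cmult[OF H1_has_derivative[OF t, of a], of s]
        gap(5)[OF that] by auto
  qed
  note it = iterated_deriv_eq[of "{p<..<q}" h "\<lambda>t. s * H a m t" "\<lambda>t. s * H1 a m t" "\<lambda>t. s * H2 a m t",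
      OF open_greaterThanLessThan h der]
  have eT: "\<forall>\<^sub>F g in at_right g0. Ts g i \<in> {0..T}"
    using e(1) by eventually_elim (use gap in auto)
  have p0: "p0 \<in> {0..T}"
    by (rule Lim_in_closed_set[OF _ eT _ e(2)]) auto
  have lim: "((\<lambda>g. s * G (Ts g i)) \<longlongrightarrow> s * G p0) (at_right g0)" if "continuous_on {0..T} G" for G
    by (intro tendsto_intros continuous_on_tendsto_compose[OF that e(2) p0 eT])
  have "((\<lambda>g. (deriv ^^ 1) h (Ts g i)) \<longlongrightarrow> s * H1 a m p0) (at_right g0)"
    by (rule Lim_transform_eventually[OF lim[OF H1_continuous]])
      (use e(1) in \<open>eventually_elim, use it(1) in auto\<close>)
  then show "deriv_at_switch g0 Ts 1 h i = s * H1 a m p0"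
    unfolding deriv_at_switch_def by (rule tendsto_Lim[OF trivial_limit_at_right_real])
  have "((\<lambda>g. (deriv ^^ 2) h (Ts g i)) \<longlongrightarrow> s * H2 a m p0) (at_right g0)"
    by (rule Lim_transform_eventually[OF lim[OF H2_continuous]])
      (use e(1) in \<open>eventually_elim, use it(2) in auto\<close>)
  then show "deriv_at_switch g0 Ts 2 h i = s * H2 a m p0"
    unfolding deriv_at_switch_def by (rule tendsto_Lim[OF trivial_limit_at_right_real])
qed

end

text \<open>
  A switch of type one. Its term in the predicted cost is \<open>\<theta> \<kappa> (g - g0)\<close>, and \<open>\<kappa> (g - g0)\<close> bounds
  the distance that it has moved, up to a factor 11/10.
\<close>

definition linear_switch where
  "linear_switch \<theta> g0 d sg Ts i \<longleftrightarrow> switch_type g0 d sg Ts i = 1 \<and>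
     (\<exists>\<kappa>>0. (- 1) ^ switch_side g0 Ts i *
          (\<theta> ^ 3 / deriv_at_switch g0 Ts 1 (\<lambda>t. d t $ sg (i + switch_side g0 Ts i)) i) = \<theta> * \<kappa> \<and>
        (\<forall>\<^sub>F g in at_right g0. \<bar>Ts g i - switch_limit g0 Ts i\<bar> \<le> 11 / 10 * \<kappa> * (g - g0)))"

text \<open>
  The analogue for a switch of type two, which moves with the square root of \<open>g - g0\<close>.
\<close>

definition root_switch where
  "root_switch \<theta> g0 d sg Ts i \<longleftrightarrow> switch_type g0 d sg Ts i = 2 \<and>
     (\<exists>\<kappa>>0. sqrt 2 * \<theta> ^ 2 /
          sqrt (deriv_at_switch g0 Ts 2 (\<lambda>t. d t $ sg (i + switch_side g0 Ts i)) i) = - \<theta> * \<kappa> \<and>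
        (\<forall>\<^sub>F g in at_right g0. \<bar>Ts g i - switch_limit g0 Ts i\<bar> \<le> 11 / 10 * \<kappa> * sqrt (g - g0)))"

definition fixed_switch where
  "fixed_switch g0 d sg Ts i \<longleftrightarrow> switch_type g0 d sg Ts i = 0 \<and>
     (\<forall>\<^sub>F g in at_right g0. Ts g i = switch_limit g0 Ts i)"

text \<open>
  The last alternative is excluded once the maximal type is at most two.
\<close>

definition tracked_switch where
  "tracked_switch \<theta> g0 d sg Ts i \<longleftrightarrow> fixed_switch g0 d sg Ts i \<or> linear_switch \<theta> g0 d sg Ts i \<or>
     root_switch \<theta> g0 d sg Ts i \<or> 2 < switch_type g0 d sg Ts i"

lemma fixed_switchI:
  assumes ev: "\<forall>\<^sub>F g in at_right g0. Ts g i = y"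
  shows "fixed_switch g0 d sg Ts i" "switch_limit g0 Ts i = y"
proof -
  have "((\<lambda>g. Ts g i) \<longlongrightarrow> y) (at_right g0)"
    by (rule tendsto_eventually[OF ev])
  then show lim: "switch_limit g0 Ts i = y"
    unfolding switch_limit_def by (rule tendsto_Lim[OF trivial_limit_at_right_real])
  show "fixed_switch g0 d sg Ts i"
    unfolding fixed_switch_def lim using ev by (auto simp: switch_type_def)
qed

context adjoint_trajectory
begin

text \<open>
  The sign \<open>s\<close> records on which side of its limit the switch lies, and this is what the switch
  side expresses. In both cases the mode selected by the side is the inserted one. The switch
  moves, so its type is positive, and it is decided by the first and second derivative of \<open>H a m\<close>
  at the limit.
\<close>

lemma active_switch:
  fixes d :: "real \<Rightarrow> real^'m"
  assumes th: "\<theta> < 0" and gap: "0 \<le> p" "p < q" "q \<le> T" "{p<..<q} \<inter> S = {}" "\<And>t. t \<in> {p<..<q} \<Longrightarrow> c t = m"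
    and act: "active_gap \<theta> g0 p q m e b1 b2 a s p0"
    and e: "\<forall>\<^sub>F g in at_right g0. e g \<in> {p<..<q}"
    and Ts: "\<forall>\<^sub>F g in at_right g0. Ts g i = e g" and sg: "sg i = b1" "sg (i + 1) = b2"
    and d: "\<And>t b. t \<in> {p<..<q} \<Longrightarrow> d t $ b = H b m t"
  shows "switch_limit g0 Ts i = p0"
    "linear_switch \<theta> g0 d sg Ts i \<or> root_switch \<theta> g0 d sg Ts i \<or> 2 < switch_type g0 d sg Ts i"
proof -
  have am: "a \<noteq> m"
    and s: "s = 1 \<and> p0 = p \<and> b1 = a \<and> b2 = m \<or> s = - 1 \<and> p0 = q \<and> b1 = m \<and> b2 = a"
    and epos: "\<forall>\<^sub>F g in at_right g0. 0 < s * (e g - p0)" and elim_: "(e \<longlongrightarrow> p0) (at_right g0)"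
    and rate1: "H1 a m p0 \<noteq> 0 \<Longrightarrow> 0 < s * H1 a m p0 \<and>
        (\<forall>\<^sub>F g in at_right g0. s * (e g - p0) \<le> 11 / 10 * (\<theta>\<^sup>2 / (s * H1 a m p0)) * (g - g0))"
    and rate2: "H1 a m p0 = 0 \<Longrightarrow> H2 a m p0 \<noteq> 0 \<Longrightarrow> 0 < H2 a m p0 \<and>
        (\<forall>\<^sub>F g in at_right g0. s * (e g - p0) \<le> 11 / 10 * (sqrt 2 * \<bar>\<theta>\<bar> / sqrt (H2 a m p0)) * sqrt (g - g0))"
    using act unfolding active_gap_def by blast+
  have lim: "((\<lambda>g. Ts g i) \<longlongrightarrow> p0) (at_right g0)"
    by (rule Lim_transform_eventually[OF elim_]) (use Ts in \<open>eventually_elim, simp\<close>)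
  show limit: "switch_limit g0 Ts i = p0"
    unfolding switch_limit_def by (rule tendsto_Lim[OF trivial_limit_at_right_real lim])
  have Tsg: "\<forall>\<^sub>F g in at_right g0. Ts g i \<in> {p<..<q}"
    using e Ts by eventually_elim simp
  have Tspos: "\<forall>\<^sub>F g in at_right g0. 0 < s * (Ts g i - p0)"
    using epos Ts by eventually_elim simp
  have side: "switch_side g0 Ts i = (if s = 1 then 0 else 1)"
  proof (cases "s = 1")
    case True
    then have "\<forall>\<^sub>F g in at_right g0. Ts g i > p0" using Tspos by simp
    then show ?thesis unfolding switch_side_def limit using True by simp
  next
    case False
    then have "s = - 1" using s by auto
    have "\<not> (\<forall>\<^sub>F g in at_right g0. Ts g i > p0)"
    proof
      assume "\<forall>\<^sub>F g in at_right g0. Ts g i > p0"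
      then have "\<forall>\<^sub>F g in at_right g0. False"
        using Tspos by eventually_elim (simp add: \<open>s = - 1\<close>)
      then show False by simp
    qed
    then show ?thesis unfolding switch_side_def limit using False by simp
  qed
  have mode: "sg (i + switch_side g0 Ts i) = a" and sgn: "(- 1) ^ switch_side g0 Ts i = s"
    using s sg unfolding side by auto
  have s2: "s * s = 1" using s by auto
  have da: "d t $ sg (i + switch_side g0 Ts i) = 1 * H a m t" if "t \<in> {p<..<q}" for t
    unfolding mode using d[OF that] by simp
  have dd: "d t $ sg i - d t $ sg (i + 1) = s * H a m t" if "t \<in> {p<..<q}" for t
    using s d[OF that] sg by auto
  have D: "deriv_at_switch g0 Ts 1 (\<lambda>t. d t $ sg (i + switch_side g0 Ts i)) i = H1 a m p0"
    "deriv_at_switch g0 Ts 2 (\<lambda>t. d t $ sg (i + switch_side g0 Ts i)) i = H2 a m p0"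
    using deriv_at_active_switch[where h = "\<lambda>t. d t $ sg (i + switch_side g0 Ts i)" and s = 1
        and Ts = Ts and i = i, OF gap Tsg lim da] by (simp_all only: mult_1)
  note DD = deriv_at_active_switch[where h = "\<lambda>t. d t $ sg i - d t $ sg (i + 1)" and Ts = Ts and i = i,
      OF gap Tsg lim dd]
  have abs_eq: "\<forall>\<^sub>F g in at_right g0. \<bar>Ts g i - p0\<bar> = s * (e g - p0)"
    using Tspos Ts by eventually_elim (use s in auto)
  have nconst: "\<not> (\<exists>y. \<forall>\<^sub>F g in at_right g0. Ts g i = y)"
  proof
    assume "\<exists>y. \<forall>\<^sub>F g in at_right g0. Ts g i = y"
    then obtain y where y: "\<forall>\<^sub>F g in at_right g0. Ts g i = y" by blast
    then have "y = p0" using fixed_switchI(2)[where Ts = Ts and i = i, OF y] limit by simp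
    have "\<forall>\<^sub>F g in at_right g0. False"
      using y Tspos by eventually_elim (simp add: \<open>y = p0\<close>)
    then show False by simp
  qed
  define A where "A = {enat k | k. 1 \<le> k \<and> deriv_at_switch g0 Ts k (\<lambda>t. d t $ sg i - d t $ sg (i + 1)) i \<noteq> 0}"
  have A_E: "\<exists>k. y = enat k \<and> 1 \<le> k \<and> deriv_at_switch g0 Ts k (\<lambda>t. d t $ sg i - d t $ sg (i + 1)) i \<noteq> 0"
    if "y \<in> A" for y
    using that unfolding A_def by (rule CollectD)
  have type: "switch_type g0 d sg Ts i = Inf A"
    unfolding switch_type_def A_def using nconst by simp
  show "linear_switch \<theta> g0 d sg Ts i \<or> root_switch \<theta> g0 d sg Ts i \<or> 2 < switch_type g0 d sg Ts i"
  proof (cases "H1 a m p0 = 0")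
    case False
    have "enat 1 \<in> A" unfolding A_def using DD(1) False s by auto
    moreover have "enat 1 \<le> y" if "y \<in> A" for y using that unfolding A_def by auto
    ultimately have "Inf A = enat 1" by (intro antisym Inf_lower Inf_greatest)
    then have t1: "switch_type g0 d sg Ts i = 1" using type by (simp add: one_enat_def)
    define \<kappa> where "\<kappa> = \<theta>\<^sup>2 / (s * H1 a m p0)"
    have k: "0 < \<kappa>" using rate1[OF False] th by (simp add: \<kappa>_def)
    have "s * (\<theta> ^ 3 / H1 a m p0) = \<theta> * \<kappa>"
      using s False unfolding \<kappa>_def by (auto simp: power2_eq_square power3_eq_cube)
    moreover have "\<forall>\<^sub>F g in at_right g0. \<bar>Ts g i - p0\<bar> \<le> 11 / 10 * \<kappa> * (g - g0)"
      using conjunct2[OF rate1[OF False]] abs_eq unfolding \<kappa>_def by eventually_elim simp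
    ultimately have "linear_switch \<theta> g0 d sg Ts i"
      unfolding linear_switch_def sgn limit D using t1 k by (intro conjI exI[of _ \<kappa>])
    then show ?thesis ..
  next
    case H1: True
    have ge2: "enat 2 \<le> y" if y: "y \<in> A" for y
    proof -
      obtain k where k: "y = enat k" "1 \<le> k" "deriv_at_switch g0 Ts k (\<lambda>t. d t $ sg i - d t $ sg (i + 1)) i \<noteq> 0"
        using A_E[OF y] by (elim exE conjE)
      have "k \<noteq> 1" using k(3) DD(1) H1 by auto
      then show ?thesis using k by simp
    qed
    show ?thesis
    proof (cases "H2 a m p0 = 0")
      case False
      have "enat 2 \<in> A" unfolding A_def using DD(2) False s by auto
      then have "Inf A = enat 2" using ge2 by (intro antisym Inf_lower Inf_greatest)
      then have t2: "switch_type g0 d sg Ts i = 2" using type by (simp add: numeral_eq_enat)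
      define \<kappa> where "\<kappa> = sqrt 2 * \<bar>\<theta>\<bar> / sqrt (H2 a m p0)"
      have k: "0 < \<kappa>" using rate2[OF H1 False] th unfolding \<kappa>_def
        by (intro divide_pos_pos mult_pos_pos) auto
      have "sqrt 2 * \<theta> ^ 2 / sqrt (H2 a m p0) = - \<theta> * \<kappa>"
        using th unfolding \<kappa>_def by (simp add: power2_eq_square)
      moreover have "\<forall>\<^sub>F g in at_right g0. \<bar>Ts g i - p0\<bar> \<le> 11 / 10 * \<kappa> * sqrt (g - g0)"
        using conjunct2[OF rate2[OF H1 False]] abs_eq unfolding \<kappa>_def by eventually_elim simp
      ultimately have "root_switch \<theta> g0 d sg Ts i"
        unfolding root_switch_def limit D using t2 k by (intro conjI exI[of _ \<kappa>])
      then show ?thesis by blast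
    next
      case H2: True
      have "enat 3 \<le> y" if y: "y \<in> A" for y
      proof -
        obtain k where k: "y = enat k" "1 \<le> k" "deriv_at_switch g0 Ts k (\<lambda>t. d t $ sg i - d t $ sg (i + 1)) i \<noteq> 0"
          using A_E[OF y] by (elim exE conjE)
        have "k \<noteq> 1" "k \<noteq> 2" using k(3) DD H1 H2 by auto
        then show ?thesis using k by simp
      qed
      then have "enat 3 \<le> Inf A" by (rule Inf_greatest)
      moreover have "(2::enat) < enat 3" by (simp add: numeral_eq_enat)
      ultimately have "2 < switch_type g0 d sg Ts i" unfolding type by (rule order_less_le_trans[rotated])
      then show ?thesis by blast
    qed
  qed
qed

end

text \<open>
  For maximal type one all moving switches enter the predicted cost. For maximal type two those
  of type one are left out, but their distance from the limit is of order \<open>g - g0\<close>, which is negligible against the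
  square root contributed by at least one switch of type two. The factor grows from 11/10 to 6/5 to
  absorb them. If there is no switch at all, both sides are zero.
\<close>

lemma predicted_decrease_dominates:
  fixes d :: "real \<Rightarrow> real^'m::finite"
  assumes th: "\<theta> < 0"
    and sw: "\<And>i. i \<in> {1..<M} \<Longrightarrow> tracked_switch \<theta> g0 d sg Ts i"
    and mbar: "mbar = max_switch_type g0 d M sg Ts" "mbar = 1 \<or> mbar = 2"
  shows "\<forall>\<^sub>F g in at_right g0. - \<theta> * (\<Sum>i\<in>{1..<M}. \<bar>Ts g i - switch_limit g0 Ts i\<bar>)
      \<le> 6 / 5 * (J0 - J_hat mbar J0 \<theta> g0 d M sg Ts g)"
proof -
  define ty where "ty i = switch_type g0 d sg Ts i" for i
  define \<delta> where "\<delta> i g = \<bar>Ts g i - switch_limit g0 Ts i\<bar>" for i g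
  define c1 where "c1 i = (- 1) ^ switch_side g0 Ts i *
          (\<theta> ^ 3 / deriv_at_switch g0 Ts 1 (\<lambda>t. d t $ sg (i + switch_side g0 Ts i)) i)" for i
  define c2 where "c2 i = sqrt 2 * \<theta> ^ 2 /
          sqrt (deriv_at_switch g0 Ts 2 (\<lambda>t. d t $ sg (i + switch_side g0 Ts i)) i)" for i
  note gr = eventually_at_right_less[of g0]
  have range: "{1..M - 1} = {1..<M}" by auto
  have le_mbar: "ty i \<le> mbar" if "i \<in> {1..<M}" for i
    unfolding mbar(1) max_switch_type_def range ty_def using that by (intro Max_ge) auto
  then have le2: "ty i \<le> 2" if "i \<in> {1..<M}" for i
    using that mbar(2) order_trans[of "ty i" 1 2] by fastforce
  define I where "I j = switches_of_type g0 d M sg Ts j" for j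
  have I: "I j = {i\<in>{1..<M}. ty i = j}" for j
    unfolding I_def switches_of_type_def range ty_def ..
  have tys: "ty i = 0 \<and> fixed_switch g0 d sg Ts i \<or> ty i = 1 \<and> linear_switch \<theta> g0 d sg Ts i \<or>
      ty i = 2 \<and> root_switch \<theta> g0 d sg Ts i" if "i \<in> {1..<M}" for i
    using sw[OF that] le2[OF that] unfolding ty_def tracked_switch_def
    by (auto simp: fixed_switch_def linear_switch_def root_switch_def)
  have b0: "\<forall>\<^sub>F g in at_right g0. \<forall>i\<in>I 0. \<delta> i g = 0"
  proof (intro eventually_ball_finite ballI)
    fix i assume "i \<in> I 0"
    then have "fixed_switch g0 d sg Ts i" using tys[of i] unfolding I by auto
    then show "\<forall>\<^sub>F g in at_right g0. \<delta> i g = 0"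
      unfolding fixed_switch_def \<delta>_def by (auto elim: eventually_mono)
  qed (simp add: I)
  have b1: "c1 i < 0" "\<forall>\<^sub>F g in at_right g0. - \<theta> * \<delta> i g \<le> 11 / 10 * (- c1 i) * (g - g0)" if "i \<in> I 1" for i
  proof -
    have "linear_switch \<theta> g0 d sg Ts i" using tys[of i] that unfolding I by auto
    then obtain \<kappa> where k: "0 < \<kappa>" "c1 i = \<theta> * \<kappa>" "\<forall>\<^sub>F g in at_right g0. \<delta> i g \<le> 11 / 10 * \<kappa> * (g - g0)"
      unfolding linear_switch_def c1_def \<delta>_def by blast
    show "c1 i < 0" unfolding k(2) using th k(1) by (rule mult_neg_pos)
    show "\<forall>\<^sub>F g in at_right g0. - \<theta> * \<delta> i g \<le> 11 / 10 * (- c1 i) * (g - g0)"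
      using k(3)
    proof eventually_elim
      case (elim g)
      have "- \<theta> * \<delta> i g \<le> - \<theta> * (11 / 10 * \<kappa> * (g - g0))" using elim th by (intro mult_left_mono) auto
      then show ?case unfolding k(2) by (simp add: algebra_simps)
    qed
  qed
  have b2: "0 < c2 i" "\<forall>\<^sub>F g in at_right g0. - \<theta> * \<delta> i g \<le> 11 / 10 * c2 i * sqrt (g - g0)" if "i \<in> I 2" for i
  proof -
    have "root_switch \<theta> g0 d sg Ts i" using tys[of i] that unfolding I by auto
    then obtain \<kappa> where k: "0 < \<kappa>" "c2 i = - \<theta> * \<kappa>" "\<forall>\<^sub>F g in at_right g0. \<delta> i g \<le> 11 / 10 * \<kappa> * sqrt (g - g0)"
      unfolding root_switch_def c2_def \<delta>_def by blast
    show "0 < c2 i" unfolding k(2) using k(1) th by (intro mult_pos_pos) auto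
    show "\<forall>\<^sub>F g in at_right g0. - \<theta> * \<delta> i g \<le> 11 / 10 * c2 i * sqrt (g - g0)"
      using k(3)
    proof eventually_elim
      case (elim g)
      have "- \<theta> * \<delta> i g \<le> - \<theta> * (11 / 10 * \<kappa> * sqrt (g - g0))" using elim th by (intro mult_left_mono) auto
      then show ?case unfolding k(2) by (simp add: algebra_simps)
    qed
  qed
  have finI: "finite (I j)" for j by (simp add: I)
  define C1 where "C1 = (\<Sum>i\<in>I 1. - c1 i)"
  define C2 where "C2 = (\<Sum>i\<in>I 2. c2 i)"
  have C10: "0 \<le> C1" unfolding C1_def using b1(1) by (intro sum_nonneg) (auto simp: less_imp_le)
  have split: "(\<Sum>i\<in>{1..<M}. \<delta> i g) = (\<Sum>i\<in>I 0. \<delta> i g) + (\<Sum>i\<in>I 1. \<delta> i g) + (\<Sum>i\<in>I 2. \<delta> i g)" for g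
  proof -
    have "{1..<M} = (I 0 \<union> I 1) \<union> I 2" using tys unfolding I by blast
    moreover have "I 0 \<inter> I 1 = {}" "(I 0 \<union> I 1) \<inter> I 2 = {}" unfolding I by auto
    ultimately show ?thesis using finI by (simp add: sum.union_disjoint)
  qed
  have bound: "\<forall>\<^sub>F g in at_right g0.
      - \<theta> * (\<Sum>i\<in>{1..<M}. \<delta> i g) \<le> 11 / 10 * C1 * (g - g0) + 11 / 10 * C2 * sqrt (g - g0)"
  proof -
    have e1: "\<forall>\<^sub>F g in at_right g0. \<forall>i\<in>I 1. - \<theta> * \<delta> i g \<le> 11 / 10 * (- c1 i) * (g - g0)"
      using b1(2) finI by (intro eventually_ball_finite) auto
    have e2: "\<forall>\<^sub>F g in at_right g0. \<forall>i\<in>I 2. - \<theta> * \<delta> i g \<le> 11 / 10 * c2 i * sqrt (g - g0)"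
      using b2(2) finI by (intro eventually_ball_finite) auto
    show ?thesis
      using b0 e1 e2
    proof eventually_elim
      case (elim g)
      have "(\<Sum>i\<in>I 1. - \<theta> * \<delta> i g) \<le> (\<Sum>i\<in>I 1. 11 / 10 * (- c1 i) * (g - g0))"
        by (rule sum_mono) (use elim in auto)
      also have "\<dots> = 11 / 10 * C1 * (g - g0)"
        unfolding C1_def sum_distrib_left sum_distrib_right ..
      finally have s1: "- \<theta> * (\<Sum>i\<in>I 1. \<delta> i g) \<le> 11 / 10 * C1 * (g - g0)"
        by (simp only: sum_distrib_left)
      have "(\<Sum>i\<in>I 2. - \<theta> * \<delta> i g) \<le> (\<Sum>i\<in>I 2. 11 / 10 * c2 i * sqrt (g - g0))"
        by (rule sum_mono) (use elim in auto)
      also have "\<dots> = 11 / 10 * C2 * sqrt (g - g0)"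
        unfolding C2_def sum_distrib_left sum_distrib_right ..
      finally have s2: "- \<theta> * (\<Sum>i\<in>I 2. \<delta> i g) \<le> 11 / 10 * C2 * sqrt (g - g0)"
        by (simp only: sum_distrib_left)
      have s0: "(\<Sum>i\<in>I 0. \<delta> i g) = 0" using elim by simp
      show ?case unfolding split s0 using s1 s2 by (simp only: distrib_left add_0_left)
    qed
  qed
  consider "mbar = 1" | "mbar = 2" using mbar(2) by blast
  then show ?thesis
  proof cases
    case 1
    have "I 2 = {}" using le_mbar 1 unfolding I by fastforce
    then have C2: "C2 = 0" by (simp add: C2_def)
    have A: "J0 - J_hat mbar J0 \<theta> g0 d M sg Ts g = C1 * (g - g0)" for g
      unfolding J_hat_def J_hat1_def C1_def I_def[symmetric] c1_def[symmetric] using 1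
      by (simp add: sum_negf sum_distrib_right)
    show ?thesis
      unfolding \<delta>_def[symmetric] A
      using bound gr
    proof eventually_elim
      case (elim g)
      have "0 \<le> C1 * (g - g0)" using C10 elim by simp
      then show ?case using elim(1) C2 by simp
    qed
  next
    case 2
    have A: "J0 - J_hat mbar J0 \<theta> g0 d M sg Ts g = C2 * sqrt (g - g0)" for g
      unfolding J_hat_def J_hat2_def C2_def I_def[symmetric] c2_def[symmetric] using 2
      by (simp add: sum_distrib_right)
    show ?thesis
    proof (cases "{1..<M} = {}")
      case True
      then have "C2 = 0" by (simp add: C2_def I)
      then show ?thesis unfolding A using True by simp
    next
      case False
      have "mbar \<in> switch_type g0 d sg Ts ` {1..<M}"
        unfolding mbar(1) max_switch_type_def range using False by (intro Max_in) auto
      then have "I 2 \<noteq> {}" using 2 unfolding I ty_def by auto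
      then have C2: "0 < C2" unfolding C2_def using b2(1) finI by (intro sum_pos) auto
      have "((\<lambda>g. 11 * C1 * sqrt (g - g0)) \<longlongrightarrow> 11 * C1 * sqrt (g0 - g0)) (at_right g0)"
        by (intro tendsto_intros)
      then have "\<forall>\<^sub>F g in at_right g0. 11 * C1 * sqrt (g - g0) < C2"
        by (rule order_tendstoD(2)) (use C2 in simp)
      then show ?thesis
        unfolding \<delta>_def[symmetric] A
        using bound gr
      proof eventually_elim
        case (elim g)
        define r where "r = sqrt (g - g0)"
        have r: "0 < r" "g - g0 = r * r" using elim by (auto simp: r_def)
        have "11 * C1 * r * r \<le> C2 * r"
          using elim(1) r unfolding r_def[symmetric] by (intro mult_right_mono) auto
        then have "11 * (C1 * (g - g0)) \<le> C2 * r" unfolding r(2) by (simp add: mult_ac)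
        moreover have "- \<theta> * (\<Sum>i\<in>{1..<M}. \<delta> i g) \<le> 11 / 10 * (C1 * (g - g0)) + 11 / 10 * (C2 * r)"
          using elim(2) unfolding r_def by (simp only: mult.assoc)
        ultimately show ?case unfolding r_def[symmetric] by linarith
      qed
    qed
  qed
qed

section \<open>The projected control and its cost\<close>

text \<open>
  The product defining the component of any other mode contains the comparison with \<open>a\<close>,
  which fails.
\<close>

lemma mode_selector_winner:
  fixes mu :: "real \<Rightarrow> real^'m::finite"
  assumes "\<And>b. b \<noteq> a \<Longrightarrow> mu t $ b < mu t $ a"
  shows "mode_selector mu t = axis a 1"
proof -
  have "(\<Prod>j\<in>UNIV - {i}. unit_step (mu t $ i - mu t $ j)) = (if i = a then 1 else 0)" for i
  proof (cases "i = a")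
    case True
    have "(\<Prod>j\<in>UNIV - {a}. unit_step (mu t $ a - mu t $ j)) = 1"
      by (rule prod.neutral) (use assms in \<open>auto simp: unit_step_def less_imp_le\<close>)
    then show ?thesis using True by simp
  next
    case False
    have "unit_step (mu t $ i - mu t $ a) = 0" using assms[OF False] by (simp add: unit_step_def)
    then show ?thesis using False by (auto intro!: bexI[of _ a])
  qed
  then show ?thesis unfolding mode_selector_def axis_def by simp
qed

lemma mode_selector_maximal:
  fixes mu :: "real \<Rightarrow> real^'m::finite"
  assumes "mode_selector mu t = axis a 1"
  shows "mu t $ b \<le> mu t $ a"
proof (cases "b = a")
  case False
  have "(\<Prod>j\<in>UNIV - {a}. unit_step (mu t $ a - mu t $ j)) = axis a 1 $ a"
    unfolding assms[symmetric] mode_selector_def by simp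
  then have "(\<Prod>j\<in>UNIV - {a}. unit_step (mu t $ a - mu t $ j)) \<noteq> 0" by (simp add: axis_def)
  then have "unit_step (mu t $ a - mu t $ b) \<noteq> 0" using False by auto
  then show ?thesis by (auto simp: unit_step_def split: if_splits)
qed simp

lemma F_axis: "F f y (axis a 1) = f a y"
proof -
  have "F f y (axis a 1) = (\<Sum>i\<in>UNIV. if i = a then f i y else 0)"
    unfolding F_def by (rule sum.cong) (auto simp: axis_def)
  then show ?thesis by simp
qed

lemma solves_state_eq_mode_function:
  assumes "negligible N" "\<And>t. t \<in> {0..T} - N \<Longrightarrow> v t = axis (c t) 1"
  shows "solves_state_eq T x0 f v y \<longleftrightarrow>
    (\<forall>t\<in>{0..T}. ((\<lambda>s. f (c s) (y s)) has_integral (y t - x0)) {0..t})"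
  unfolding solves_state_eq_def
proof (rule ball_cong[OF refl])
  fix t assume t: "t \<in> {0..T}"
  show "((\<lambda>s. F f (y s) (v s)) has_integral (y t - x0)) {0..t} \<longleftrightarrow>
      ((\<lambda>s. f (c s) (y s)) has_integral (y t - x0)) {0..t}"
    by (rule has_integral_spike_eq[OF assms(1)]) (use t assms(2) in \<open>auto simp: F_axis\<close>)
qed

lemma integral_le_off_negligible:
  fixes g h :: "real \<Rightarrow> real"
  assumes "g integrable_on A" "h integrable_on A" "negligible N" "\<And>t. t \<in> A - N \<Longrightarrow> g t \<le> h t"
  shows "integral A g \<le> integral A h"
proof -
  define g' where "g' t = (if t \<in> N then h t else g t)" for t
  have "integral A g' = integral A g"
    by (rule integral_spike[OF assms(3)]) (auto simp: g'_def)
  moreover have "g' integrable_on A"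
    by (rule integrable_spike[OF assms(1,3)]) (auto simp: g'_def)
  then have "integral A g' \<le> integral A h"
    by (rule integral_le[OF _ assms(2)]) (use assms(4) in \<open>auto simp: g'_def\<close>)
  ultimately show ?thesis by simp
qed

text \<open>
  A nonempty open set is not negligible.
\<close>

lemma continuous_eq_off_negligible:
  fixes g h :: "real \<Rightarrow> real"
  assumes U: "open U" and g: "continuous_on U g" and h: "continuous_on U h"
    and N: "negligible N" "\<And>t. t \<in> U - N \<Longrightarrow> g t = h t" and t: "t \<in> U"
  shows "g t = h t"
proof (rule ccontr)
  assume "g t \<noteq> h t"
  let ?D = "{t\<in>U. g t - h t \<in> - {0}}"
  have "open ?D"
  proof -
    have "continuous_on U (\<lambda>t. g t - h t)" by (intro continuous_intros g h)
    then have "open ((\<lambda>t. g t - h t) -` (- {0}) \<inter> U)"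
      using continuous_on_open_vimage[OF U] by blast
    moreover have "(\<lambda>t. g t - h t) -` (- {0}) \<inter> U = ?D" by auto
    ultimately show ?thesis by simp
  qed
  moreover have "?D \<noteq> {}" using t \<open>g t \<noteq> h t\<close> by auto
  moreover have "?D \<subseteq> N" using N(2) by auto
  ultimately show False using N(1) negligible_subset open_not_negligible by metis
qed

text \<open>
  Off a null set the indicator of the mismatch is at most the sum of the indicators of the intervals.
\<close>

lemma mismatch_integral_le:
  fixes c c' :: "real \<Rightarrow> 'm::finite" and y z :: "'i \<Rightarrow> real"
  assumes c: "piecewise_constant 0 T c" "piecewise_constant 0 T c'" and I: "finite I" and N: "negligible N"
    and cover: "\<And>t. t \<in> {0..T} - N \<Longrightarrow> c t \<noteq> c' t \<Longrightarrow> \<exists>i\<in>I. t \<in> {min (y i) (z i)..max (y i) (z i)}"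
  shows "integral {0..T} (mismatch c c') \<le> (\<Sum>i\<in>I. \<bar>z i - y i\<bar>)"
proof -
  define A where "A i = {min (y i) (z i)..max (y i) (z i)}" for i
  have meas: "A i \<inter> {0..T} \<in> lmeasurable" for i unfolding A_def by simp
  have int: "(indicator (A i) :: real \<Rightarrow> real) integrable_on {0..T}" for i
    using meas[of i] integrable_on_indicator by blast
  have "integral {0..T} (mismatch c c') \<le> integral {0..T} (\<lambda>t. \<Sum>i\<in>I. indicator (A i) t)"
  proof (rule integral_le_off_negligible[OF integrable_mismatch[OF c] integrable_sum[OF I int] N])
    fix t assume t: "t \<in> {0..T} - N"
    have nn: "0 \<le> (\<Sum>i\<in>I. indicator (A i) t :: real)" by (intro sum_nonneg) auto
    show "mismatch c c' t \<le> (\<Sum>i\<in>I. indicator (A i) t)"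
    proof (cases "c t = c' t")
      case False
      then obtain i where i: "i \<in> I" "t \<in> A i" using cover[OF t] unfolding A_def by blast
      have "(indicator (A i) t :: real) \<le> (\<Sum>i\<in>I. indicator (A i) t)"
        by (rule member_le_sum[OF i(1)]) (use I in auto)
      then show ?thesis using i False by (simp add: mismatch_def)
    qed (use nn in \<open>simp add: mismatch_def\<close>)
  qed
  also have "\<dots> = (\<Sum>i\<in>I. integral {0..T} (indicator (A i)))"
    by (rule integral_sum[OF I int])
  also have "\<dots> \<le> (\<Sum>i\<in>I. \<bar>z i - y i\<bar>)"
  proof (rule sum_mono)
    fix i
    have "integral {0..T} (indicator (A i)) = measure lebesgue (A i \<inter> {0..T})"
      using integral_indicator[OF meas] .
    also have "\<dots> \<le> measure lebesgue (A i)"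
      by (rule measure_mono_fmeasurable) (use meas in \<open>auto simp: A_def\<close>)
    also have "\<dots> = \<bar>z i - y i\<bar>" unfolding A_def by (simp add: max_def min_def)
    finally show "integral {0..T} (indicator (A i)) \<le> \<bar>z i - y i\<bar>" .
  qed
  finally show ?thesis .
qed

text \<open>
  The projection picks an arbitrary solution. A solution exists when the controls differ for a
  short time only, and the expansion holds for whichever solution is picked.
\<close>

lemma projection_cost_expansion:
  fixes f :: "'m::finite \<Rightarrow> real^'n \<Rightarrow> real^'n" and \<alpha> :: "real \<Rightarrow> real^'n"
  assumes tr: "adjoint_trajectory T K KL f f' f'' l l' l'' c S x0 x \<rho>"
  shows "\<exists>C \<epsilon>0. 0 < \<epsilon>0 \<and> 0 \<le> C \<and> (\<forall>mu c' N. piecewise_constant 0 T c' \<longrightarrow> negligible N \<longrightarrow>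
       (\<forall>t\<in>{0..T} - N. mode_selector mu t = axis (c' t) 1) \<longrightarrow>
       integral {0..T} (mismatch c c') \<le> \<epsilon>0 \<longrightarrow>
       \<bar>cost T l (projection T x0 f \<alpha> mu) - integral {0..T} (\<lambda>t. l (x t))
         - integral {0..T} (\<lambda>t. \<rho> t \<bullet> (f (c' t) (x t) - f (c t) (x t)))\<bar>
       \<le> C * (integral {0..T} (mismatch c c'))\<^sup>2)"
proof -
  interpret adjoint_trajectory T K KL f f' f'' l l' l'' c S x0 x \<rho> by (rule tr)
  show ?thesis
  proof (rule cost_first_order_expansion)
  fix C \<epsilon>0 :: real
  assume C: "0 < \<epsilon>0" "0 \<le> C"
    and ex: "\<And>c'. piecewise_constant 0 T c' \<Longrightarrow> integral {0..T} (mismatch c c') \<le> \<epsilon>0 \<Longrightarrow>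
       \<exists>y. continuous_on {0..T} y \<and>
         (\<forall>t\<in>{0..T}. ((\<lambda>s. f (c' s) (y s)) has_integral (y t - x0)) {0..t})"
    and est: "\<And>c' y. piecewise_constant 0 T c' \<Longrightarrow> integral {0..T} (mismatch c c') \<le> \<epsilon>0 \<Longrightarrow>
       (\<And>t. t \<in> {0..T} \<Longrightarrow> ((\<lambda>s. f (c' s) (y s)) has_integral (y t - x0)) {0..t}) \<Longrightarrow>
       \<bar>integral {0..T} (\<lambda>t. l (y t)) - integral {0..T} (\<lambda>t. l (x t))
         - integral {0..T} (\<lambda>t. \<rho> t \<bullet> (f (c' t) (x t) - f (c t) (x t)))\<bar>
       \<le> C * (integral {0..T} (mismatch c c'))\<^sup>2"
  show ?thesis
  proof (rule exI[of _ C], rule exI[of _ \<epsilon>0], intro conjI C allI impI)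
    fix mu :: "real \<Rightarrow> real^'m" and c' N
    assume c': "piecewise_constant 0 T c'" and N: "negligible N"
      and mu: "\<forall>t\<in>{0..T} - N. mode_selector mu t = axis (c' t) 1"
      and small: "integral {0..T} (mismatch c c') \<le> \<epsilon>0"
    note eqv = solves_state_eq_mode_function[of N T "mode_selector mu" c', OF N mu[rule_format]]
    obtain y where y: "continuous_on {0..T} y" "solves_state_eq T x0 f (mode_selector mu) y"
      using ex[OF c' small] eqv by blast
    have "y \<in> L1_functions T"
      unfolding L1_functions_def using absolutely_integrable_continuous_real[OF y(1)] by simp
    then have "\<exists>y. y \<in> L1_functions T \<and> solves_state_eq T x0 f (mode_selector mu) y" using y by blast
    then have "solves_state_eq T x0 f (mode_selector mu) (fst (projection T x0 f \<alpha> mu))"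
      unfolding projection_def fst_conv by (rule someI2_ex) blast
    then have "\<And>t. t \<in> {0..T} \<Longrightarrow> ((\<lambda>s. f (c' s) (fst (projection T x0 f \<alpha> mu) s)) has_integral
        (fst (projection T x0 f \<alpha> mu) t - x0)) {0..t}"
      using eqv by blast
    from est[OF c' small this]
    show "\<bar>cost T l (projection T x0 f \<alpha> mu) - integral {0..T} (\<lambda>t. l (x t))
         - integral {0..T} (\<lambda>t. \<rho> t \<bullet> (f (c' t) (x t) - f (c t) (x t)))\<bar>
       \<le> C * (integral {0..T} (mismatch c c'))\<^sup>2"
      unfolding cost_def .
  qed
  qed
qed

context adjoint_trajectory
begin

text \<open>
  On such an interval the order of the components of the gradient never changes and each of them is
  monotone, as \<open>gap_insertion\<close> demands; \<open>S'\<close> is for the discontinuities of \<open>d\<close>.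
\<close>

definition regular_gap :: "real set \<Rightarrow> real \<Rightarrow> real \<Rightarrow> 'm \<Rightarrow> bool" where
  "regular_gap S' p q m \<longleftrightarrow> 0 \<le> p \<and> p < q \<and> q \<le> T \<and> {p<..<q} \<inter> (S \<union> S') = {} \<and>
     (\<forall>t\<in>{p<..<q}. c t = m \<and> (\<forall>b. b \<noteq> m \<longrightarrow> H1 b m t \<noteq> 0) \<and> (\<forall>a b. a \<noteq> b \<longrightarrow> H a b t \<noteq> 0))"

lemma regular_partition:
  assumes crit: "\<And>i j. i \<noteq> j \<Longrightarrow> finite (critical_points T (H i j))" and S': "finite S'"
  obtains n p m where "p 0 = 0" "p n = T" "\<forall>k<n. regular_gap S' (p k) (p (Suc k)) (m k)"
proof -
  \<comment> \<open>the points where some interval has to be cut\<close>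
  define P where "P = S \<union> S' \<union> (\<Union>(i, j)\<in>{(i, j). i \<noteq> j}. critical_points T (H i j) \<union> {t\<in>{0..T}. H i j t = 0})"
  have "finite P"
    unfolding P_def using finite_S S' crit finite_zeros[OF H_continuous crit] by auto
  then obtain n p where p: "p 0 = 0" "p n = T" "\<And>k. k < n \<Longrightarrow> p k < p (Suc k)"
    "\<And>k. k < n \<Longrightarrow> {p k<..<p (Suc k)} \<inter> P = {}"
    using partition_by_finite_set[of P 0 T] T_pos by blast
  have in0T: "0 \<le> p k \<and> p (Suc k) \<le> T" if "k < n" for k
  proof
    show "0 \<le> p k" using increasing_chain[of n p 0 k] p that by (cases "k = 0") auto
    show "p (Suc k) \<le> T" using increasing_chain[of n p "Suc k" n] p that by (cases "Suc k = n") auto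
  qed
  define m where "m k = c ((p k + p (Suc k)) / 2)" for k
  have cm: "c t = m k" if k: "k < n" and t: "t \<in> {p k<..<p (Suc k)}" for k t
    unfolding m_def
  proof (rule connected_local_const[of "{p k<..<p (Suc k)}"])
    show "(p k + p (Suc k)) / 2 \<in> {p k<..<p (Suc k)}" using p(3)[OF k] by simp
    show "\<forall>r\<in>{p k<..<p (Suc k)}. \<forall>\<^sub>F s in at r within {p k<..<p (Suc k)}. c r = c s"
    proof
      fix r assume r: "r \<in> {p k<..<p (Suc k)}"
      then have "r \<in> {0..T} - S" using p(4)[OF k] in0T[OF k] unfolding P_def by auto
      then have "\<forall>\<^sub>F s in nhds r. c s = c r" by (rule c_locally_constant)
      then show "\<forall>\<^sub>F s in at r within {p k<..<p (Suc k)}. c r = c s"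
        unfolding eventually_at_filter by eventually_elim simp
    qed
  qed (use t in auto)
  show thesis
  proof (rule that[OF p(1,2)], intro allI impI)
    fix k assume k: "k < n"
    have disj: "{p k<..<p (Suc k)} \<inter> (S \<union> S') = {}" using p(4)[OF k] unfolding P_def by blast
    have "c t = m k \<and> (\<forall>b. b \<noteq> m k \<longrightarrow> H1 b (m k) t \<noteq> 0) \<and> (\<forall>a b. a \<noteq> b \<longrightarrow> H a b t \<noteq> 0)"
      if t: "t \<in> {p k<..<p (Suc k)}" for t
    proof (intro conjI allI impI)
      show "c t = m k" by (rule cm[OF k t])
      fix a b :: 'm
    have tP: "t \<notin> P" and tT: "t \<in> {0<..<T}" using p(4)[OF k] t in0T[OF k] by auto
    show "H a b t \<noteq> 0" if "a \<noteq> b" using tP tT that unfolding P_def by auto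
    show "H1 b (m k) t \<noteq> 0" if "b \<noteq> m k"
    proof
      assume z: "H1 b (m k) t = 0"
      have "t \<in> {0<..<T} - S" using tP tT unfolding P_def by auto
      then have "(H b (m k) has_real_derivative 0) (at t within {0..T})"
        using H_has_derivative[of t b] cm[OF k t] z by (auto intro: has_field_derivative_at_within)
      then have "t \<in> critical_points T (H b (m k))" unfolding critical_points_def using tT by auto
      then show False using tP that unfolding P_def by blast
    qed
    qed
    then show "regular_gap S' (p k) (p (Suc k)) (m k)"
      unfolding regular_gap_def using disj in0T[OF k] p(3)[OF k] by blast
  qed
qed

end

text \<open>
  Here \<open>w\<close> is the first-order term of the cost change \<open>B\<close>, and \<open>\<nu>\<close> the time during which the
  controls differ.
\<close>

lemma cost_change_bounds:
  fixes \<theta> B w \<nu> C g :: real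
  assumes "\<theta> < 0" "0 \<le> \<nu>" "\<bar>B - w\<bar> \<le> C * \<nu>\<^sup>2" "\<theta> * \<nu> \<le> w" "w \<le> - 1 / g * \<nu>"
    and "- 1 / g < \<theta> / 2" "C * \<nu> \<le> - \<theta> / 10"
  shows "B \<le> 0" "11 / 10 * \<theta> * \<nu> \<le> B"
proof -
  have sq: "C * \<nu>\<^sup>2 \<le> - \<theta> / 10 * \<nu>"
    using mult_right_mono[OF assms(7,2)] by (simp add: power2_eq_square mult.assoc)
  have "- 1 / g * \<nu> \<le> \<theta> / 2 * \<nu>" using assms(2,6) by (intro mult_right_mono) auto
  moreover have "\<theta> * \<nu> \<le> 0" using assms(1,2) by (simp add: mult_nonpos_nonneg)
  moreover have "B - w \<le> C * \<nu>\<^sup>2" "w - B \<le> C * \<nu>\<^sup>2" using assms(3) by (auto simp: abs_le_iff)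
  ultimately show "B \<le> 0" "11 / 10 * \<theta> * \<nu> \<le> B"
    using sq assms(4,5) by linarith+
qed

context adjoint_trajectory
begin

lemma selector_of_wins:
  fixes d u :: "real \<Rightarrow> real^'m"
  assumes "u t = axis m 1" "\<And>b. d t $ b = H b m t" "wins g m t a"
  shows "mode_selector (\<lambda>t. u t - g *\<^sub>R d t) t = axis a 1"
  by (rule mode_selector_winner) (use assms in \<open>auto simp: wins_def axis_def\<close>)

text \<open>
  Each interval of a regular partition is split at one further point \<open>e k g\<close>, so the breakpoints
  are \<open>p 0, e 0, p 1, e 1, \<dots>\<close>. A switching time that follows some \<open>p k\<close> is fixed; one that follows
  \<open>e k\<close> belongs to an interval with insertion, since elsewhere the mode does not change at \<open>e k\<close>.
  The control differs from \<open>u\<close> only between the ends \<open>p0\<close> and the points \<open>e k g\<close>, that is, between the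
  switching times and their limits.
\<close>

lemma switching_structure:
  fixes d u :: "real \<Rightarrow> real^'m" and Ts :: "real \<Rightarrow> nat \<Rightarrow> real"
  assumes th: "\<theta> < 0" "g0 = - 1 / \<theta>"
    and p: "p 0 = 0" "p n = T" and reg: "\<And>k. k < n \<Longrightarrow> regular_gap S' (p k) (p (Suc k)) (m k)"
    and dH: "\<And>k t b. k < n \<Longrightarrow> t \<in> {p k<..<p (Suc k)} \<Longrightarrow> d t $ b = H b (m k) t"
    and lower: "\<And>t b. t \<in> {0..T} \<Longrightarrow> \<theta> \<le> d t $ b"
    and N: "negligible N" and u: "\<And>t. t \<in> {0..T} - N \<Longrightarrow> u t = axis (c t) 1"
    and sched: "\<forall>\<^sub>F g in at_right g0. mode_schedule T M sg (Ts g) (mode_selector (\<lambda>t. u t - g *\<^sub>R d t))"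
  shows "\<And>i. i \<in> {1..<M} \<Longrightarrow> tracked_switch \<theta> g0 d sg Ts i"
    and "\<And>i. i \<in> {1..<M} \<Longrightarrow> ((\<lambda>g. Ts g i) \<longlongrightarrow> switch_limit g0 Ts i) (at_right g0)"
    and "\<forall>\<^sub>F g in at_right g0. \<forall>c' N'. piecewise_constant 0 T c' \<longrightarrow> negligible N' \<longrightarrow>
          (\<forall>t\<in>{0..T} - N'. mode_selector (\<lambda>t. u t - g *\<^sub>R d t) t = axis (c' t) 1) \<longrightarrow>
          integral {0..T} (mismatch c c') \<le> (\<Sum>i\<in>{1..<M}. \<bar>Ts g i - switch_limit g0 Ts i\<bar>)"
proof -
  have gap: "0 \<le> p k" "p k < p (Suc k)" "p (Suc k) \<le> T" "{p k<..<p (Suc k)} \<inter> S = {}"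
      "\<And>t. t \<in> {p k<..<p (Suc k)} \<Longrightarrow> c t = m k"
      "\<And>b t. b \<noteq> m k \<Longrightarrow> t \<in> {p k<..<p (Suc k)} \<Longrightarrow> H1 b (m k) t \<noteq> 0"
      "\<And>a b t. a \<noteq> b \<Longrightarrow> t \<in> {p k<..<p (Suc k)} \<Longrightarrow> H a b t \<noteq> 0" if "k < n" for k
    using reg[OF that] unfolding regular_gap_def by blast+
  define Q where "Q k e b1 b2 \<longleftrightarrow>
      (\<forall>\<^sub>F g in at_right g0. splits (p k) (p (Suc k)) (m k) (e g) b1 b2 g) \<and>
      (b1 = m k \<and> b2 = m k \<and> (\<forall>g. e g = (p k + p (Suc k)) / 2) \<or>
       (\<exists>a s p0. active_gap \<theta> g0 (p k) (p (Suc k)) (m k) e b1 b2 a s p0))" for k e b1 b2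
  have "\<exists>e b1 b2. Q k e b1 b2" if k: "k < n" for k
    unfolding Q_def
  proof (rule gap_breakpoint[OF th gap(1-5)[OF k] gap(6)[OF k] gap(7)[OF k]])
    show "\<theta> \<le> H b (m k) t" if "t \<in> {p k<..<p (Suc k)}" for b t
      using lower[of t b] dH[OF k that] that gap(1-3)[OF k] by simp
  qed auto
  then have "\<forall>k. \<exists>e b1 b2. k < n \<longrightarrow> Q k e b1 b2" by blast
  then obtain e b1 b2 where Q: "\<And>k. k < n \<Longrightarrow> Q k (e k) (b1 k) (b2 k)" by metis
  have ev: "\<forall>\<^sub>F g in at_right g0. \<forall>k\<in>{..<n}. splits (p k) (p (Suc k)) (m k) (e k g) (b1 k) (b2 k) g"
    using Q unfolding Q_def by (intro eventually_ball_finite) auto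
  have kinds: "b1 k = m k \<and> b2 k = m k \<and> (\<forall>g. e k g = (p k + p (Suc k)) / 2) \<or>
       (\<exists>a s p0. active_gap \<theta> g0 (p k) (p (Suc k)) (m k) (e k) (b1 k) (b2 k) a s p0)" if "k < n" for k
    using Q[OF that] unfolding Q_def by blast
  define v where "v g = mode_selector (\<lambda>t. u t - g *\<^sub>R d t)" for g
  \<comment> \<open>even breakpoints are the partition points, odd ones the points inside the pieces\<close>
  define q where "q g j = (if even j then p (j div 2) else e (j div 2) g)" for g j
  define b where "b j = (if even j then b1 (j div 2) else b2 (j div 2))" for j
  have u_gap: "u t = axis (m k) 1" if "k < n" "t \<in> {p k<..<p (Suc k)}" "t \<notin> N" for k t
    using u[of t] gap(1,3)[OF that(1)] gap(5)[OF that(1,2)] that by auto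
  have v_gap: "v g t = axis a 1"
    if "k < n" "t \<in> {p k<..<p (Suc k)}" "t \<notin> N" "wins g (m k) t a" for k t g a
    unfolding v_def by (rule selector_of_wins[where m = "m k"]) (use u_gap dH that in auto)
  have aeN: "AE t in lebesgue. t \<notin> N"
    using N by (intro AE_not_in) (simp add: negligible_iff_null_sets)
  have pm: "\<forall>\<^sub>F g in at_right g0. piecewise_modes (2 * n) (q g) b (v g)"
    using ev
  proof eventually_elim
    case (elim g)
    show ?case
      unfolding piecewise_modes_def
    proof (intro allI impI)
      fix j assume j: "j < 2 * n"
      define k where "k = j div 2"
      have k: "k < n" using j by (simp add: k_def)
      have el: "p k < e k g" "e k g < p (Suc k)"
        "\<And>t. t \<in> {p k<..<p (Suc k)} \<Longrightarrow> t < e k g \<Longrightarrow> wins g (m k) t (b1 k)"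
        "\<And>t. t \<in> {p k<..<p (Suc k)} \<Longrightarrow> e k g < t \<Longrightarrow> wins g (m k) t (b2 k)"
        using elim k by (auto simp: splits_def)
      show "q g j < q g (Suc j) \<and> (AE t in lebesgue. t \<in> {q g j<..<q g (Suc j)} \<longrightarrow> v g t = axis (b j) 1)"
      proof (cases "even j")
        case True
        then have qj: "q g j = p k" "q g (Suc j) = e k g" "b j = b1 k"
          by (auto simp: q_def b_def k_def elim: evenE)
        have "AE t in lebesgue. t \<in> {q g j<..<q g (Suc j)} \<longrightarrow> v g t = axis (b j) 1"
          using aeN unfolding qj by eventually_elim (use v_gap[OF k] el in auto)
        then show ?thesis using el qj by simp
      next
        case False
        then have qj: "q g j = e k g" "q g (Suc j) = p (Suc k)" "b j = b2 k"
          by (auto simp: q_def b_def k_def elim: oddE)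
        have "AE t in lebesgue. t \<in> {q g j<..<q g (Suc j)} \<longrightarrow> v g t = axis (b j) 1"
          using aeN unfolding qj by eventually_elim (use v_gap[OF k] el in auto)
        then show ?thesis using el qj by simp
      qed
    qed
  qed
  have "\<forall>\<^sub>F g in at_right g0. mode_schedule T M sg (Ts g) (v g) \<and>
      piecewise_modes (2 * n) (q g) b (v g) \<and> q g 0 = 0 \<and> q g (2 * n) = T"
    using sched[folded v_def] pm by eventually_elim (simp add: q_def p)
  then obtain idx where idx: "bij_betw idx {1..<M} (jumps (2 * n) b)"
    "\<And>i. i \<in> {1..<M} \<Longrightarrow> sg i = b (idx i - 1) \<and> sg (i + 1) = b (idx i)"
    "\<And>i. i \<in> {1..<M} \<Longrightarrow> \<forall>\<^sub>F g in at_right g0. Ts g i = q g (idx i)"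
    by (rule switching_times_follow_breakpoints[OF trivial_limit_at_right_real]) blast
  have e_in: "\<forall>\<^sub>F g in at_right g0. e k g \<in> {p k<..<p (Suc k)}" if "k < n" for k
    using ev by eventually_elim (use that in \<open>auto simp: splits_def\<close>)
  have odd_active: "switch_limit g0 Ts i = p0 \<and>
      (linear_switch \<theta> g0 d sg Ts i \<or> root_switch \<theta> g0 d sg Ts i \<or> 2 < switch_type g0 d sg Ts i) \<and>
      ((\<lambda>g. Ts g i) \<longlongrightarrow> p0) (at_right g0)"
    if i: "i \<in> {1..<M}" and k: "idx i = 2 * k + 1" "k < n"
      and act: "active_gap \<theta> g0 (p k) (p (Suc k)) (m k) (e k) (b1 k) (b2 k) a s p0" for i k a s p0
  proof -
    have Ts: "\<forall>\<^sub>F g in at_right g0. Ts g i = e k g"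
      using idx(3)[OF i] by eventually_elim (simp add: q_def k)
    have sg: "sg i = b1 k" "sg (i + 1) = b2 k" using idx(2)[OF i] by (auto simp: b_def k)
    note sw = active_switch[OF th(1) gap(1-4)[OF k(2)] gap(5)[OF k(2)] act e_in[OF k(2)],
        where Ts = Ts and i = i and sg = sg and d = d, OF _ Ts sg dH[OF k(2)]]
    have "(e k \<longlongrightarrow> p0) (at_right g0)" using act unfolding active_gap_def by blast
    then have "((\<lambda>g. Ts g i) \<longlongrightarrow> p0) (at_right g0)"
      by (rule Lim_transform_eventually) (use Ts in \<open>eventually_elim, simp\<close>)
    then show ?thesis using sw by auto
  qed
  have classify: "(fixed_switch g0 d sg Ts i \<and> (\<exists>y. \<forall>\<^sub>F g in at_right g0. Ts g i = y)) \<or>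
      (\<exists>k a s p0. idx i = 2 * k + 1 \<and> k < n \<and>
         active_gap \<theta> g0 (p k) (p (Suc k)) (m k) (e k) (b1 k) (b2 k) a s p0)" if i: "i \<in> {1..<M}" for i
  proof (cases "even (idx i)")
    case True
    have "\<forall>\<^sub>F g in at_right g0. Ts g i = p (idx i div 2)"
      using idx(3)[OF i] by eventually_elim (use True in \<open>simp add: q_def\<close>)
    then show ?thesis using fixed_switchI(1)[where Ts = Ts and i = i] by blast
  next
    case False
    define k where "k = idx i div 2"
    have j: "idx i \<in> jumps (2 * n) b" using idx(1) i by (auto simp: bij_betw_def)
    have ik: "idx i = 2 * k + 1" using False by (auto simp: k_def elim: oddE)
    have k: "k < n" using j ik by (auto simp: jumps_def)
    have "b1 k \<noteq> b2 k" using j ik by (auto simp: jumps_def b_def)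
    then show ?thesis using kinds[OF k] ik k by auto
  qed
  show "tracked_switch \<theta> g0 d sg Ts i" if i: "i \<in> {1..<M}" for i
    unfolding tracked_switch_def using classify[OF i] odd_active[OF i] by blast
  show "((\<lambda>g. Ts g i) \<longlongrightarrow> switch_limit g0 Ts i) (at_right g0)" if i: "i \<in> {1..<M}" for i
    using classify[OF i]
  proof (elim disjE conjE exE)
    fix y assume y: "\<forall>\<^sub>F g in at_right g0. Ts g i = y"
    show ?thesis
      unfolding fixed_switchI(2)[where Ts = Ts and i = i, OF y] by (rule tendsto_eventually[OF y])
  next
    fix k a s p0
    assume *: "idx i = 2 * k + 1" "k < n" "active_gap \<theta> g0 (p k) (p (Suc k)) (m k) (e k) (b1 k) (b2 k) a s p0"
    show ?thesis using odd_active[OF i *] by simp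
  qed
  have evTs: "\<forall>\<^sub>F g in at_right g0. \<forall>i\<in>{1..<M}. Ts g i = q g (idx i)"
    by (intro eventually_ball_finite) (use idx(3) in auto)
  show "\<forall>\<^sub>F g in at_right g0. \<forall>c' N'. piecewise_constant 0 T c' \<longrightarrow> negligible N' \<longrightarrow>
          (\<forall>t\<in>{0..T} - N'. mode_selector (\<lambda>t. u t - g *\<^sub>R d t) t = axis (c' t) 1) \<longrightarrow>
          integral {0..T} (mismatch c c') \<le> (\<Sum>i\<in>{1..<M}. \<bar>Ts g i - switch_limit g0 Ts i\<bar>)"
    using ev evTs
  proof (eventually_elim, intro allI impI)
    fix g c' N'
    assume el: "\<forall>k\<in>{..<n}. splits (p k) (p (Suc k)) (m k) (e k g) (b1 k) (b2 k) g"
      and Ts: "\<forall>i\<in>{1..<M}. Ts g i = q g (idx i)"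
      and c': "piecewise_constant 0 T c'" and N': "negligible N'"
      and v: "\<forall>t\<in>{0..T} - N'. mode_selector (\<lambda>t. u t - g *\<^sub>R d t) t = axis (c' t) 1"
    define Z where "Z = N \<union> N' \<union> p ` {..n} \<union> (\<lambda>k. e k g) ` {..<n}"
    have Z: "negligible Z" unfolding Z_def using N N' by (auto simp: negligible_finite)
    show "integral {0..T} (mismatch c c') \<le> (\<Sum>i\<in>{1..<M}. \<bar>Ts g i - switch_limit g0 Ts i\<bar>)"
    proof (rule mismatch_integral_le[OF c_piecewise c' finite_atLeastLessThan Z])
      fix t assume t: "t \<in> {0..T} - Z" and ne: "c t \<noteq> c' t"
      have "t \<noteq> p n" using t unfolding Z_def by auto
      then obtain k where k: "k < n" "p k \<le> t" "t < p (Suc k)"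
        using increasing_chain_locate[of p t n] t p by auto
      have "t \<noteq> p k" "t \<noteq> e k g" using t k unfolding Z_def by auto
      then have tk: "t \<in> {p k<..<p (Suc k)}" and "t < e k g \<or> e k g < t" using k by auto
      have ct: "c t = m k" by (rule gap(5)[OF k(1) tk])
      have v': "v g t = axis (c' t) 1" using v t unfolding v_def Z_def by auto
      have w1: "c' t = b1 k" if "t < e k g"
      proof -
        have "wins g (m k) t (b1 k)" using el k tk that by (auto simp: splits_def)
        then have "v g t = axis (b1 k) 1" using v_gap[OF k(1) tk] t unfolding Z_def by auto
        then show ?thesis using v' by (simp add: axis_eq_axis)
      qed
      have w2: "c' t = b2 k" if "e k g < t"
      proof -
        have "wins g (m k) t (b2 k)" using el k tk that by (auto simp: splits_def)
        then have "v g t = axis (b2 k) 1" using v_gap[OF k(1) tk] t unfolding Z_def by auto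
        then show ?thesis using v' by (simp add: axis_eq_axis)
      qed
      have "\<not> (b1 k = m k \<and> b2 k = m k)" using w1 w2 ne ct \<open>t < e k g \<or> e k g < t\<close> by auto
      then obtain a s p0 where act: "active_gap \<theta> g0 (p k) (p (Suc k)) (m k) (e k) (b1 k) (b2 k) a s p0"
        using kinds[OF k(1)] by blast
      then have am: "a \<noteq> m k" and s: "s = 1 \<and> p0 = p k \<and> b1 k = a \<and> b2 k = m k \<or>
          s = - 1 \<and> p0 = p (Suc k) \<and> b1 k = m k \<and> b2 k = a"
        unfolding active_gap_def by blast+
      have "2 * k + 1 \<in> jumps (2 * n) b" using s am k(1) by (auto simp: jumps_def b_def)
      then obtain i where i: "i \<in> {1..<M}" "idx i = 2 * k + 1"
        using idx(1) unfolding bij_betw_def by (metis imageE)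
      have lim: "switch_limit g0 Ts i = p0" using odd_active[OF i k(1) act] by blast
      have Tsi: "Ts g i = e k g" using Ts i by (simp add: q_def)
      have ek: "p k < e k g" "e k g < p (Suc k)" using el k by (auto simp: splits_def)
      have "t \<in> {min p0 (e k g)..max p0 (e k g)}"
        using s w1 w2 ne ct tk ek \<open>t < e k g \<or> e k g < t\<close> by auto
      then show "\<exists>i\<in>{1..<M}. t \<in> {min (switch_limit g0 Ts i) (Ts g i)..max (switch_limit g0 Ts i) (Ts g i)}"
        using i(1) lim Tsi by (intro bexI[of _ i]) auto
    qed
  qed
qed

end

theorem lemma8:
  fixes T :: real
    and x0 :: "real^'n"
    and f :: "'m::finite \<Rightarrow> real^'n \<Rightarrow> real^'n"
    and l :: "real^'n \<Rightarrow> real"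
    and K2 K2_bar :: real
    and x rho :: "real \<Rightarrow> real^'n"
    and u d :: "real \<Rightarrow> real^'m"
    and theta gamma0 \<delta> :: real
    and M :: nat
    and \<sigma> :: "nat \<Rightarrow> 'm"
    and Ts :: "real \<Rightarrow> nat \<Rightarrow> real"
    and J R :: "real \<Rightarrow> real"
    and Jhat :: "enat \<Rightarrow> real \<Rightarrow> real"
    and mbar :: enat
  assumes T_pos: "0 < T"
    and f_C2: "\<And>i. C2_bounded (f i) K2"
    and l_C2: "C2_bounded l K2_bar"
    and feasible: "(x, u) \<in> feasible_pairs T x0 f"
    and adjoint: "solves_adjoint_eq T f l x u rho"
    and d_eq: "d = mode_insertion_gradient f rho x u"
    and d_pc: "piecewise_continuous_on 0 T d"
    and d_crit: "\<And>i j. i \<noteq> j \<Longrightarrow> finite (critical_points T (\<lambda>t. d t $ i - d t $ j))"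
    and theta_eq: "theta = optimality_function T d"
    and theta_neg: "theta < 0"
    and gamma0_eq: "gamma0 = - 1 / theta"
    and delta_pos: "0 < \<delta>"
    and schedule: "\<And>\<gamma>. \<gamma> \<in> {gamma0<..<gamma0 + \<delta>} \<Longrightarrow>
          mode_schedule T M \<sigma> (Ts \<gamma>) (mode_selector (\<lambda>t. u t - \<gamma> *\<^sub>R d t))"
    and J_eq: "\<And>\<gamma>. J \<gamma> = cost T l (projection T x0 f x (\<lambda>t. u t - \<gamma> *\<^sub>R d t))"
    and Jhat_eq: "\<And>m \<gamma>. Jhat m \<gamma> = J_hat m (J 0) theta gamma0 d M \<sigma> Ts \<gamma>"
    and mbar_eq: "mbar = max_switch_type gamma0 d M \<sigma> Ts"
    and R_eq: "\<And>\<gamma>. J \<gamma> = Jhat mbar \<gamma> + R \<gamma>"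
    and mbar_12: "mbar = 1 \<or> mbar = 2"
  shows "\<exists>\<delta>\<gamma>>0. \<forall>\<gamma>\<in>{gamma0<..<gamma0 + \<delta>\<gamma>}.
           \<bar>Jhat mbar \<gamma> - J 0\<bar> \<ge> \<bar>R \<gamma>\<bar>"
proof -
  define C2 where "C2 i g' g'' \<longleftrightarrow> (\<forall>y. (f i has_derivative blinfun_apply (g' y)) (at y)) \<and>
      (\<forall>y. (g' has_derivative blinfun_apply (g'' y)) (at y)) \<and>
      continuous_on UNIV g'' \<and> (\<forall>y. norm (g'' y) \<le> K2)" for i g' g''
  have ex: "\<forall>i. \<exists>g' g''. C2 i g' g''"
    using f_C2 unfolding C2_bounded_def C2_def by (rule allI)
  from choice[OF ex] obtain f' where ex': "\<forall>i. \<exists>g''. C2 i (f' i) g''" by (rule exE)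
  from choice[OF ex'] obtain f'' where C2: "\<forall>i. C2 i (f' i) (f'' i)" by (rule exE)
  have f: "\<And>i y. (f i has_derivative blinfun_apply (f' i y)) (at y)"
      "\<And>i y. (f' i has_derivative blinfun_apply (f'' i y)) (at y)"
      "\<And>i. continuous_on UNIV (f'' i)" "\<And>i y. norm (f'' i y) \<le> K2"
    using C2 unfolding C2_def by blast+
  obtain l' l'' where l: "\<And>y. (l has_derivative blinfun_apply (l' y)) (at y)"
      "\<And>y. (l' has_derivative blinfun_apply (l'' y)) (at y)"
      "continuous_on UNIV l''" "\<And>y. norm (l'' y) \<le> K2_bar"
    using l_C2 unfolding C2_bounded_def by blast
  have "u \<in> non_chattering_controls T" and state_u: "solves_state_eq T x0 f u x"
    using feasible unfolding feasible_pairs_def by auto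
  then obtain M0 sg0 s0 where "mode_schedule T M0 sg0 s0 u"
    unfolding non_chattering_controls_def by blast
  then obtain c N where c: "piecewise_constant 0 T c" and N: "negligible N"
      and u: "\<And>t. t \<in> {0..T} - N \<Longrightarrow> u t = axis (c t) 1"
    by (rule mode_schedule_mode_function) blast
  obtain S where S: "finite S" "\<And>t. t \<in> {0..T} - S \<Longrightarrow> \<forall>\<^sub>F s in nhds t. c s = c t"
    using c unfolding piecewise_constant_def by blast
  \<comment> \<open>Off the null set \<open>N\<close> the control is a unit vector, so \<open>F f y (u s)\<close> is the mode \<open>c s\<close> at \<open>y\<close>.\<close>
  have costate: "((\<lambda>s. adjoint (f' (c s) (x s)) (rho s) + adjoint (l' (x s)) 1) has_integral rho t) {t..T}"
    if t: "t \<in> {0..T}" for t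
  proof (rule has_integral_spike[OF N])
    show "((\<lambda>s. adjoint (frechet_derivative (\<lambda>y. F f y (u s)) (at (x s))) (rho s)
           + adjoint (frechet_derivative l (at (x s))) 1) has_integral rho t) {t..T}"
      using adjoint t unfolding solves_adjoint_eq_def by blast
    fix s assume "s \<in> {t..T} - N"
    then have us: "u s = axis (c s) 1" using t by (intro u) auto
    have "frechet_derivative (f (c s)) (at (x s)) = blinfun_apply (f' (c s) (x s))"
      using frechet_derivative_at[OF f(1)] by simp
    moreover have "frechet_derivative l (at (x s)) = blinfun_apply (l' (x s))"
      using frechet_derivative_at[OF l(1)] by simp
    ultimately show "adjoint (f' (c s) (x s)) (rho s) + adjoint (l' (x s)) 1 =
        adjoint (frechet_derivative (\<lambda>y. F f y (u s)) (at (x s))) (rho s)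
           + adjoint (frechet_derivative l (at (x s))) 1"
      unfolding us F_axis by simp
  qed
  have state: "((\<lambda>s. f (c s) (x s)) has_integral (x t - x0)) {0..t}" if "t \<in> {0..T}" for t
    using state_u that solves_state_eq_mode_function[of N T u c x0 f x, OF N u] by blast
  have tr: "adjoint_trajectory T K2 K2_bar f f' f'' l l' l'' c S x0 x rho"
    by unfold_locales (use T_pos f l S state costate in auto)
  interpret adjoint_trajectory T K2 K2_bar f f' f'' l l' l'' c S x0 x rho by (rule tr)
  have d_diff: "d t $ i - d t $ j = H i j t" for t i j
    unfolding d_eq mode_insertion_gradient_def H_def by (simp add: inner_diff_right)
  have d_good: "d t $ b = H b (c t) t" if "t \<in> {0..T} - N" for t b
    unfolding d_eq mode_insertion_gradient_def H_def by (simp add: u[OF that] F_axis)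
  obtain Sd where Sd: "finite Sd" "continuous_on ({0..T} - Sd) d"
    using d_pc unfolding piecewise_continuous_on_def by blast
  have crit: "finite (critical_points T (H i j))" if "i \<noteq> j" for i j
    using d_crit[OF that] unfolding d_diff .
  obtain n p m where p: "p 0 = 0" "p n = T" and reg: "\<forall>k<n. regular_gap Sd (p k) (p (Suc k)) (m k)"
    by (rule regular_partition[OF crit Sd(1)]) (assumption, rule that)
  \<comment> \<open>Both sides are continuous between partition points and agree off a null set.\<close>
  have d_gap: "d t $ b = H b (m k) t" if k: "k < n" and t: "t \<in> {p k<..<p (Suc k)}" for k t b
  proof (rule continuous_eq_off_negligible[OF open_greaterThanLessThan _ _ N _ t])
    have g: "0 \<le> p k" "p (Suc k) \<le> T" "{p k<..<p (Suc k)} \<inter> Sd = {}"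
        "\<And>s. s \<in> {p k<..<p (Suc k)} \<Longrightarrow> c s = m k"
      using reg[rule_format, OF k] unfolding regular_gap_def by blast+
    have sub: "{p k<..<p (Suc k)} \<subseteq> {0..T} - Sd" using g by auto
    show "continuous_on {p k<..<p (Suc k)} (\<lambda>t. d t $ b)"
      by (intro continuous_intros continuous_on_subset[OF Sd(2) sub])
    show "continuous_on {p k<..<p (Suc k)} (H b (m k))"
      using sub by (intro continuous_on_subset[OF H_continuous]) auto
    show "d s $ b = H b (m k) s" if "s \<in> {p k<..<p (Suc k)} - N" for s
      using d_good[of s b] g that by auto
  qed
  have in_gap: "\<exists>k<n. t \<in> {p k<..<p (Suc k)}" if t: "t \<in> {0..T} - p ` {..n}" for t
  proof -
    have "t \<noteq> p n" using t by auto
    then obtain k where k: "k < n" "p k \<le> t" "t < p (Suc k)"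
      using increasing_chain_locate[of p t n] t p by auto
    have "t \<noteq> p k" using t k by auto
    then show ?thesis using k by auto
  qed
  obtain B where B: "\<And>i t. t \<in> {0..T} \<Longrightarrow> norm (H (fst i) (snd i) t) \<le> B"
    by (rule bounded_along_trajectory[where G = "\<lambda>i :: 'm \<times> 'm. H (fst i) (snd i)"])
      (rule H_continuous, blast)
  \<comment> \<open>At the finitely many partition points \<open>u\<close>, and hence \<open>d\<close>, may take arbitrary values.\<close>
  have "bdd_below ((\<lambda>(a, t). d t $ a) ` (UNIV \<times> {0..T}))"
  proof (rule bdd_below_mono)
    show "bdd_below ((\<lambda>(a, t). d t $ a) ` (UNIV \<times> p ` {..n}) \<union> {- B..})"
      by simp
    show "(\<lambda>(a, t). d t $ a) ` (UNIV \<times> {0..T}) \<subseteq> (\<lambda>(a, t). d t $ a) ` (UNIV \<times> p ` {..n}) \<union> {- B..}"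
    proof
      fix y assume "y \<in> (\<lambda>(a, t). d t $ a) ` (UNIV \<times> {0..T})"
      then obtain a t where t: "t \<in> {0..T}" and y: "y = d t $ a" by auto
      show "y \<in> (\<lambda>(a, t). d t $ a) ` (UNIV \<times> p ` {..n}) \<union> {- B..}"
      proof (cases "t \<in> p ` {..n}")
        case False
        then obtain k where k: "k < n" "t \<in> {p k<..<p (Suc k)}" using in_gap[of t] t by blast
        have "\<bar>d t $ a\<bar> \<le> B" using d_gap[OF k] B[OF t, of "(a, m k)"] by simp
        then show ?thesis unfolding y by auto
      qed (use y in force)
    qed
  qed
  then have lower: "theta \<le> d t $ b" if "t \<in> {0..T}" for t b
    unfolding theta_eq optimality_function_def
    using cINF_lower[of "\<lambda>(a, t). d t $ a" "UNIV \<times> {0..T}" "(b, t)"] that by simp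
  have g0: "0 < gamma0" using theta_neg gamma0_eq by (simp add: divide_neg_neg)
  have dom: "\<forall>\<^sub>F \<gamma> in at_right gamma0. \<gamma> \<in> {gamma0<..<gamma0 + \<delta>}"
    using eventually_at_right_real[of gamma0 "gamma0 + \<delta>"] delta_pos by simp
  then have sched: "\<forall>\<^sub>F \<gamma> in at_right gamma0.
      mode_schedule T M \<sigma> (Ts \<gamma>) (mode_selector (\<lambda>t. u t - \<gamma> *\<^sub>R d t))"
    by eventually_elim (rule schedule)
  note struct = switching_structure[OF theta_neg gamma0_eq p reg[rule_format] d_gap lower N u sched]
  have changed: "\<forall>\<^sub>F \<gamma> in at_right gamma0. \<forall>c' N'. piecewise_constant 0 T c' \<longrightarrow> negligible N' \<longrightarrow>
      (\<forall>t\<in>{0..T} - N'. mode_selector (\<lambda>t. u t - \<gamma> *\<^sub>R d t) t = axis (c' t) 1) \<longrightarrow>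
      integral {0..T} (mismatch c c') \<le> (\<Sum>i\<in>{1..<M}. \<bar>Ts \<gamma> i - switch_limit gamma0 Ts i\<bar>)"
    by (rule struct(3))
  define D where "D \<gamma> = (\<Sum>i\<in>{1..<M}. \<bar>Ts \<gamma> i - switch_limit gamma0 Ts i\<bar>)" for \<gamma>
  have D_lim: "(D \<longlongrightarrow> 0) (at_right gamma0)"
  proof -
    have "((\<lambda>\<gamma>. \<Sum>i\<in>{1..<M}. \<bar>Ts \<gamma> i - switch_limit gamma0 Ts i\<bar>) \<longlongrightarrow>
        (\<Sum>i\<in>{1..<M}. \<bar>switch_limit gamma0 Ts i - switch_limit gamma0 Ts i\<bar>)) (at_right gamma0)"
      by (intro tendsto_intros struct(2))
    then show ?thesis by (simp add: D_def[abs_def])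
  qed
  obtain C \<epsilon>0 where C: "0 < \<epsilon>0" "0 \<le> C"
    and expand: "\<And>mu c' N. piecewise_constant 0 T c' \<Longrightarrow> negligible N \<Longrightarrow>
       (\<forall>t\<in>{0..T} - N. mode_selector mu t = axis (c' t) 1) \<Longrightarrow>
       integral {0..T} (mismatch c c') \<le> \<epsilon>0 \<Longrightarrow>
       \<bar>cost T l (projection T x0 f x mu) - integral {0..T} (\<lambda>t. l (x t))
         - integral {0..T} (\<lambda>t. rho t \<bullet> (f (c' t) (x t) - f (c t) (x t)))\<bar>
       \<le> C * (integral {0..T} (mismatch c c'))\<^sup>2"
    using projection_cost_expansion[OF tr, of x] by blast
  \<comment> \<open>For \<open>\<gamma> = 0\<close> the selected control is \<open>u\<close> itself up to a null set.\<close>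
  have J0: "J 0 = integral {0..T} (\<lambda>t. l (x t))"
  proof -
    have sel: "mode_selector (\<lambda>t. u t - 0 *\<^sub>R d t) t = axis (c t) 1" if "t \<in> {0..T} - N" for t
      by (rule mode_selector_winner) (simp add: u[OF that] axis_def)
    have "mismatch c c = (\<lambda>t. 0)" by (auto simp: mismatch_def)
    then show ?thesis
      using expand[OF c N ballI[OF sel]] C unfolding J_eq by simp
  qed
  \<comment> \<open>leaves room for the quadratic error within the factor 11/10\<close>
  have ev_small: "\<forall>\<^sub>F \<gamma> in at_right gamma0. D \<gamma> < \<epsilon>0 \<and> C * D \<gamma> < - theta / 10"
  proof -
    have "((\<lambda>\<gamma>. C * D \<gamma>) \<longlongrightarrow> C * 0) (at_right gamma0)" by (intro tendsto_intros D_lim)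
    then have "\<forall>\<^sub>F \<gamma> in at_right gamma0. C * D \<gamma> < - theta / 10"
      by (rule order_tendstoD(2)) (use theta_neg in simp)
    moreover have "\<forall>\<^sub>F \<gamma> in at_right gamma0. D \<gamma> < \<epsilon>0" by (rule order_tendstoD(2)[OF D_lim C(1)])
    ultimately show ?thesis by eventually_elim simp
  qed
  have ev_thr: "\<forall>\<^sub>F \<gamma> in at_right gamma0. - 1 / \<gamma> < theta / 2"
    by (rule order_tendstoD(2)[OF threshold_tendsto[OF theta_neg gamma0_eq]]) (use theta_neg in simp)
  have ev_dom: "\<forall>\<^sub>F \<gamma> in at_right gamma0. - theta * D \<gamma> \<le> 6 / 5 * (J 0 - Jhat mbar \<gamma>)"
    unfolding D_def Jhat_eq
    by (rule predicted_decrease_dominates[OF theta_neg struct(1) mbar_eq mbar_12])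
  have "\<forall>\<^sub>F \<gamma> in at_right gamma0. \<bar>R \<gamma>\<bar> \<le> \<bar>Jhat mbar \<gamma> - J 0\<bar>"
    using dom sched ev_small ev_thr ev_dom changed
  proof eventually_elim
    case (elim \<gamma>)
    have gpos: "0 < \<gamma>" using elim(1) g0 by simp
    obtain c' N' where c': "piecewise_constant 0 T c'" and N': "negligible N'"
      and v: "\<And>t. t \<in> {0..T} - N' \<Longrightarrow> mode_selector (\<lambda>t. u t - \<gamma> *\<^sub>R d t) t = axis (c' t) 1"
      using mode_schedule_mode_function[OF elim(2)] by blast
    \<comment> \<open>the time during which the projected control differs from \<open>u\<close>\<close>
    define \<nu> where "\<nu> = integral {0..T} (mismatch c c')"
    define w where "w t = rho t \<bullet> (f (c' t) (x t) - f (c t) (x t))" for t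
    have im: "mismatch c c' integrable_on {0..T}" by (rule integrable_mismatch[OF c c'])
    have \<nu>0: "0 \<le> \<nu>" unfolding \<nu>_def by (intro integral_nonneg im mismatch_bounds)
    have \<nu>D: "\<nu> \<le> D \<gamma>" unfolding \<nu>_def D_def using elim(6) c' N' v by blast
    have "\<nu> \<le> \<epsilon>0" using \<nu>D elim(3) by simp
    then have est: "\<bar>J \<gamma> - J 0 - integral {0..T} w\<bar> \<le> C * \<nu>\<^sup>2"
      using expand[OF c' N' ballI[OF v]] unfolding \<nu>_def J0 J_eq[of \<gamma>] w_def by simp
    have iw: "w integrable_on {0..T}"
    proof -
      have "(\<lambda>t. (\<lambda>p t. rho t \<bullet> (f (snd p) (x t) - f (fst p) (x t))) (c t, c' t) t) integrable_on {0..T}"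
        by (rule integrable_piecewise[OF piecewise_constant_Pair[OF c c']])
          (intro continuous_intros rho_continuous fx_continuous)
      then show ?thesis by (simp add: w_def[abs_def])
    qed
    have NN: "negligible (N \<union> N')" using N N' by simp
    have w_bounds: "theta * mismatch c c' t \<le> w t \<and> w t \<le> - 1 / \<gamma> * mismatch c c' t"
      if t: "t \<in> {0..T} - (N \<union> N')" for t
    proof (cases "c t = c' t")
      case False
      have wd: "w t = d t $ c' t" using d_good[of t "c' t"] t unfolding w_def H_def by simp
      \<comment> \<open>The selected mode beats the current one, for which \<open>d\<close> vanishes and \<open>u - \<gamma> d\<close> is 1.\<close>
      have "(u t - \<gamma> *\<^sub>R d t) $ c t \<le> (u t - \<gamma> *\<^sub>R d t) $ c' t"
        using mode_selector_maximal[of "\<lambda>t. u t - \<gamma> *\<^sub>R d t" t "c' t" "c t"] v[of t] t by simp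
      then have "1 \<le> - (\<gamma> * d t $ c' t)"
        using False d_good[of t "c t"] u[of t] t by (simp add: axis_def)
      then have "d t $ c' t \<le> - 1 / \<gamma>" using gpos by (simp add: field_simps)
      then show ?thesis using lower[of t "c' t"] t False wd by (simp add: mismatch_def)
    qed (simp add: mismatch_def w_def)
    have "theta * \<nu> = integral {0..T} (\<lambda>t. theta * mismatch c c' t)" unfolding \<nu>_def by simp
    also have "\<dots> \<le> integral {0..T} w"
      by (rule integral_le_off_negligible[OF integrable_on_cmult_left[OF im, simplified] iw NN])
        (use w_bounds in blast)
    finally have lo: "theta * \<nu> \<le> integral {0..T} w" .
    have "integral {0..T} w \<le> integral {0..T} (\<lambda>t. - 1 / \<gamma> * mismatch c c' t)"
      by (rule integral_le_off_negligible[OF iw integrable_on_cmult_left[OF im, simplified] NN])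
        (use w_bounds in blast)
    also have "\<dots> = - 1 / \<gamma> * \<nu>" unfolding \<nu>_def by (rule integral_mult_right)
    finally have hi: "integral {0..T} w \<le> - 1 / \<gamma> * \<nu>" .
    have "C * \<nu> \<le> C * D \<gamma>" by (rule mult_left_mono[OF \<nu>D C(2)])
    then have small: "C * \<nu> \<le> - theta / 10" using elim(3) by simp
    note B = cost_change_bounds[OF theta_neg \<nu>0 est lo hi elim(4) small]
    have "- theta * \<nu> \<le> - theta * D \<gamma>" using \<nu>D theta_neg by (intro mult_left_mono) auto
    then have "- theta * \<nu> \<le> 6 / 5 * (J 0 - Jhat mbar \<gamma>)" "0 \<le> - theta * \<nu>"
      using elim(5) theta_neg \<nu>0 by (linarith, simp add: mult_nonpos_nonneg)
    moreover define z where "z = theta * \<nu>"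
    ultimately have "- z \<le> 6 / 5 * (J 0 - Jhat mbar \<gamma>)" "z \<le> 0" "11 / 10 * z \<le> J \<gamma> - J 0"
      using B(2) by (simp_all add: z_def mult.assoc)
    moreover define A where "A = J 0 - Jhat mbar \<gamma>"
    moreover define \<Delta> where "\<Delta> = J \<gamma> - J 0"
    ultimately have "- z \<le> 6 / 5 * A" "z \<le> 0" "11 / 10 * z \<le> \<Delta>" "\<Delta> \<le> 0" "R \<gamma> = \<Delta> + A"
      using B(1) R_eq[of \<gamma>] by auto
    then have "\<bar>R \<gamma>\<bar> \<le> A" by linarith
    then show ?case unfolding A_def by linarith
  qed
  then obtain b where b: "gamma0 < b" "\<And>\<gamma>. gamma0 < \<gamma> \<Longrightarrow> \<gamma> < b \<Longrightarrow> \<bar>R \<gamma>\<bar> \<le> \<bar>Jhat mbar \<gamma> - J 0\<bar>"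
    unfolding eventually_at_right_field by blast
  show ?thesis
    by (rule exI[of _ "b - gamma0"]) (use b in auto)
qed

end
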